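(* Let $X^L$ be an $\mathbb{R}^d$-valued Lamperti stable Lévy process with characteristics $(\alpha,f,\sigma,0)$ and let $$\eta_\alpha=\int_{S^{d-1}}\xi\,\sigma(d\xi)\int_1^\infty re^{f(\xi)r}(e^r-1)^{-(\alpha+1)}dr.$$ Then $$\Big(h^{-1/2}\big(X^L_{ht}-ht\,\eta_\alpha\big),\ t>0\Big)\overset{d}{\longrightarrow}(W_t,\ t>0)\qquad\text{as }h\to\infty,$$ where $(W_t,t>0)$ is a centered Brownian motion with covariance matrix $\displaystyle\int_{\mathbb{R}^d_0}xx'\,\nu^{\alpha,f}_\sigma(dx)$ ($x'$ denoting the transpose of the column vector $x$).
   Context: Let $\alpha\in(0,2)$, let $\sigma$ be a non-zero finite measure on the unit sphere $S^{d-1}\subset\mathbb{R}^d$, and let $f:S^{d-1}\to\mathbb{R}$ be measurable with $\sup_{\xi}f(\xi)<\alpha+1$. Define the Lévy measure on $\mathbb{R}^d_0=\mathbb{R}^d\setminus\{0\}$ $$\nu^{\alpha,f}_\sigma(B)=\int_{S^{d-1}}\sigma(d\xi)\int_0^\infty1_B(r\xi)e^{rf(\xi)}(e^r-1)^{-(\alpha+1)}dr.$$ A Lévy process $X^L$ on $\mathbb{R}^d$ (started at $0$) is Lamperti stable with characteristics $(\alpha,f,\sigma,\theta)$, $\theta\in\mathbb{R}^d$, if it has no Gaussian component and $E[e^{i\langle y,X^L_t\rangle}]=e^{-t\Psi(y)}$ with $$\Psi(y)=i\langle y,\theta\rangle+\int_{\mathbb{R}^d_0}\big(1-e^{i\langle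 y,x\rangle}+i\langle y,x\rangle1_{\{\|x\|<1\}}\big)\nu^{\alpha,f}_\sigma(dx).$$ The convergence $\overset{d}{\to}$ is weak convergence of the laws of the processes on the Skorokhod space. *)

theory Defs
  imports "HOL-Probability.Probability"
begin

section \<open>The Skorokhod space $D([0,\infty), E)$\<close>

definition cadlag :: "(real \<Rightarrow> 'a::topological_space) \<Rightarrow> bool" where
  "cadlag x \<longleftrightarrow>
     (\<forall>t\<ge>0. (x \<longlongrightarrow> x t) (at_right t)) \<and>
     (\<forall>t>0. \<exists>l. (x \<longlongrightarrow> l) (at_left t))"

text \<open>Paths are indexed by $[0,\infty)$; they are total functions that take the fixed value
  \<^term>\<open>undefined\<close> at negative times.\<close>

definition skorokhod_paths :: "(real \<Rightarrow> 'a::topological_space) set" where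
  "skorokhod_paths = {x \<in> extensional {0..}. cadlag x}"

definition time_change :: "(real \<Rightarrow> real) \<Rightarrow> bool" where
  "time_change l \<longleftrightarrow>
     strict_mono_on {0..} l \<and> continuous_on {0..} l \<and> l ` {0..} = {0..}"

text \<open>J1 convergence of a sequence of paths on $[0,\infty)$, as in Jacod and Shiryaev,
  Limit Theorems for Stochastic Processes, Theorem VI.1.14.\<close>

definition J1_converges ::
    "(nat \<Rightarrow> real \<Rightarrow> 'a::metric_space) \<Rightarrow> (real \<Rightarrow> 'a) \<Rightarrow> bool" where
  "J1_converges xs x \<longleftrightarrow>
     (\<exists>l. (\<forall>n. time_change (l n)) \<and>
          uniform_limit {0..} l (\<lambda>s. s) sequentially \<and>
          (\<forall>T. uniform_limit {0..T} (\<lambda>n s. xs n (l n s)) x sequentially))"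

text \<open>The Skorokhod (J1) topology is metrizable, so its open sets are exactly the sets that are
  sequentially open for J1 convergence.\<close>

definition skorokhod_topology :: "(real \<Rightarrow> 'a::metric_space) topology" where
  "skorokhod_topology = topology (\<lambda>U. U \<subseteq> skorokhod_paths \<and>
     (\<forall>x\<in>U. \<forall>xs. range xs \<subseteq> skorokhod_paths \<and> J1_converges xs x \<longrightarrow>
        (\<forall>\<^sub>F n in sequentially. xs n \<in> U)))"

lemma openin_skorokhod_topology:
  "openin skorokhod_topology U \<longleftrightarrow> U \<subseteq> skorokhod_paths \<and>
     (\<forall>x\<in>U. \<forall>xs. range xs \<subseteq> skorokhod_paths \<and> J1_converges xs x \<longrightarrow>
        (\<forall>\<^sub>F n in sequentially. xs n \<in> U))"
proof -
  define P :: "(real \<Rightarrow> 'a) set \<Rightarrow> bool" where "P = (\<lambda>U. U \<subseteq> skorokhod_paths \<and>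
     (\<forall>x\<in>U. \<forall>xs. range xs \<subseteq> skorokhod_paths \<and> J1_converges xs x \<longrightarrow>
        (\<forall>\<^sub>F n in sequentially. xs n \<in> U)))"
  have "P (S \<inter> T)" if "P S" "P T" for S T
    using that unfolding P_def by (auto intro!: eventually_conj)
  moreover have "P (\<Union>K)" if K: "\<forall>S\<in>K. P S" for K
    unfolding P_def
  proof (intro conjI ballI allI impI)
    show "\<Union>K \<subseteq> skorokhod_paths"
      using K unfolding P_def by blast
    fix x xs assume "x \<in> \<Union>K" and xs: "range xs \<subseteq> skorokhod_paths \<and> J1_converges xs x"
    then obtain S where S: "S \<in> K" "x \<in> S" by blast
    with K xs have "\<forall>\<^sub>F n in sequentially. xs n \<in> S"
      unfolding P_def by blast
    then show "\<forall>\<^sub>F n in sequentially. xs n \<in> \<Union>K"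
      by eventually_elim (use S in blast)
  qed
  ultimately have "istopology P"
    unfolding istopology_def by blast
  then show ?thesis
    unfolding skorokhod_topology_def P_def by (subst topology_inverse') auto
qed

lemma topspace_skorokhod_topology [simp]: "topspace skorokhod_topology = skorokhod_paths"
proof (rule antisym)
  show "topspace skorokhod_topology \<subseteq> skorokhod_paths"
    using openin_topspace[of skorokhod_topology] unfolding openin_skorokhod_topology by blast
  have "openin skorokhod_topology skorokhod_paths"
    unfolding openin_skorokhod_topology by (auto intro!: always_eventually)
  then show "skorokhod_paths \<subseteq> topspace skorokhod_topology"
    by (rule openin_subset)
qed

text \<open>The \<open>\<sigma>\<close>-algebra generated by the coordinate projections. For Euclidean state spaces it
  coincides with the Borel \<open>\<sigma>\<close>-algebra of the Skorokhod topology.\<close>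

definition skorokhod_algebra :: "(real \<Rightarrow> 'a::euclidean_space) measure" where
  "skorokhod_algebra = restrict_space (PiM {0..} (\<lambda>_. borel)) skorokhod_paths"

definition path_law ::
    "'w measure \<Rightarrow> (real \<Rightarrow> 'w \<Rightarrow> 'a::euclidean_space) \<Rightarrow> (real \<Rightarrow> 'a) measure" where
  "path_law M X = distr M skorokhod_algebra (\<lambda>\<omega>. \<lambda>t\<in>{0..}. X t \<omega>)"

definition skorokhod_weak_conv ::
    "('i \<Rightarrow> (real \<Rightarrow> 'a::euclidean_space) measure) \<Rightarrow> (real \<Rightarrow> 'a) measure \<Rightarrow> 'i filter \<Rightarrow> bool" where
  "skorokhod_weak_conv \<mu>s \<mu> F \<longleftrightarrow>
     (\<forall>\<phi>. continuous_map skorokhod_topology euclideanreal \<phi> \<and> bounded (\<phi> ` skorokhod_paths) \<longrightarrow>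
        ((\<lambda>i. integral\<^sup>L (\<mu>s i) \<phi>) \<longlongrightarrow> integral\<^sup>L \<mu> \<phi>) F)"


section \<open>Levy processes and Brownian motion\<close>

definition independent_increments ::
    "'w measure \<Rightarrow> (real \<Rightarrow> 'w \<Rightarrow> 'a::euclidean_space) \<Rightarrow> bool" where
  "independent_increments M X \<longleftrightarrow>
     (\<forall>(n::nat) t. 0 \<le> t 0 \<and> mono_on {..n} t \<longrightarrow>
        prob_space.indep_vars M (\<lambda>_. borel) (\<lambda>i \<omega>. X (t (Suc i)) \<omega> - X (t i) \<omega>) {..<n})"

definition levy_process ::
    "'w measure \<Rightarrow> (real \<Rightarrow> 'w \<Rightarrow> 'a::euclidean_space) \<Rightarrow> bool" where
  "levy_process M X \<longleftrightarrow>
     prob_space M \<and>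
     (\<forall>t\<ge>0. X t \<in> borel_measurable M) \<and>
     (AE \<omega> in M. X 0 \<omega> = 0) \<and>
     (\<forall>\<omega>\<in>space M. cadlag (\<lambda>t. X t \<omega>)) \<and>
     independent_increments M X \<and>
     (\<forall>s\<ge>0. \<forall>t\<ge>0.
        distr M borel (\<lambda>\<omega>. X (s + t) \<omega> - X s \<omega>) = distr M borel (\<lambda>\<omega>. X t \<omega> - X 0 \<omega>))"

text \<open>Centered Gaussian laws are given by their characteristic function, so that singular
  covariance matrices are allowed.\<close>

definition centered_gaussian :: "real ^ 'd ^ 'd \<Rightarrow> (real ^ 'd) measure \<Rightarrow> bool" where
  "centered_gaussian C \<mu> \<longleftrightarrow>
     (\<forall>y. (LINT x|\<mu>. iexp (y \<bullet> x)) = complex_of_real (exp (- (y \<bullet> (C *v y)) / 2)))"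

definition centered_brownian_motion ::
    "'w measure \<Rightarrow> (real \<Rightarrow> 'w \<Rightarrow> real ^ 'd) \<Rightarrow> real ^ 'd ^ 'd \<Rightarrow> bool" where
  "centered_brownian_motion M W C \<longleftrightarrow>
     prob_space M \<and>
     (\<forall>t\<ge>0. W t \<in> borel_measurable M) \<and>
     (AE \<omega> in M. W 0 \<omega> = 0) \<and>
     (\<forall>\<omega>\<in>space M. continuous_on {0..} (\<lambda>t. W t \<omega>)) \<and>
     independent_increments M W \<and>
     (\<forall>s t. 0 \<le> s \<and> s \<le> t \<longrightarrow>
        centered_gaussian ((t - s) *\<^sub>R C) (distr M borel (\<lambda>\<omega>. W t \<omega> - W s \<omega>)))"


section \<open>Lamperti stable processes\<close>

text \<open>The density of the radial part.\<close>

definition lamperti_density :: "real \<Rightarrow> real \<Rightarrow> real \<Rightarrow> real" where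
  "lamperti_density \<alpha> c r = exp (r * c) * (exp r - 1) powr (- (\<alpha> + 1))"

definition lamperti_levy_measure ::
    "real \<Rightarrow> (real ^ 'd \<Rightarrow> real) \<Rightarrow> (real ^ 'd) measure \<Rightarrow> (real ^ 'd) measure" where
  "lamperti_levy_measure \<alpha> f \<sigma> =
     measure_of (- {0}) (sets (restrict_space borel (- {0})))
       (\<lambda>B. \<integral>\<^sup>+\<xi>. (\<integral>\<^sup>+r\<in>{0<..}. indicator B (r *\<^sub>R \<xi>) * ennreal (lamperti_density \<alpha> (f \<xi>) r) \<partial>lborel) \<partial>\<sigma>)"

lemma emeasure_lamperti_levy_measure:
  fixes f :: "real ^ 'd \<Rightarrow> real"
  assumes sets_\<sigma>: "sets \<sigma> = sets (restrict_space borel (sphere 0 1))"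
    and f [measurable]: "f \<in> borel_measurable \<sigma>"
    and B: "B \<in> sets borel" "0 \<notin> B"
  shows "emeasure (lamperti_levy_measure \<alpha> f \<sigma>) B =
    (\<integral>\<^sup>+\<xi>. (\<integral>\<^sup>+r\<in>{0<..}. indicator B (r *\<^sub>R \<xi>) * ennreal (lamperti_density \<alpha> (f \<xi>) r) \<partial>lborel) \<partial>\<sigma>)"
    (is "_ = ?\<mu> B")
proof -
  let ?A = "sets (restrict_space borel (- {0::real ^ 'd}))"
  have A: "A \<in> ?A \<longleftrightarrow> A \<in> sets borel \<and> 0 \<notin> A" for A
    by (subst sets_restrict_space_iff) auto
  have sub: "?A \<subseteq> Pow (- {0})"
    by (auto simp: A)
  have "space (restrict_space borel (- {0::real ^ 'd})) = - {0}"
    by (simp add: space_restrict_space)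
  then have sigma_A: "sigma_sets (- {0}) ?A = ?A"
    using sets.sigma_sets_eq[of "restrict_space borel (- {0::real ^ 'd})"] by simp
  have [measurable]: "(\<lambda>\<xi>. \<xi>) \<in> borel_measurable \<sigma>"
    by (subst measurable_cong_sets[OF sets_\<sigma> refl]) (intro measurable_restrict_space1; simp)
  have meas: "(\<lambda>(\<xi>, r). indicator A (r *\<^sub>R \<xi>) * ennreal (lamperti_density \<alpha> (f \<xi>) r) * indicator {0<..} r)
      \<in> borel_measurable (\<sigma> \<Otimes>\<^sub>M lborel)" if [measurable]: "A \<in> sets borel" for A
    unfolding lamperti_density_def by measurable
  have inner: "(\<lambda>\<xi>. \<integral>\<^sup>+r\<in>{0<..}. indicator A (r *\<^sub>R \<xi>) * ennreal (lamperti_density \<alpha> (f \<xi>) r) \<partial>lborel)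
      \<in> borel_measurable \<sigma>" if "A \<in> sets borel" for A
    using lborel.borel_measurable_nn_integral[OF meas[OF that]] by simp
  have inner': "(\<lambda>r. indicator A (r *\<^sub>R \<xi>) * ennreal (lamperti_density \<alpha> (f \<xi>) r) * indicator {0<..} r)
      \<in> borel_measurable lborel" if [measurable]: "A \<in> sets borel" for A \<xi>
    unfolding lamperti_density_def by measurable
  have "countably_additive ?A ?\<mu>"
  proof (rule countably_additiveI)
    fix As :: "nat \<Rightarrow> (real ^ 'd) set"
    assume As: "range As \<subseteq> ?A" and disj: "disjoint_family As"
    then have As': "As i \<in> sets borel" for i
      using A by blast
    have "(\<Sum>i. ?\<mu> (As i)) =
        (\<integral>\<^sup>+\<xi>. (\<Sum>i. \<integral>\<^sup>+r\<in>{0<..}. indicator (As i) (r *\<^sub>R \<xi>) * ennreal (lamperti_density \<alpha> (f \<xi>) r) \<partial>lborel) \<partial>\<sigma>)"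
      by (rule nn_integral_suminf[symmetric]) (rule inner[OF As'])
    also have "\<dots> = ?\<mu> (\<Union>i. As i)"
    proof (rule nn_integral_cong)
      fix \<xi>
      have "(\<Sum>i. \<integral>\<^sup>+r\<in>{0<..}. indicator (As i) (r *\<^sub>R \<xi>) * ennreal (lamperti_density \<alpha> (f \<xi>) r) \<partial>lborel) =
          (\<integral>\<^sup>+r. (\<Sum>i. indicator (As i) (r *\<^sub>R \<xi>) * ennreal (lamperti_density \<alpha> (f \<xi>) r)
            * indicator {0<..} r) \<partial>lborel)"
        by (rule nn_integral_suminf[symmetric]) (rule inner'[OF As'])
      also have "\<dots> = (\<integral>\<^sup>+r\<in>{0<..}. indicator (\<Union>i. As i) (r *\<^sub>R \<xi>)
            * ennreal (lamperti_density \<alpha> (f \<xi>) r) \<partial>lborel)"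
        by (simp add: suminf_indicator[OF disj])
      finally show "(\<Sum>i. \<integral>\<^sup>+r\<in>{0<..}. indicator (As i) (r *\<^sub>R \<xi>)
            * ennreal (lamperti_density \<alpha> (f \<xi>) r) \<partial>lborel) =
          (\<integral>\<^sup>+r\<in>{0<..}. indicator (\<Union>i. As i) (r *\<^sub>R \<xi>)
            * ennreal (lamperti_density \<alpha> (f \<xi>) r) \<partial>lborel)" .
    qed
    finally show "(\<Sum>i. ?\<mu> (As i)) = ?\<mu> (\<Union>i. As i)" .
  qed
  moreover have "positive ?A ?\<mu>"
    by (simp add: positive_def)
  ultimately show ?thesis
    using B sub
    by (intro emeasure_measure_of[OF lamperti_levy_measure_def])
       (auto simp: lamperti_levy_measure_def sigma_A A)
qed

definition lamperti_exponent ::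
    "real \<Rightarrow> (real ^ 'd \<Rightarrow> real) \<Rightarrow> (real ^ 'd) measure \<Rightarrow> real ^ 'd \<Rightarrow> real ^ 'd \<Rightarrow> complex" where
  "lamperti_exponent \<alpha> f \<sigma> \<theta> y =
     \<i> * complex_of_real (y \<bullet> \<theta>) +
     (LINT x|lamperti_levy_measure \<alpha> f \<sigma>.
        1 - iexp (y \<bullet> x) + \<i> * complex_of_real (y \<bullet> x) * indicator {x. norm x < 1} x)"

definition lamperti_stable ::
    "'w measure \<Rightarrow> (real \<Rightarrow> 'w \<Rightarrow> real ^ 'd) \<Rightarrow>
     real \<Rightarrow> (real ^ 'd \<Rightarrow> real) \<Rightarrow> (real ^ 'd) measure \<Rightarrow> real ^ 'd \<Rightarrow> bool" where
  "lamperti_stable M X \<alpha> f \<sigma> \<theta> \<longleftrightarrow>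
     levy_process M X \<and>
     (\<forall>t\<ge>0. \<forall>y. (LINT \<omega>|M. iexp (y \<bullet> X t \<omega>)) =
        exp (- (complex_of_real t * lamperti_exponent \<alpha> f \<sigma> \<theta> y)))"

definition lamperti_drift ::
    "real \<Rightarrow> (real ^ 'd \<Rightarrow> real) \<Rightarrow> (real ^ 'd) measure \<Rightarrow> real ^ 'd" where
  "lamperti_drift \<alpha> f \<sigma> =
     (LINT \<xi>|\<sigma>. (LINT r:{1..}|lborel. r * lamperti_density \<alpha> (f \<xi>) r) *\<^sub>R \<xi>)"

definition lamperti_covariance ::
    "real \<Rightarrow> (real ^ 'd \<Rightarrow> real) \<Rightarrow> (real ^ 'd) measure \<Rightarrow> real ^ 'd ^ 'd" where
  "lamperti_covariance \<alpha> f \<sigma> =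
     (LINT x|lamperti_levy_measure \<alpha> f \<sigma>. (\<chi> i j. x $ i * x $ j))"

end

theory Submission
  imports Defs
begin

text \<open>Let \<open>Y\<^sub>h(t) = h powr (-1/2) (X(ht) - ht \<eta>)\<close>. Subtracting \<open>\<eta>\<close> completes the compensation of the jumps,
so \<open>Y\<^sub>h\<close> is a Levy process whose exponent is \<open>h \<psi>(u / sqrt h)\<close> with
\<open>\<psi>(u) = \<integral> (1 - exp(i<u,x>) + i<u,x>) \<nu>(dx)\<close>. The bound \<open>sup f < \<alpha> + 1\<close> and \<open>\<alpha> < 2\<close> make the second
moment of \<open>\<nu>\<close> finite (\<open>radial_second_moment_bounded\<close>). By dominated convergence the exponent therefore
tends to \<open>\<integral> <u,x>\<^sup>2 \<nu>(dx) / 2\<close>, the exponent of the Brownian motion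
(\<open>centred_exponent_scaling_limit\<close>), and it is bounded by the same quantity, which gives
\<open>P(r < |Y\<^sub>h(t) - Y\<^sub>h(s)|) \<le> c (t - s) / r\<^sup>2\<close> uniformly in \<open>h\<close> (\<open>rescaled_chebyshev\<close>).

The passage to the Skorokhod space is the general \<open>skorokhod_invariance_principle\<close>: for processes
with independent increments, convergence of the characteristic functions of the increments together
with such a uniform tail bound yields weak convergence, provided that the limit has continuous paths.
Its proof approximates the test functional by functionals of finitely many increments.

Let \<open>\<phi>\<close> be bounded and continuous. Taking the identity as time change, \<open>\<phi>\<close> is sequentially continuous
for locally uniform convergence of paths. Hence the envelopes
\<open>\<phi>\<^sub>k(x) = INF y. \<phi>(y) + k d\<^sub>k(x, y)\<close>, where \<open>d\<^sub>k\<close> is the truncated uniform distance on \<open>[0, k]\<close>, are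
Lipschitz, lie below \<open>\<phi>\<close> and converge to \<open>\<phi>\<close> pointwise. Let \<open>A\<^sub>m x\<close> be the step path that samples \<open>x\<close> at
the multiples of \<open>1/m\<close>. Then
\<open>E \<phi>(Y\<^sub>h) \<ge> E \<phi>\<^sub>k(A\<^sub>m Y\<^sub>h) - k E d\<^sub>k(Y\<^sub>h, A\<^sub>m Y\<^sub>h)\<close>.
The first term on the right is the expectation of a bounded continuous function of finitely many
increments, so it converges to \<open>E \<phi>\<^sub>k(A\<^sub>m W)\<close> by \<open>weak_convergence_of_char_functions\<close>. The second is
controlled by Ottaviani's inequality: the probability that \<open>Y\<^sub>h\<close> oscillates by more than \<open>2 \<epsilon>\<close> in some
grid cell is at most twice \<open>\<Sum>j. P(\<epsilon> < |j-th grid increment of Y\<^sub>h|)\<close>, and for large \<open>h\<close> this sum is bounded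
by the corresponding sum for \<open>W\<close>, which vanishes as \<open>m \<rightarrow> \<infinity>\<close> because the paths of \<open>W\<close> are continuous
(\<open>sum_prob_jumps_tendsto_0\<close>). Letting \<open>h\<close>, then \<open>m\<close>, then \<open>k\<close> tend to infinity gives
\<open>liminf E \<phi>(Y\<^sub>h) \<ge> E \<phi>(W)\<close>; the same for \<open>- \<phi>\<close> gives the opposite bound.\<close>

section \<open>Characteristic functions and weak convergence of finitely many vectors\<close>

text \<open>The Stone-Weierstrass theorem controls an approximant only on the compact set \<open>K\<close>. Composing it with a
polynomial that is uniformly close to the truncation at height \<open>B\<close> on the range of the approximant
stays inside the function ring and restores a global bound. The global bound is what makes
approximation on a large box useful for tight families.\<close>
lemma bounded_approximant_in_function_ring:
  fixes R :: "('b::t2_space \<Rightarrow> real) set"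
  assumes ring: "function_ring_on R K"
    and bdd: "\<And>p. p \<in> R \<Longrightarrow> bounded (range p)"
    and g: "continuous_on K g" "\<And>x. x \<in> K \<Longrightarrow> \<bar>g x\<bar> \<le> B" and B: "0 \<le> B" and e: "0 < e"
  obtains p where "p \<in> R" "\<And>x. \<bar>p x\<bar> \<le> B + e" "\<And>x. x \<in> K \<Longrightarrow> \<bar>p x - g x\<bar> \<le> e"
proof -
  interpret function_ring_on R K by (rule ring)
  obtain p0 where p0: "p0 \<in> R" "\<And>x. x \<in> K \<Longrightarrow> \<bar>g x - p0 x\<bar> < e / 2"
    using Stone_Weierstrass_basic[OF g(1), of "e / 2"] e by auto
  obtain C where C: "\<And>x. \<bar>p0 x\<bar> \<le> C"
    using bdd[OF p0(1)] unfolding bounded_iff by auto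
  define clamp where "clamp t = max (- B) (min B t)" for t :: real
  have "continuous_on {-C..C} clamp"
    unfolding clamp_def by (intro continuous_intros)
  then obtain q where q: "real_polynomial_function q" "\<And>t. t \<in> {-C..C} \<Longrightarrow> \<bar>clamp t - q t\<bar> < e / 2"
    using Stone_Weierstrass_real_polynomial_function[of "{-C..C}" clamp "e / 2"] e by auto
  have "(\<lambda>x. q (p0 x)) \<in> R"
    using q(1)
  proof induction
    case (linear f)
    then obtain c where "f = (\<lambda>t. t * c)"
      by (auto simp: real_bounded_linear)
    with p0(1) const[of c] mult show ?case by auto
  qed (auto intro: const add mult)
  moreover have near: "\<bar>clamp (p0 x) - q (p0 x)\<bar> < e / 2" for x
    using C[of x] by (intro q(2)) auto
  moreover have "\<bar>q (p0 x)\<bar> \<le> B + e" for x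
    using near[of x] B e unfolding clamp_def by linarith
  moreover have "\<bar>q (p0 x) - g x\<bar> \<le> e" if "x \<in> K" for x
    using near[of x] p0(2)[OF that] g(2)[OF that] unfolding clamp_def by linarith
  ultimately show thesis using that by blast
qed

text \<open>Finite sequences of vectors are functions on \<open>nat\<close> of which only the first \<open>n\<close> values matter. Their
product topology is the one of a fixed type for all \<open>n\<close>, so that \<open>n\<close> can vary inside a proof.\<close>
inductive_set trig_polys :: "nat \<Rightarrow> ((nat \<Rightarrow> 'a::euclidean_space) \<Rightarrow> complex) set" for n where
  character: "(\<lambda>x. iexp (\<Sum>k<n. u k \<bullet> x k)) \<in> trig_polys n"
| scale: "p \<in> trig_polys n \<Longrightarrow> (\<lambda>x. c * p x) \<in> trig_polys n"
| add: "p \<in> trig_polys n \<Longrightarrow> q \<in> trig_polys n \<Longrightarrow> (\<lambda>x. p x + q x) \<in> trig_polys n"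

lemma trig_polys_const: "(\<lambda>x. c) \<in> trig_polys n"
  using scale[OF character[where u = "\<lambda>_. 0"], of c] by simp

lemma trig_polys_mult:
  assumes p: "p \<in> trig_polys n" and q: "q \<in> trig_polys n"
  shows "(\<lambda>x. p x * q x) \<in> trig_polys n"
  using p
proof induction
  case (character u)
  show ?case using q
  proof induction
    case (character v)
    show ?case
      using trig_polys.character[where n = n and u = "\<lambda>k. u k + v k"]
      by (simp add: inner_add_left sum.distrib exp_add distrib_left)
  next
    case (scale q c)
    from trig_polys.scale[OF this(2), of c] show ?case by (simp add: mult_ac)
  next
    case (add q r)
    from trig_polys.add[OF add(3,4)] show ?case by (simp add: distrib_left)
  qed
next
  case (scale p c)
  from trig_polys.scale[OF this(2), of c] show ?case by (simp add: mult_ac)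
next
  case (add p r)
  from trig_polys.add[OF add(3,4)] show ?case by (simp add: distrib_right)
qed

lemma trig_polys_continuous: "p \<in> trig_polys n \<Longrightarrow> continuous_on UNIV p"
  by (induction rule: trig_polys.induct) (auto intro!: continuous_intros)

lemma trig_polys_bounded: "p \<in> trig_polys n \<Longrightarrow> bounded (range p)"
proof (induction rule: trig_polys.induct)
  case (character u)
  show ?case by (rule boundedI[of _ 1]) auto
next
  case (scale p c)
  then obtain B where "\<And>x. norm (p x) \<le> B" by (auto simp: bounded_iff)
  then show ?case
    by (intro boundedI[of _ "norm c * B"]) (auto simp: norm_mult mult_left_mono)
next
  case (add p q)
  then obtain B C where "\<And>x. norm (p x) \<le> B" "\<And>x. norm (q x) \<le> C" by (auto simp: bounded_iff)
  then show ?case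
    by (intro boundedI[of _ "B + C"]) (auto intro: order_trans[OF norm_triangle_ineq] add_mono)
qed

lemma compact_box_sequences:
  "compact {x :: nat \<Rightarrow> 'a::euclidean_space. (\<forall>k<n. norm (x k) \<le> r) \<and> (\<forall>k\<ge>n. x k = 0)}" (is "compact ?K")
proof -
  have "?K = PiE UNIV (\<lambda>k. if k < n then cball 0 r else {0})"
    by (auto simp: PiE_def Pi_def not_less split: if_splits)
  moreover have "compactin (product_topology (\<lambda>_. euclidean) UNIV) \<dots>"
    by (subst compactin_PiE) auto
  ultimately show ?thesis
    by (simp add: euclidean_product_topology)
qed

text \<open>Two points of the box that differ in the coordinate \<open>k\<close> by a vector \<open>v\<close> are separated by a cosine of the
inner product with a multiple of \<open>v\<close>, scaled and shifted so that its phase is \<open>\<pi>\<close> at the first point and \<open>0\<close> at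
the second.\<close>
lemma trig_polys_function_ring:
  "function_ring_on {p. (\<lambda>x. complex_of_real (p x)) \<in> trig_polys n}
     {x :: nat \<Rightarrow> 'a::euclidean_space. (\<forall>k<n. norm (x k) \<le> r) \<and> (\<forall>k\<ge>n. x k = 0)}" (is "function_ring_on ?R ?K")
proof
  show "compact ?K" by (rule compact_box_sequences)
  fix f :: "(nat \<Rightarrow> 'a) \<Rightarrow> real" assume "f \<in> ?R"
  then have "continuous_on ?K (\<lambda>x. Re (complex_of_real (f x)))"
    by (intro continuous_intros continuous_on_subset[OF trig_polys_continuous]) auto
  then show "continuous_on ?K f" by simp
next
  fix x y :: "nat \<Rightarrow> 'a" assume xy: "x \<in> ?K" "y \<in> ?K" "x \<noteq> y"
  have "\<exists>k<n. x k \<noteq> y k"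
  proof (rule ccontr)
    assume "\<not> (\<exists>k<n. x k \<noteq> y k)"
    then have "x k = y k" for k using xy(1,2) by (cases "k < n") auto
    with xy(3) show False by (simp add: fun_eq_iff)
  qed
  then obtain k where k: "k < n" "x k \<noteq> y k" by blast
  define v where "v = x k - y k"
  have v: "v \<noteq> 0" using k by (simp add: v_def)
  define u where "u j = (if j = k then (pi / (v \<bullet> v)) *\<^sub>R v else 0)" for j
  define \<theta> where "\<theta> z = (\<Sum>j<n. u j \<bullet> z j)" for z
  have \<theta>: "\<theta> z = pi / (v \<bullet> v) * (v \<bullet> z k)" for z
    using k(1) unfolding \<theta>_def u_def by (simp add: if_distrib[of "\<lambda>w. w \<bullet> _"] cong: if_cong)
  have diff: "\<theta> x - \<theta> y = pi"
  proof -
    have "\<theta> x - \<theta> y = pi / (v \<bullet> v) * (v \<bullet> v)"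
      unfolding \<theta> right_diff_distrib[symmetric] inner_diff_right[symmetric] v_def[symmetric] ..
    with v show ?thesis by simp
  qed
  define p where "p z = cos (\<theta> z - \<theta> y)" for z
  have eq: "complex_of_real (p z) = (iexp (- \<theta> y) / 2) * iexp (\<theta> z) + (iexp (\<theta> y) / 2) * iexp (- \<theta> z)" for z
  proof -
    have "complex_of_real (p z) = (exp (\<i> * complex_of_real (\<theta> z - \<theta> y)) + exp (- (\<i> * complex_of_real (\<theta> z - \<theta> y)))) / 2"
      unfolding p_def cos_of_real[symmetric] cos_exp_eq by simp
    moreover have "exp (\<i> * complex_of_real (\<theta> z - \<theta> y)) = iexp (- \<theta> y) * iexp (\<theta> z)"
      "exp (- (\<i> * complex_of_real (\<theta> z - \<theta> y))) = iexp (\<theta> y) * iexp (- \<theta> z)"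
      by (simp_all add: exp_add[symmetric] right_diff_distrib)
    ultimately show ?thesis by (simp add: add_divide_distrib)
  qed
  have "(\<lambda>z. iexp (\<theta> z)) \<in> trig_polys n" "(\<lambda>z. iexp (- \<theta> z)) \<in> trig_polys n"
    using character[where n = n and u = u] character[where n = n and u = "\<lambda>j. - u j"] unfolding \<theta>_def by (simp_all add: sum_negf)
  then have "(\<lambda>z. complex_of_real (p z)) \<in> trig_polys n"
    unfolding eq by (intro trig_polys.add trig_polys.scale)
  moreover have "p x \<noteq> p y"
    unfolding p_def diff by simp
  ultimately show "\<exists>f\<in>?R. f x \<noteq> f y" by blast
qed (simp_all add: trig_polys_const trig_polys.add trig_polys_mult)

lemma trig_polys_integral_tendsto:
  fixes V :: "'i \<Rightarrow> 'w \<Rightarrow> nat \<Rightarrow> 'a::euclidean_space" and U :: "'v \<Rightarrow> nat \<Rightarrow> 'a"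
  assumes M: "\<And>i. prob_space (M i)" and N: "prob_space N"
    and V[measurable]: "\<And>i. V i \<in> borel_measurable (M i)" and U[measurable]: "U \<in> borel_measurable N"
    and char: "\<And>u. ((\<lambda>i. LINT \<omega>|M i. iexp (\<Sum>k<n. u k \<bullet> V i \<omega> k)) \<longlongrightarrow> (LINT \<omega>|N. iexp (\<Sum>k<n. u k \<bullet> U \<omega> k))) F"
    and p: "p \<in> trig_polys n"
  shows "((\<lambda>i. LINT \<omega>|M i. p (V i \<omega>)) \<longlongrightarrow> (LINT \<omega>|N. p (U \<omega>))) F"
  using p
proof induction
  case (character u)
  show ?case by (rule char)
next
  case (scale p c)
  then show ?case by (simp add: tendsto_mult_left)
next
  case (add p q)
  have int: "integrable P (\<lambda>\<omega>. r (Z \<omega>))"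
    if r: "r \<in> trig_polys n" and P: "prob_space P" and Z[measurable]: "Z \<in> borel_measurable P" for r :: "(nat \<Rightarrow> 'a) \<Rightarrow> complex" and Z and P :: "'u measure"
  proof -
    interpret prob_space P by fact
    have [measurable]: "r \<in> borel_measurable borel"
      using trig_polys_continuous[OF r] by (rule borel_measurable_continuous_onI)
    obtain B where "\<And>x. norm (r x) \<le> B" using trig_polys_bounded[OF r] by (auto simp: bounded_iff)
    then show ?thesis by (intro integrable_const_bound[of _ B]) auto
  qed
  have "(LINT \<omega>|M i. p (V i \<omega>) + q (V i \<omega>)) = (LINT \<omega>|M i. p (V i \<omega>)) + (LINT \<omega>|M i. q (V i \<omega>))" for i
    by (intro Bochner_Integration.integral_add int M V add)
  moreover have "(LINT \<omega>|N. p (U \<omega>) + q (U \<omega>)) = (LINT \<omega>|N. p (U \<omega>)) + (LINT \<omega>|N. q (U \<omega>))"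
    by (intro Bochner_Integration.integral_add int N U add)
  ultimately show ?case using add by (simp add: tendsto_add)
qed

lemma (in prob_space) expectation_close_off_box:
  fixes V :: "'a \<Rightarrow> nat \<Rightarrow> 'b::euclidean_space" and p g :: "(nat \<Rightarrow> 'b) \<Rightarrow> real"
  assumes V[measurable]: "V \<in> borel_measurable M" and supp: "\<And>\<omega> k. n \<le> k \<Longrightarrow> V \<omega> k = 0"
    and [measurable]: "p \<in> borel_measurable borel" "g \<in> borel_measurable borel"
    and bound: "\<And>x. \<bar>p x\<bar> \<le> B + d" "\<And>x. \<bar>g x\<bar> \<le> B" and d: "0 \<le> d"
    and close: "\<And>x. (\<forall>k<n. norm (x k) \<le> r) \<Longrightarrow> (\<forall>k\<ge>n. x k = 0) \<Longrightarrow> \<bar>p x - g x\<bar> \<le> d"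
  shows "\<bar>expectation (\<lambda>\<omega>. p (V \<omega>)) - expectation (\<lambda>\<omega>. g (V \<omega>))\<bar>
    \<le> d + (2 * B + d) * prob {\<omega> \<in> space M. \<exists>k<n. r < norm (V \<omega> k)}"
proof -
  let ?E = "{\<omega> \<in> space M. \<exists>k<n. r < norm (V \<omega> k)}"
  have [measurable]: "(\<lambda>\<omega>. V \<omega> k) \<in> borel_measurable M" for k
    using V by (rule measurable_product_then_coordinatewise)
  have E[measurable]: "?E \<in> events" by measurable
  have int: "integrable M (\<lambda>\<omega>. p (V \<omega>))" "integrable M (\<lambda>\<omega>. g (V \<omega>))"
    using bound by (intro integrable_const_bound[of _ "B + d"] integrable_const_bound[of _ B]; simp)+
  have intE: "integrable M (indicat_real ?E)"
    using E by (simp add: less_top[symmetric])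
  have "\<bar>expectation (\<lambda>\<omega>. p (V \<omega>)) - expectation (\<lambda>\<omega>. g (V \<omega>))\<bar> = \<bar>expectation (\<lambda>\<omega>. p (V \<omega>) - g (V \<omega>))\<bar>"
    using int by simp
  also have "\<dots> \<le> expectation (\<lambda>\<omega>. \<bar>p (V \<omega>) - g (V \<omega>)\<bar>)"
    by (rule integral_abs_bound)
  also have "\<dots> \<le> expectation (\<lambda>\<omega>. d + (2 * B + d) * indicator ?E \<omega>)"
  proof (rule integral_mono)
    fix \<omega> assume "\<omega> \<in> space M"
    show "\<bar>p (V \<omega>) - g (V \<omega>)\<bar> \<le> d + (2 * B + d) * indicator ?E \<omega>"
    proof (cases "\<omega> \<in> ?E")
      case True
      then show ?thesis using bound[of "V \<omega>"] d by (simp add: indicator_def)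
    next
      case False
      with \<open>\<omega> \<in> space M\<close> have "\<forall>k<n. norm (V \<omega> k) \<le> r"
        by (auto simp: not_less[symmetric])
      then have "\<bar>p (V \<omega>) - g (V \<omega>)\<bar> \<le> d"
        using supp[of _ \<omega>] by (intro close) blast+
      with False show ?thesis by simp
    qed
  next
    show "integrable M (\<lambda>\<omega>. d + (2 * B + d) * indicat_real ?E \<omega>)"
      using intE by (intro Bochner_Integration.integrable_add integrable_const integrable_mult_right)
  qed (use int in \<open>auto intro!: integrable_diff integrable_abs\<close>)
  also have "\<dots> = d + (2 * B + d) * prob ?E"
    using E by (subst Bochner_Integration.integral_add) (simp_all add: intE prob_space)
  finally show ?thesis .
qed

text \<open>Levy's continuity theorem for finite sequences of Euclidean vectors, with tightness as a hypothesis.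
Convergence holds for trigonometric polynomials by linearity. A bounded continuous \<open>g\<close> is close to a
bounded trigonometric polynomial on a box that carries almost all the mass, and off the box both
functions are bounded.\<close>
theorem weak_convergence_of_char_functions:
  fixes V :: "'i \<Rightarrow> 'w \<Rightarrow> nat \<Rightarrow> 'a::euclidean_space" and U :: "'v \<Rightarrow> nat \<Rightarrow> 'a"
    and g :: "(nat \<Rightarrow> 'a) \<Rightarrow> real"
  assumes M: "\<And>i. prob_space (M i)" and N: "prob_space N"
    and V[measurable]: "\<And>i. V i \<in> borel_measurable (M i)" and U[measurable]: "U \<in> borel_measurable N"
    and supp: "\<And>i \<omega> k. n \<le> k \<Longrightarrow> V i \<omega> k = 0" "\<And>\<omega> k. n \<le> k \<Longrightarrow> U \<omega> k = 0"
    and char: "\<And>u. ((\<lambda>i. LINT \<omega>|M i. iexp (\<Sum>k<n. u k \<bullet> V i \<omega> k)) \<longlongrightarrow> (LINT \<omega>|N. iexp (\<Sum>k<n. u k \<bullet> U \<omega> k))) F"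
    and tight: "\<And>e. 0 < e \<Longrightarrow> \<exists>r. \<forall>\<^sub>F i in F. measure (M i) {\<omega> \<in> space (M i). \<exists>k<n. r < norm (V i \<omega> k)} \<le> e"
    and g: "continuous_on UNIV g" "\<And>x. \<bar>g x\<bar> \<le> B"
  shows "((\<lambda>i. LINT \<omega>|M i. g (V i \<omega>)) \<longlongrightarrow> (LINT \<omega>|N. g (U \<omega>))) F"
proof (rule tendstoI)
  fix e :: real assume e: "0 < e"
  interpret N: prob_space N by fact
  have B: "0 \<le> B" using g(2)[of "\<lambda>_. 0"] by linarith
  \<comment> \<open>each comparison with \<open>p\<close> costs at most \<open>d + (2 B + d) \<delta> \<le> e/8 + e/8\<close>\<close>
  define d where "d = min 1 (e / 8)"
  define \<delta> where "\<delta> = e / (8 * (2 * B + 1))"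
  have d: "0 < d" "d \<le> 1" "d \<le> e / 8" and \<delta>: "0 < \<delta>"
    using e B by (auto simp: d_def \<delta>_def)
  obtain r1 where r1: "\<forall>\<^sub>F i in F. measure (M i) {\<omega> \<in> space (M i). \<exists>k<n. r1 < norm (V i \<omega> k)} \<le> \<delta>"
    using tight[OF \<delta>] by blast
  have [measurable]: "(\<lambda>\<omega>. U \<omega> k) \<in> borel_measurable N" for k
    using U by (rule measurable_product_then_coordinatewise)
  have [measurable]: "(\<lambda>\<omega>. V i \<omega> k) \<in> borel_measurable (M i)" for i k
    using V by (rule measurable_product_then_coordinatewise)
  have "(\<lambda>j. N.prob {\<omega> \<in> space N. \<exists>k<n. real j < norm (U \<omega> k)})
      \<longlonglongrightarrow> N.prob (\<Inter>j. {\<omega> \<in> space N. \<exists>k<n. real j < norm (U \<omega> k)})"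
  proof (rule N.finite_Lim_measure_decseq)
    have "{\<omega> \<in> space N. \<exists>k<n. real j < norm (U \<omega> k)} \<subseteq> {\<omega> \<in> space N. \<exists>k<n. real i < norm (U \<omega> k)}"
      if "i \<le> j" for i j
    proof -
      have "real i < c" if "real j < c" for c
        using \<open>i \<le> j\<close> that by linarith
      then show ?thesis by blast
    qed
    then show "decseq (\<lambda>j. {\<omega> \<in> space N. \<exists>k<n. real j < norm (U \<omega> k)})"
      by (simp add: decseq_def)
  qed auto
  moreover have "(\<Inter>j. {\<omega> \<in> space N. \<exists>k<n. real j < norm (U \<omega> k)}) = {}"
  proof safe
    fix \<omega> assume *: "\<omega> \<in> (\<Inter>j. {\<omega> \<in> space N. \<exists>k<n. real j < norm (U \<omega> k)})"
    obtain j :: nat where j: "(\<Sum>k<n. norm (U \<omega> k)) \<le> real j"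
      using real_arch_simple by blast
    from * obtain k where k: "k < n" "real j < norm (U \<omega> k)" by blast
    have "norm (U \<omega> k) \<le> (\<Sum>k<n. norm (U \<omega> k))"
      using k(1) by (intro member_le_sum) auto
    with j k(2) show "\<omega> \<in> {}" by simp
  qed
  ultimately have "\<forall>\<^sub>F j in sequentially. N.prob {\<omega> \<in> space N. \<exists>k<n. real j < norm (U \<omega> k)} < \<delta>"
    using \<delta> by (auto simp: order_tendsto_iff)
  then obtain r2 :: nat where r2: "N.prob {\<omega> \<in> space N. \<exists>k<n. real r2 < norm (U \<omega> k)} < \<delta>"
    by (auto simp: eventually_sequentially)
  define r where "r = max r1 r2"
  have rV: "\<forall>\<^sub>F i in F. measure (M i) {\<omega> \<in> space (M i). \<exists>k<n. r < norm (V i \<omega> k)} \<le> \<delta>"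
    using r1
  proof eventually_elim
    case (elim i)
    interpret prob_space "M i" by (rule M)
    have "prob {\<omega> \<in> space (M i). \<exists>k<n. r < norm (V i \<omega> k)} \<le> prob {\<omega> \<in> space (M i). \<exists>k<n. r1 < norm (V i \<omega> k)}"
      by (rule finite_measure_mono) (auto simp: r_def)
    with elim show ?case by simp
  qed
  have rU: "N.prob {\<omega> \<in> space N. \<exists>k<n. r < norm (U \<omega> k)} \<le> \<delta>"
  proof -
    have "N.prob {\<omega> \<in> space N. \<exists>k<n. r < norm (U \<omega> k)} \<le> N.prob {\<omega> \<in> space N. \<exists>k<n. r2 < norm (U \<omega> k)}"
      by (rule N.finite_measure_mono) (auto simp: r_def)
    with r2 show ?thesis by simp
  qed
  let ?K = "{x :: nat \<Rightarrow> 'a. (\<forall>k<n. norm (x k) \<le> r) \<and> (\<forall>k\<ge>n. x k = 0)}"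
  obtain p where p: "(\<lambda>x. complex_of_real (p x)) \<in> trig_polys n" "\<And>x. \<bar>p x\<bar> \<le> B + d"
    "\<And>x. x \<in> ?K \<Longrightarrow> \<bar>p x - g x\<bar> \<le> d"
  proof (rule bounded_approximant_in_function_ring[OF trig_polys_function_ring[of n r, where ?'a='a], of g B d])
    fix q :: "(nat \<Rightarrow> 'a) \<Rightarrow> real" assume "q \<in> {p. (\<lambda>x. complex_of_real (p x)) \<in> trig_polys n}"
    then show "bounded (range q)"
      using trig_polys_bounded[of "\<lambda>x. complex_of_real (q x)" n] by (auto simp: bounded_iff)
  qed (use g B d in \<open>auto intro: continuous_on_subset\<close>)
  have [measurable]: "g \<in> borel_measurable borel"
    using g(1) by (rule borel_measurable_continuous_onI)
  have "(\<lambda>x. complex_of_real (p x)) \<in> borel_measurable borel"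
    using trig_polys_continuous[OF p(1)] by (rule borel_measurable_continuous_onI)
  then have "(\<lambda>x. Re (complex_of_real (p x))) \<in> borel_measurable borel"
    by measurable
  then have [measurable]: "p \<in> borel_measurable borel" by simp
  have small: "d + (2 * B + d) * x \<le> e / 4" if "x \<le> \<delta>" "0 \<le> x" for x
  proof -
    have "(2 * B + d) * x \<le> (2 * B + 1) * \<delta>"
      using that d B by (intro mult_mono) auto
    also have "\<dots> = e / 8" using B by (simp add: \<delta>_def field_simps)
    finally show ?thesis using d by simp
  qed
  have cU: "\<bar>N.expectation (\<lambda>\<omega>. p (U \<omega>)) - N.expectation (\<lambda>\<omega>. g (U \<omega>))\<bar> \<le> e / 4"
    by (rule order_trans[OF N.expectation_close_off_box[OF U supp(2), where n=n and r=r and B=B and d=d] small[OF rU]])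
       (use p g d in auto)
  have "((\<lambda>i. LINT \<omega>|M i. complex_of_real (p (V i \<omega>))) \<longlongrightarrow> (LINT \<omega>|N. complex_of_real (p (U \<omega>)))) F"
    by (rule trig_polys_integral_tendsto[OF M N V U char p(1)])
  then have "((\<lambda>i. LINT \<omega>|M i. p (V i \<omega>)) \<longlongrightarrow> (LINT \<omega>|N. p (U \<omega>))) F"
    by (simp add: tendsto_of_real_iff)
  from tendstoD[OF this, of "e / 4"] e
  have "\<forall>\<^sub>F i in F. \<bar>(LINT \<omega>|M i. p (V i \<omega>)) - (LINT \<omega>|N. p (U \<omega>))\<bar> < e / 4"
    by (simp add: dist_real_def)
  then show "\<forall>\<^sub>F i in F. dist (LINT \<omega>|M i. g (V i \<omega>)) (LINT \<omega>|N. g (U \<omega>)) < e"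
    using rV
  proof eventually_elim
    case (elim i)
    interpret prob_space "M i" by (rule M)
    have "\<bar>expectation (\<lambda>\<omega>. p (V i \<omega>)) - expectation (\<lambda>\<omega>. g (V i \<omega>))\<bar> \<le> e / 4"
      by (rule order_trans[OF expectation_close_off_box[OF V supp(1), where n=n and r=r and B=B and d=d] small[OF elim(2)]])
         (use p g d in auto)
    with elim(1) cU e show ?case unfolding dist_real_def by linarith
  qed
qed

section \<open>Lipschitz envelopes of functionals on the path space\<close>

definition path_dist :: "real \<Rightarrow> (real \<Rightarrow> 'a::metric_space) \<Rightarrow> (real \<Rightarrow> 'a) \<Rightarrow> real" where
  "path_dist T x y = (SUP t\<in>{0..T}. min 1 (dist (x t) (y t)))"

lemma path_dist_upper: "t \<in> {0..T} \<Longrightarrow> min 1 (dist (x t) (y t)) \<le> path_dist T x y"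
  unfolding path_dist_def by (rule cSUP_upper) (auto intro!: bdd_aboveI[of _ 1])

lemma path_dist_least:
  "0 \<le> T \<Longrightarrow> (\<And>t. t \<in> {0..T} \<Longrightarrow> min 1 (dist (x t) (y t)) \<le> c) \<Longrightarrow> path_dist T x y \<le> c"
  unfolding path_dist_def by (rule cSUP_least) auto

lemma path_dist_nonneg: "0 \<le> T \<Longrightarrow> 0 \<le> path_dist T x y"
  using path_dist_upper[of 0 T x y] by (auto intro: order_trans[rotated])

lemma path_dist_self: "0 \<le> T \<Longrightarrow> path_dist T x x = 0"
  by (intro antisym path_dist_nonneg path_dist_least) auto

lemma path_dist_commute: "path_dist T x y = path_dist T y x"
  by (simp add: path_dist_def dist_commute)

lemma path_dist_triangle:
  assumes "0 \<le> T" shows "path_dist T x z \<le> path_dist T x y + path_dist T y z"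
proof (rule path_dist_least[OF assms])
  fix t assume t: "t \<in> {0..T}"
  have "min 1 (dist (x t) (z t)) \<le> min 1 (dist (x t) (y t)) + min 1 (dist (y t) (z t))"
    using dist_triangle[of "x t" "z t" "y t"] zero_le_dist[of "x t" "y t"] zero_le_dist[of "y t" "z t"]
    by linarith
  also have "\<dots> \<le> path_dist T x y + path_dist T y z"
    using t by (intro add_mono path_dist_upper)
  finally show "min 1 (dist (x t) (z t)) \<le> path_dist T x y + path_dist T y z" .
qed

text \<open>Locally uniform convergence is J1 convergence with the identity as time change. This is the only
property of the Skorokhod topology on which the limit theorem rests.\<close>
lemma skorokhod_continuous_locally_uniform:
  fixes \<phi> :: "(real \<Rightarrow> 'a::metric_space) \<Rightarrow> real"
  assumes cont: "continuous_map skorokhod_topology euclideanreal \<phi>"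
    and x: "x \<in> skorokhod_paths" and xs: "\<And>n. xs n \<in> skorokhod_paths"
    and lim: "\<And>T. uniform_limit {0..T} xs x sequentially"
  shows "(\<lambda>n. \<phi> (xs n)) \<longlonglongrightarrow> \<phi> x"
proof (rule topological_tendstoI)
  fix S :: "real set" assume S: "open S" "\<phi> x \<in> S"
  have "openin skorokhod_topology {y \<in> skorokhod_paths. \<phi> y \<in> S}"
    using cont S(1) unfolding continuous_map_def by simp
  moreover have "J1_converges xs x"
    unfolding J1_converges_def
  proof (intro exI[of _ "\<lambda>_ s. s"] conjI allI)
    show "time_change (\<lambda>s. s)"
      by (auto simp: time_change_def strict_mono_on_def)
    show "uniform_limit {0..T} (\<lambda>n s. xs n s) x sequentially" for T
      using lim[of T] by simp
  qed (auto simp: uniform_limit_iff)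
  moreover have "range xs \<subseteq> skorokhod_paths"
    using xs by blast
  ultimately have "\<forall>\<^sub>F n in sequentially. xs n \<in> {y \<in> skorokhod_paths. \<phi> y \<in> S}"
    using x S(2) unfolding openin_skorokhod_topology by blast
  then show "\<forall>\<^sub>F n in sequentially. \<phi> (xs n) \<in> S"
    by eventually_elim simp
qed

text \<open>The Pasch-Hausdorff envelope of \<open>\<phi>\<close>. The horizon of the distance grows with the Lipschitz constant, so
that for fixed \<open>k\<close> only the path on \<open>[0, k]\<close> matters, while the limit \<open>k \<rightarrow> \<infinity>\<close> sees every horizon.\<close>
definition lower_envelope ::
    "((real \<Rightarrow> 'a::metric_space) \<Rightarrow> real) \<Rightarrow> nat \<Rightarrow> (real \<Rightarrow> 'a) \<Rightarrow> real" where
  "lower_envelope \<phi> k x = (INF y\<in>skorokhod_paths. \<phi> y + real k * path_dist (real k) x y)"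

context
  fixes \<phi> :: "(real \<Rightarrow> 'a::metric_space) \<Rightarrow> real" and B :: real
  assumes bound: "\<And>y. y \<in> skorokhod_paths \<Longrightarrow> \<bar>\<phi> y\<bar> \<le> B"
begin

lemma envelope_bdd_below:
  "bdd_below ((\<lambda>y. \<phi> y + real k * path_dist (real k) x y) ` skorokhod_paths)"
proof (rule bdd_belowI2[of _ "- B"])
  fix y :: "real \<Rightarrow> 'a" assume "y \<in> skorokhod_paths"
  moreover have "0 \<le> real k * path_dist (real k) x y"
    by (simp add: path_dist_nonneg)
  ultimately show "- B \<le> \<phi> y + real k * path_dist (real k) x y"
    using bound[of y] by linarith
qed

lemma lower_envelope_lower:
  "y \<in> skorokhod_paths \<Longrightarrow> lower_envelope \<phi> k x \<le> \<phi> y + real k * path_dist (real k) x y"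
  unfolding lower_envelope_def by (rule cINF_lower[OF envelope_bdd_below])

lemma lower_envelope_le: "x \<in> skorokhod_paths \<Longrightarrow> lower_envelope \<phi> k x \<le> \<phi> x"
  using lower_envelope_lower[of x k x] by (simp add: path_dist_self)

lemma lower_envelope_approximant:
  assumes "x \<in> skorokhod_paths" "0 < e"
  obtains y where "y \<in> skorokhod_paths" "\<phi> y + real k * path_dist (real k) x y < lower_envelope \<phi> k x + e"
proof -
  have "(INF y\<in>skorokhod_paths. \<phi> y + real k * path_dist (real k) x y) < lower_envelope \<phi> k x + e"
    using assms(2) by (simp add: lower_envelope_def)
  then show thesis
    using that assms(1) by (subst (asm) cINF_less_iff[OF _ envelope_bdd_below]) auto
qed

lemma lower_envelope_abs_le: "x \<in> skorokhod_paths \<Longrightarrow> \<bar>lower_envelope \<phi> k x\<bar> \<le> B"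
proof -
  assume x: "x \<in> skorokhod_paths"
  have "- B \<le> lower_envelope \<phi> k x"
    unfolding lower_envelope_def
  proof (rule cINF_greatest)
    fix y :: "real \<Rightarrow> 'a" assume "y \<in> skorokhod_paths"
    moreover have "0 \<le> real k * path_dist (real k) x y"
      by (simp add: path_dist_nonneg)
    ultimately show "- B \<le> \<phi> y + real k * path_dist (real k) x y"
      using bound[of y] by linarith
  qed (use x in auto)
  with lower_envelope_le[OF x, of k] bound[OF x] show ?thesis by linarith
qed

lemma lower_envelope_lipschitz:
  assumes "x \<in> skorokhod_paths" "x' \<in> skorokhod_paths"
  shows "lower_envelope \<phi> k x \<le> lower_envelope \<phi> k x' + real k * path_dist (real k) x x'"
proof (rule field_le_epsilon)
  fix e :: real assume "0 < e"
  then obtain y where y: "y \<in> skorokhod_paths"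
      "\<phi> y + real k * path_dist (real k) x' y < lower_envelope \<phi> k x' + e"
    using lower_envelope_approximant assms(2) by blast
  have "real k * path_dist (real k) x y \<le> real k * (path_dist (real k) x x' + path_dist (real k) x' y)"
    by (intro mult_left_mono path_dist_triangle) auto
  with y(2) lower_envelope_lower[OF y(1), of k x]
  show "lower_envelope \<phi> k x \<le> lower_envelope \<phi> k x' + real k * path_dist (real k) x x' + e"
    by (simp add: distrib_left)
qed

text \<open>A near minimiser \<open>y\<^sub>k\<close> satisfies \<open>k d\<^sub>k(x, y\<^sub>k) \<le> 2 B + 1\<close> since \<open>\<phi>\<close> is bounded. So \<open>y\<^sub>k\<close> converges to \<open>x\<close> locally
uniformly, and continuity of \<open>\<phi>\<close> at \<open>x\<close> gives the lower bound.\<close>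
lemma lower_envelope_tendsto:
  assumes cont: "continuous_map skorokhod_topology euclideanreal \<phi>" and x: "x \<in> skorokhod_paths"
  shows "(\<lambda>k. lower_envelope \<phi> k x) \<longlonglongrightarrow> \<phi> x"
proof -
  have "\<forall>k. \<exists>y. y \<in> skorokhod_paths \<and>
      \<phi> y + real k * path_dist (real k) x y < lower_envelope \<phi> k x + inverse (real (Suc k))"
    using lower_envelope_approximant[OF x] by (metis inverse_positive_iff_positive of_nat_0_less_iff zero_less_Suc)
  then obtain y where y: "\<And>k. y k \<in> skorokhod_paths"
      "\<And>k. \<phi> (y k) + real k * path_dist (real k) x (y k) < lower_envelope \<phi> k x + inverse (real (Suc k))"
    by metis
  have "uniform_limit {0..T} y x sequentially" for T
    unfolding uniform_limit_iff
  proof (intro allI impI)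
    fix e :: real assume e: "0 < e"
    obtain k0 :: nat where k0: "max T ((2 * B + 1) / min 1 e) < real k0"
      using reals_Archimedean2 by blast
    show "\<forall>\<^sub>F k in sequentially. \<forall>t\<in>{0..T}. dist (y k t) (x t) < e"
    proof (rule eventually_sequentiallyI[of k0])
      fix k assume "k0 \<le> k"
      then have k: "T < real k" "(2 * B + 1) / min 1 e < real k" using k0 by linarith+
      have B: "0 \<le> B" using bound[OF x] by linarith
      have "inverse (real (Suc k)) \<le> 1" by (simp add: field_simps)
      then have "real k * path_dist (real k) x (y k) < 2 * B + 1"
        using y(2)[of k] bound[OF y(1)[of k]] lower_envelope_abs_le[OF x, of k] by linarith
      also have "2 * B + 1 < real k * min 1 e"
        using k(2) e by (simp add: field_simps)
      finally have "path_dist (real k) x (y k) < min 1 e"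
        by (rule mult_left_less_imp_less) simp
      moreover have "min 1 (dist (x t) (y k t)) \<le> path_dist (real k) x (y k)" if "t \<in> {0..T}" for t
        using that k by (intro path_dist_upper) auto
      ultimately show "\<forall>t\<in>{0..T}. dist (y k t) (x t) < e"
        by (fastforce simp: dist_commute min_def split: if_splits)
    qed
  qed
  then have lim: "(\<lambda>k. \<phi> (y k)) \<longlonglongrightarrow> \<phi> x"
    by (rule skorokhod_continuous_locally_uniform[OF cont x y(1)])
  have "(\<lambda>k. \<phi> (y k) - inverse (real (Suc k))) \<longlonglongrightarrow> \<phi> x - 0"
    by (intro tendsto_diff lim LIMSEQ_inverse_real_of_nat)
  then have low: "(\<lambda>k. \<phi> (y k) - inverse (real (Suc k))) \<longlonglongrightarrow> \<phi> x"
    unfolding diff_0_right .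
  have "\<phi> (y k) - inverse (real (Suc k)) \<le> lower_envelope \<phi> k x" for k
  proof -
    have "0 \<le> real k * path_dist (real k) x (y k)"
      by (simp add: path_dist_nonneg)
    with y(2)[of k] show ?thesis by linarith
  qed
  then show ?thesis
    by (rule real_tendsto_sandwich[OF always_eventually[OF allI] always_eventually[OF allI] low tendsto_const])
       (rule lower_envelope_le[OF x])
qed

end

text \<open>The right-continuous path that starts at \<open>0\<close>, jumps by \<open>x j\<close> at time \<open>(j + 1)/m\<close> for \<open>j < n\<close>, and stays
constant after time \<open>n/m\<close>.\<close>
definition step_path :: "nat \<Rightarrow> nat \<Rightarrow> (nat \<Rightarrow> 'a::real_normed_vector) \<Rightarrow> real \<Rightarrow> 'a" where
  "step_path m n x = (\<lambda>t\<in>{0..}. \<Sum>j<min n (nat \<lfloor>real m * t\<rfloor>). x j)"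

lemma cadlag_restrict_iff: "cadlag (restrict x {0..}) \<longleftrightarrow> cadlag x"
proof -
  have "(restrict x {0..} \<longlongrightarrow> l) (at_right t) \<longleftrightarrow> (x \<longlongrightarrow> l) (at_right t)" if "0 \<le> t" for t l
    by (rule tendsto_cong) (use that in \<open>auto intro: eventually_mono[OF eventually_at_right_less]\<close>)
  moreover have "(restrict x {0..} \<longlongrightarrow> l) (at_left t) \<longleftrightarrow> (x \<longlongrightarrow> l) (at_left t)" if "0 < t" for t l
    by (rule tendsto_cong) (use that in \<open>auto intro: eventually_mono[OF eventually_at_left_real]\<close>)
  ultimately show ?thesis
    unfolding cadlag_def by simp
qed

lemma step_path_in_skorokhod_paths:
  assumes m: "0 < m"
  shows "step_path m n x \<in> skorokhod_paths"
proof -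
  define s where "s t = (\<Sum>j<min n (nat \<lfloor>real m * t\<rfloor>). x j)" for t
  have "cadlag s"
    unfolding cadlag_def
  proof (intro conjI allI impI)
    fix t :: real assume "0 \<le> t"
    have "\<forall>\<^sub>F u in at_right t. \<lfloor>real m * u\<rfloor> = \<lfloor>real m * t\<rfloor>"
      unfolding eventually_at_right_field
    proof (intro exI[of _ "(of_int \<lfloor>real m * t\<rfloor> + 1) / real m"] conjI allI impI)
      show "t < (of_int \<lfloor>real m * t\<rfloor> + 1) / real m"
        using m floor_correct[of "real m * t"] by (simp add: field_simps)
      fix u assume u: "t < u" "u < (of_int \<lfloor>real m * t\<rfloor> + 1) / real m"
      then have "real m * t < real m * u" "real m * u < of_int \<lfloor>real m * t\<rfloor> + 1"
        using m by (simp_all add: field_simps)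
      then show "\<lfloor>real m * u\<rfloor> = \<lfloor>real m * t\<rfloor>"
        by linarith
    qed
    then show "(s \<longlongrightarrow> s t) (at_right t)"
      by (intro tendsto_eventually) (auto elim!: eventually_mono simp: s_def)
  next
    fix t :: real assume "0 < t"
    define c where "c = \<lceil>real m * t\<rceil> - 1"
    have "\<forall>\<^sub>F u in at_left t. \<lfloor>real m * u\<rfloor> = c"
      unfolding eventually_at_left_field
    proof (intro exI[of _ "of_int c / real m"] conjI allI impI)
      show "of_int c / real m < t"
        using m ceiling_correct[of "real m * t"] by (simp add: c_def field_simps)
      fix u assume u: "of_int c / real m < u" "u < t"
      then have "real m * u < real m * t" "of_int c < real m * u"
        using m by (simp_all add: field_simps)
      then show "\<lfloor>real m * u\<rfloor> = c"
        unfolding c_def by linarith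
    qed
    then have "(s \<longlongrightarrow> (\<Sum>j<min n (nat c). x j)) (at_left t)"
      by (intro tendsto_eventually) (auto elim!: eventually_mono simp: s_def)
    then show "\<exists>l. (s \<longlongrightarrow> l) (at_left t)" by blast
  qed
  then show ?thesis
    by (simp add: skorokhod_paths_def step_path_def s_def[abs_def] cadlag_restrict_iff)
qed

lemma path_dist_step_path_le:
  assumes "0 \<le> T"
  shows "path_dist T (step_path m n x) (step_path m n y) \<le> (\<Sum>j<n. dist (x j) (y j))"
proof (rule path_dist_least[OF assms])
  fix t assume "t \<in> {0..T}"
  let ?N = "min n (nat \<lfloor>real m * t\<rfloor>)"
  have "dist (step_path m n x t) (step_path m n y t) \<le> (\<Sum>j<?N. dist (x j) (y j))"
    using \<open>t \<in> {0..T}\<close>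
    by (simp add: step_path_def dist_norm sum_subtractf[symmetric] norm_sum)
  also have "\<dots> \<le> (\<Sum>j<n. dist (x j) (y j))"
    by (rule sum_mono2) auto
  finally show "min 1 (dist (step_path m n x t) (step_path m n y t)) \<le> (\<Sum>j<n. dist (x j) (y j))"
    by simp
qed

text \<open>Step paths depend on their jumps in a Lipschitz way. Continuity makes the envelope of a step path a test
function for the weak convergence of its jumps, and it settles measurability, which is unclear for the
envelope on the whole path space, an infimum over uncountably many paths.\<close>
lemma continuous_lower_envelope_step_path:
  fixes \<phi> :: "(real \<Rightarrow> 'a::real_normed_vector) \<Rightarrow> real"
  assumes bound: "\<And>y. y \<in> skorokhod_paths \<Longrightarrow> \<bar>\<phi> y\<bar> \<le> B" and m: "0 < m"
  shows "continuous_on UNIV (\<lambda>x. lower_envelope \<phi> k (step_path m n x))" (is "continuous_on UNIV ?g")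
  unfolding continuous_on_def
proof
  fix x0 :: "nat \<Rightarrow> 'a"
  let ?b = "\<lambda>x. real k * (\<Sum>j<n. dist (x j) (x0 j))"
  have le: "?g x \<le> ?g y + real k * (\<Sum>j<n. dist (x j) (y j))" for x y
    using lower_envelope_lipschitz[of \<phi> B "step_path m n x" "step_path m n y" k, OF bound]
      step_path_in_skorokhod_paths[OF m] mult_left_mono[OF path_dist_step_path_le[of "real k" m n x y], of "real k"]
    by force
  have bnd: "norm (?g x - ?g x0) \<le> ?b x" for x
    using le[of x x0] le[of x0 x] by (simp add: dist_commute abs_le_iff)
  have "(?b \<longlongrightarrow> ?b x0) (at x0)"
  proof -
    have "continuous_on UNIV ?b"
      by (intro continuous_intros continuous_on_product_coordinates)
    then have "isCont ?b x0" by (simp add: continuous_on_eq_continuous_at)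
    then show ?thesis unfolding isCont_def .
  qed
  moreover have "?b x0 = 0" by simp
  ultimately have "(?b \<longlongrightarrow> 0) (at x0)" by (simp only:)
  then have "((\<lambda>x. ?g x - ?g x0) \<longlongrightarrow> 0) (at x0)"
    by (rule Lim_null_comparison[OF always_eventually[OF allI[OF bnd]]])
  then show "(?g \<longlongrightarrow> ?g x0) (at x0 within UNIV)"
    by (simp add: LIM_zero_iff)
qed

lemma restrict_in_skorokhod_paths: "cadlag x \<Longrightarrow> restrict x {0..} \<in> skorokhod_paths"
  by (simp add: skorokhod_paths_def cadlag_restrict_iff)

lemma measurable_path:
  fixes X :: "real \<Rightarrow> 'w \<Rightarrow> 'a::euclidean_space"
  assumes "\<And>t. 0 \<le> t \<Longrightarrow> X t \<in> borel_measurable M" "\<And>\<omega>. \<omega> \<in> space M \<Longrightarrow> cadlag (\<lambda>t. X t \<omega>)"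
  shows "(\<lambda>\<omega>. \<lambda>t\<in>{0..}. X t \<omega>) \<in> measurable M skorokhod_algebra"
  unfolding skorokhod_algebra_def
  using assms by (intro measurable_restrict_space2 measurable_restrict) (auto intro: restrict_in_skorokhod_paths)

section \<open>Oscillation of processes with independent increments\<close>

text \<open>Let \<open>F i\<close> be the event that \<open>i\<close> is the first index at which the partial sum exceeds \<open>2 e\<close>. It is
independent of the remaining sum, which is at most \<open>e\<close> with probability at least \<open>1/2\<close>; if both occur then
the full sum exceeds \<open>e\<close>.\<close>
lemma (in prob_space) ottaviani_inequality:
  fixes Z :: "nat \<Rightarrow> 'a \<Rightarrow> 'b::euclidean_space"
  assumes indep: "indep_vars (\<lambda>_. borel) Z {..<n}"
    and tail: "\<And>i. i \<le> n \<Longrightarrow> prob {\<omega> \<in> space M. e < norm (\<Sum>j\<in>{i..<n}. Z j \<omega>)} \<le> 1 / 2"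
  shows "prob {\<omega> \<in> space M. \<exists>i\<le>n. 2 * e < norm (\<Sum>j<i. Z j \<omega>)}
    \<le> 2 * prob {\<omega> \<in> space M. e < norm (\<Sum>j<n. Z j \<omega>)}"
proof -
  have [measurable]: "random_variable borel (Z j)" if "j < n" for j
    using indep that by (auto simp: indep_vars_def)
  have Sm: "(\<lambda>\<omega>. \<Sum>j\<in>J. Z j \<omega>) \<in> borel_measurable M" if "J \<subseteq> {..<n}" for J
    using that by (intro borel_measurable_sum) auto
  have [measurable]: "(\<lambda>\<omega>. \<Sum>j<i. Z j \<omega>) \<in> borel_measurable M" if "i \<le> n" for i
    using that by (intro Sm) auto
  have [measurable]: "(\<lambda>\<omega>. \<Sum>j\<in>{i..<n}. Z j \<omega>) \<in> borel_measurable M" for i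
    by (intro Sm) auto
  define F where "F i = {\<omega> \<in> space M. 2 * e < norm (\<Sum>j<i. Z j \<omega>) \<and> (\<forall>l<i. norm (\<Sum>j<l. Z j \<omega>) \<le> 2 * e)}" for i
  define G where "G i = {\<omega> \<in> space M. norm (\<Sum>j\<in>{i..<n}. Z j \<omega>) \<le> e}" for i
  have F[measurable]: "F i \<in> events" if "i \<le> n" for i
  proof -
    have "{\<omega> \<in> space M. norm (\<Sum>j<l. Z j \<omega>) \<le> 2 * e} \<in> events" if "l \<in> {..<i}" for l
      using Sm[of "{..<l}"] that \<open>i \<le> n\<close> by (intro borel_measurable_le borel_measurable_norm) auto
    then have "{\<omega> \<in> space M. \<forall>l\<in>{..<i}. norm (\<Sum>j<l. Z j \<omega>) \<le> 2 * e} \<in> events"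
      by (intro sets.sets_Collect_finite_All) auto
    moreover have "{\<omega> \<in> space M. 2 * e < norm (\<Sum>j<i. Z j \<omega>)} \<in> events"
      using that by measurable
    moreover have "F i = {\<omega> \<in> space M. 2 * e < norm (\<Sum>j<i. Z j \<omega>)} \<inter> {\<omega> \<in> space M. \<forall>l\<in>{..<i}. norm (\<Sum>j<l. Z j \<omega>) \<le> 2 * e}"
      by (auto simp: F_def)
    ultimately show ?thesis by (simp only: sets.Int)
  qed
  have G[measurable]: "G i \<in> events" for i
    unfolding G_def by measurable
  have disj: "disjoint_family_on F {..n}"
    unfolding disjoint_family_on_def
  proof (intro ballI impI)
    fix i l :: nat assume "i \<noteq> l"
    then consider "i < l" | "l < i" by linarith
    then show "F i \<inter> F l = {}"
      by cases (auto simp: F_def not_less[symmetric])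
  qed
  have Un: "(\<Union>i\<le>n. F i) = {\<omega> \<in> space M. \<exists>i\<le>n. 2 * e < norm (\<Sum>j<i. Z j \<omega>)}"
  proof (intro equalityI subsetI)
    fix \<omega> assume "\<omega> \<in> {\<omega> \<in> space M. \<exists>i\<le>n. 2 * e < norm (\<Sum>j<i. Z j \<omega>)}"
    then obtain i where i: "\<omega> \<in> space M" "i \<le> n" "2 * e < norm (\<Sum>j<i. Z j \<omega>)" by blast
    define i0 where "i0 = (LEAST i. 2 * e < norm (\<Sum>j<i. Z j \<omega>))"
    have "2 * e < norm (\<Sum>j<i0. Z j \<omega>)" "i0 \<le> i"
      unfolding i0_def using i(3) by (auto intro: LeastI Least_le)
    moreover have "norm (\<Sum>j<l. Z j \<omega>) \<le> 2 * e" if "l < i0" for l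
      using not_less_Least[of l "\<lambda>i. 2 * e < norm (\<Sum>j<i. Z j \<omega>)"] that by (simp add: i0_def)
    ultimately show "\<omega> \<in> (\<Union>i\<le>n. F i)"
      using i by (auto simp: F_def intro!: exI[of _ i0])
  qed (auto simp: F_def)
  have ind: "prob (F i \<inter> G i) = prob (F i) * prob (G i)" if i: "i \<le> n" for i
  proof -
    let ?P = "PiM {..<i} (\<lambda>_. borel :: 'b measure)" and ?Q = "PiM {i..<n} (\<lambda>_. borel :: 'b measure)"
    let ?A = "{x \<in> space ?P. 2 * e < norm (\<Sum>j<i. x j) \<and> (\<forall>l\<in>{..<i}. norm (\<Sum>j<l. x j) \<le> 2 * e)}"
    let ?B = "{x \<in> space ?Q. norm (\<Sum>j\<in>{i..<n}. x j) \<le> e}"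
    have Pm: "(\<lambda>x. \<Sum>j<l. x j) \<in> borel_measurable ?P" if "l \<le> i" for l
      using that by (intro borel_measurable_sum measurable_component_singleton) auto
    have "{x \<in> space ?P. norm (\<Sum>j<l. x j) \<le> 2 * e} \<in> sets ?P" if "l \<in> {..<i}" for l
      using Pm[of l] that by (intro borel_measurable_le borel_measurable_norm) auto
    then have "{x \<in> space ?P. \<forall>l\<in>{..<i}. norm (\<Sum>j<l. x j) \<le> 2 * e} \<in> sets ?P"
      by (intro sets.sets_Collect_finite_All) auto
    moreover have "{x \<in> space ?P. 2 * e < norm (\<Sum>j<i. x j)} \<in> sets ?P"
      using Pm[of i] by (intro borel_measurable_less borel_measurable_norm) auto
    moreover have "?A = {x \<in> space ?P. 2 * e < norm (\<Sum>j<i. x j)} \<inter> {x \<in> space ?P. \<forall>l\<in>{..<i}. norm (\<Sum>j<l. x j) \<le> 2 * e}"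
      by auto
    ultimately have A: "?A \<in> sets ?P" by (simp only: sets.Int)
    have B: "?B \<in> sets ?Q"
      by (intro borel_measurable_le borel_measurable_norm borel_measurable_sum measurable_component_singleton) auto
    have iv: "indep_var ?P (\<lambda>\<omega>. \<lambda>j\<in>{..<i}. Z j \<omega>) ?Q (\<lambda>\<omega>. \<lambda>j\<in>{i..<n}. Z j \<omega>)"
      using i by (intro indep_var_restrict[OF indep]) auto
    have FA: "F i = (\<lambda>\<omega>. \<lambda>j\<in>{..<i}. Z j \<omega>) -` ?A \<inter> space M"
      by (auto simp: F_def space_PiM cong: sum.cong_simp)
    have GB: "G i = (\<lambda>\<omega>. \<lambda>j\<in>{i..<n}. Z j \<omega>) -` ?B \<inter> space M"
      by (auto simp: G_def space_PiM)
    have "F i \<inter> G i = (\<lambda>\<omega>. (\<lambda>j\<in>{..<i}. Z j \<omega>, \<lambda>j\<in>{i..<n}. Z j \<omega>)) -` (?A \<times> ?B) \<inter> space M"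
      unfolding FA GB by blast
    then show ?thesis
      using indep_varD[OF iv A B] by (simp only: FA GB)
  qed
  have half: "1 / 2 \<le> prob (G i)" if "i \<le> n" for i
  proof -
    have "prob (G i) = 1 - prob {\<omega> \<in> space M. e < norm (\<Sum>j\<in>{i..<n}. Z j \<omega>)}"
      unfolding G_def by (subst prob_compl[symmetric]) (auto intro!: arg_cong[of _ _ prob])
    with tail[OF that] show ?thesis by simp
  qed
  have "prob {\<omega> \<in> space M. \<exists>i\<le>n. 2 * e < norm (\<Sum>j<i. Z j \<omega>)} = (\<Sum>i\<le>n. prob (F i))"
    unfolding Un[symmetric] using disj by (intro finite_measure_finite_Union) auto
  also have "\<dots> \<le> (\<Sum>i\<le>n. 2 * prob (F i \<inter> G i))"
  proof (rule sum_mono)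
    fix i assume "i \<in> {..n}"
    then have "1 * prob (F i) \<le> (2 * prob (G i)) * prob (F i)"
      using half[of i] by (intro mult_right_mono) auto
    then show "prob (F i) \<le> 2 * prob (F i \<inter> G i)"
      using ind[of i] \<open>i \<in> {..n}\<close> by (simp add: mult_ac)
  qed
  also have "\<dots> = 2 * prob (\<Union>i\<le>n. F i \<inter> G i)"
    using disj unfolding sum_distrib_left[symmetric]
    by (subst finite_measure_finite_Union) (auto simp: disjoint_family_on_def)
  also have "\<dots> \<le> 2 * prob {\<omega> \<in> space M. e < norm (\<Sum>j<n. Z j \<omega>)}"
  proof (intro mult_left_mono finite_measure_mono subsetI)
    fix \<omega> assume "\<omega> \<in> (\<Union>i\<le>n. F i \<inter> G i)"
    then obtain i where i: "i \<le> n" "\<omega> \<in> space M" "2 * e < norm (\<Sum>j<i. Z j \<omega>)" "norm (\<Sum>j\<in>{i..<n}. Z j \<omega>) \<le> e"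
      by (auto simp: F_def G_def)
    have "(\<Sum>j<n. Z j \<omega>) = (\<Sum>j<i. Z j \<omega>) + (\<Sum>j\<in>{i..<n}. Z j \<omega>)"
      using i(1) by (simp add: lessThan_atLeast0 sum.atLeastLessThan_concat)
    then have "norm (\<Sum>j<i. Z j \<omega>) \<le> norm (\<Sum>j<n. Z j \<omega>) + norm (\<Sum>j\<in>{i..<n}. Z j \<omega>)"
      using norm_triangle_ineq4[of "\<Sum>j<n. Z j \<omega>" "\<Sum>j\<in>{i..<n}. Z j \<omega>"] by simp
    with i show "\<omega> \<in> {\<omega> \<in> space M. e < norm (\<Sum>j<n. Z j \<omega>)}" by simp
  qed auto
  finally show ?thesis .
qed

text \<open>Ottaviani's inequality on uniform grids of \<open>[a, b]\<close> with \<open>N + 1\<close> cells. By right continuity, a path that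
deviates by more than \<open>2 e\<close> at some time does so at a point of every sufficiently fine grid, so it belongs
to the lower limit of the grid events. That event is measurable and inherits the bound. The event that
the path deviates at some time is an uncountable union; covering it by \<open>E\<close> avoids its measurability.\<close>
lemma (in prob_space) oscillation_bound:
  fixes X :: "real \<Rightarrow> 'a \<Rightarrow> 'b::euclidean_space"
  assumes X[measurable]: "\<And>t. 0 \<le> t \<Longrightarrow> X t \<in> borel_measurable M"
    and cont: "\<And>\<omega> t. \<omega> \<in> space M \<Longrightarrow> 0 \<le> t \<Longrightarrow> ((\<lambda>u. X u \<omega>) \<longlongrightarrow> X t \<omega>) (at_right t)"
    and indep: "independent_increments M X"
    and ab: "0 \<le> a" "a < b"
    and tail: "\<And>s. a \<le> s \<Longrightarrow> s \<le> b \<Longrightarrow> prob {\<omega> \<in> space M. e < norm (X b \<omega> - X s \<omega>)} \<le> 1 / 2"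
  obtains E where "E \<in> events"
    "\<And>\<omega> t. \<omega> \<in> space M \<Longrightarrow> t \<in> {a..b} \<Longrightarrow> 2 * e < norm (X t \<omega> - X a \<omega>) \<Longrightarrow> \<omega> \<in> E"
    "prob E \<le> 2 * prob {\<omega> \<in> space M. e < norm (X b \<omega> - X a \<omega>)}"
proof -
  let ?bound = "2 * prob {\<omega> \<in> space M. e < norm (X b \<omega> - X a \<omega>)}"
  define g where "g N i = a + (b - a) * real i / real (Suc N)" for N i
  define E where "E N = {\<omega> \<in> space M. \<exists>i\<le>Suc N. 2 * e < norm (X (g N i) \<omega> - X a \<omega>)}" for N
  have g_ge: "a \<le> g N i" for N i
    using ab by (simp add: g_def)
  have g0: "g N 0 = a" and gN: "g N (Suc N) = b" for N
    by (simp_all add: g_def del: of_nat_Suc)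
  have g_mono: "g N i \<le> g N j" if "i \<le> j" for N i j
    unfolding g_def using ab that by (intro add_left_mono divide_right_mono mult_left_mono) auto
  have [measurable]: "X (g N i) \<in> borel_measurable M" for N i
    using g_ge[of N i] ab by simp
  have [measurable]: "X a \<in> borel_measurable M" using ab by simp
  have E_meas[measurable]: "E N \<in> events" for N
    unfolding E_def by measurable
  have E_prob: "prob (E N) \<le> ?bound" for N
  proof -
    let ?Z = "\<lambda>j \<omega>. X (g N (Suc j)) \<omega> - X (g N j) \<omega>"
    have ind: "indep_vars (\<lambda>_. borel) ?Z {..<Suc N}"
      using indep g_mono g_ge[of N 0] ab unfolding independent_increments_def
      by (auto simp: mono_on_def)
    have low: "(\<Sum>j<i. ?Z j \<omega>) = X (g N i) \<omega> - X a \<omega>" for i \<omega>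
      by (subst sum_lessThan_telescope) (simp add: g0)
    have high: "(\<Sum>j\<in>{i..<Suc N}. ?Z j \<omega>) = X b \<omega> - X (g N i) \<omega>" if "i \<le> Suc N" for i \<omega>
      using that by (subst sum_Suc_diff') (simp_all add: gN)
    have "prob {\<omega> \<in> space M. \<exists>i\<le>Suc N. 2 * e < norm (\<Sum>j<i. ?Z j \<omega>)}
        \<le> 2 * prob {\<omega> \<in> space M. e < norm (\<Sum>j<Suc N. ?Z j \<omega>)}"
    proof (rule ottaviani_inequality[OF ind])
      fix i assume i: "i \<le> Suc N"
      show "prob {\<omega> \<in> space M. e < norm (\<Sum>j\<in>{i..<Suc N}. ?Z j \<omega>)} \<le> 1 / 2"
        unfolding high[OF i] using g_ge[of N i] g_mono[OF i, of N] gN[of N] by (intro tail) auto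
    qed
    then show ?thesis
      unfolding low gN E_def .
  qed
  define L where "L = (\<Union>k. \<Inter>N\<in>{k..}. E N)"
  have [measurable]: "(\<Inter>N\<in>{k..}. E N) \<in> events" for k
    by (intro sets.countable_INT') auto
  have "(\<lambda>k. prob (\<Inter>N\<in>{k..}. E N)) \<longlonglongrightarrow> prob L"
    unfolding L_def by (rule finite_Lim_measure_incseq) (auto simp: incseq_def)
  moreover have "prob (\<Inter>N\<in>{k..}. E N) \<le> ?bound" for k
    by (rule order_trans[OF finite_measure_mono E_prob[of k]]) auto
  ultimately have "prob L \<le> ?bound"
    by (intro LIMSEQ_le_const2[of _ _ ?bound]) blast+
  moreover have "L \<in> events" unfolding L_def by measurable
  moreover have "\<omega> \<in> L" if \<omega>: "\<omega> \<in> space M" and t: "t \<in> {a..b}" and big: "2 * e < norm (X t \<omega> - X a \<omega>)" for \<omega> t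
  proof (cases "t = b")
    case True
    have "\<omega> \<in> E N" for N
      using \<omega> big unfolding E_def by (auto simp: True gN intro!: exI[of _ "Suc N"])
    then show ?thesis by (auto simp: L_def)
  next
    case False
    then have tb: "t < b" "0 \<le> t" using t ab by auto
    have "((\<lambda>u. norm (X u \<omega> - X a \<omega>)) \<longlongrightarrow> norm (X t \<omega> - X a \<omega>)) (at_right t)"
      using cont[OF \<omega> tb(2)] by (intro tendsto_intros)
    then have "\<forall>\<^sub>F u in at_right t. 2 * e < norm (X u \<omega> - X a \<omega>)"
      using big by (rule order_tendstoD)
    then obtain d where d: "t < d" "\<And>u. t < u \<Longrightarrow> u < d \<Longrightarrow> 2 * e < norm (X u \<omega> - X a \<omega>)"
      by (auto simp: eventually_at_right_field)
    obtain k :: nat where k: "(b - a) / (min d b - t) < real k"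
      using reals_Archimedean2 by blast
    have "\<omega> \<in> E N" if "k \<le> N" for N
    proof -
      \<comment> \<open>the first grid point strictly to the right of \<open>t\<close>\<close>
      define i where "i = nat \<lfloor>(t - a) * real (Suc N) / (b - a)\<rfloor> + 1"
      have nn: "0 \<le> (t - a) * real (Suc N) / (b - a)"
        using t ab by simp
      then have i: "real i - 1 \<le> (t - a) * real (Suc N) / (b - a)" "(t - a) * real (Suc N) / (b - a) < real i"
        unfolding i_def by linarith+
      have pos: "0 < real (Suc N)" by simp
      have "(t - a) * real (Suc N) < real i * (b - a)"
        using i(2) ab by (simp add: field_simps)
      then have 1: "t < g N i"
        using pos by (simp add: g_def field_simps)
      have "(real i - 1) * (b - a) \<le> (t - a) * real (Suc N)"
        using i(1) ab by (simp add: field_simps)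
      moreover have "b - a < (min d b - t) * real (Suc N)"
      proof -
        have "(b - a) / (min d b - t) < real (Suc N)" using k that by simp
        then show ?thesis using d(1) tb(1) by (simp add: field_simps)
      qed
      ultimately have "real i * (b - a) < (t - a) * real (Suc N) + (min d b - t) * real (Suc N)"
        by (simp add: left_diff_distrib)
      also have "\<dots> = (min d b - a) * real (Suc N)"
        by (simp add: distrib_right[symmetric])
      finally have "(b - a) * real i / real (Suc N) < min d b - a"
        using pos by (simp add: pos_divide_less_eq mult.commute)
      then have 2: "g N i < min d b"
        unfolding g_def by linarith
      have "i \<le> Suc N"
      proof (rule ccontr)
        assume "\<not> i \<le> Suc N"
        then have "g N (Suc N) \<le> g N i" by (intro g_mono) simp
        with 2 gN[of N] show False by simp
      qed
      with 1 2 d(2)[of "g N i"] \<omega> show ?thesis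
        unfolding E_def by auto
    qed
    then show ?thesis by (auto simp: L_def)
  qed
  ultimately show thesis using that by blast
qed

section \<open>Step path approximation on a grid\<close>

definition grid_increments :: "nat \<Rightarrow> nat \<Rightarrow> (real \<Rightarrow> 'w \<Rightarrow> 'a::real_normed_vector) \<Rightarrow> 'w \<Rightarrow> nat \<Rightarrow> 'a" where
  "grid_increments m n X \<omega> = (\<lambda>j. if j < n then X (real (Suc j) / real m) \<omega> - X (real j / real m) \<omega> else 0)"

lemma grid_increments_measurable [measurable]:
  fixes X :: "real \<Rightarrow> 'w \<Rightarrow> 'a::euclidean_space"
  assumes [measurable]: "\<And>t. 0 \<le> t \<Longrightarrow> X t \<in> borel_measurable M"
  shows "grid_increments m n X \<in> borel_measurable M"
proof (rule measurable_coordinatewise_then_product)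
  fix j
  show "(\<lambda>\<omega>. grid_increments m n X \<omega> j) \<in> borel_measurable M"
    unfolding grid_increments_def by (cases "j < n") simp_all
qed

lemma step_path_grid_increments:
  assumes m: "0 < m" and t: "0 \<le> t" "t \<le> real n / real m"
  shows "step_path m n (grid_increments m n X \<omega>) t = X (real (nat \<lfloor>real m * t\<rfloor>) / real m) \<omega> - X 0 \<omega>"
proof -
  have "real m * t \<le> real n" using m t by (simp add: field_simps)
  then have le: "nat \<lfloor>real m * t\<rfloor> \<le> n" by linarith
  then have "step_path m n (grid_increments m n X \<omega>) t =
      (\<Sum>j<nat \<lfloor>real m * t\<rfloor>. X (real (Suc j) / real m) \<omega> - X (real j / real m) \<omega>)"
    using t(1) by (auto simp: step_path_def grid_increments_def min_absorb2 intro!: sum.cong)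
  also have "\<dots> = X (real (nat \<lfloor>real m * t\<rfloor>) / real m) \<omega> - X (real 0 / real m) \<omega>"
    by (rule sum_lessThan_telescope)
  finally show ?thesis by simp
qed

lemma grid_cell:
  assumes m: "0 < m" and t: "0 \<le> t"
  shows "real (nat \<lfloor>real m * t\<rfloor>) / real m \<le> t" "t < real (Suc (nat \<lfloor>real m * t\<rfloor>)) / real m"
proof -
  have "real (nat \<lfloor>real m * t\<rfloor>) \<le> real m * t" "real m * t < real (Suc (nat \<lfloor>real m * t\<rfloor>))"
    using zero_le_mult_iff[of "real m" t] t by linarith+
  then show "real (nat \<lfloor>real m * t\<rfloor>) / real m \<le> t" "t < real (Suc (nat \<lfloor>real m * t\<rfloor>)) / real m"
    using m by (simp_all add: field_simps)
qed

lemma independent_grid_increments: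
  assumes "independent_increments M X" and m: "0 < m"
  shows "prob_space.indep_vars M (\<lambda>_. borel)
    (\<lambda>j \<omega>. X (real (Suc j) / real m) \<omega> - X (real j / real m) \<omega>) {..<n}"
proof -
  have "0 \<le> real 0 / real m \<and> mono_on {..n} (\<lambda>j. real j / real m)"
    by (auto simp: mono_on_def divide_right_mono)
  then show ?thesis
    using assms(1)[unfolded independent_increments_def, rule_format, of "\<lambda>j. real j / real m" n] by blast
qed

text \<open>On a grid cell the step path stays at the value of \<open>X\<close> at the left end point, so the error is the
oscillation of \<open>X\<close> over single cells. The exceptional event is the union over the cells of the events from
Ottaviani's inequality.\<close>
lemma (in prob_space) step_path_error:
  fixes X :: "real \<Rightarrow> 'a \<Rightarrow> 'b::euclidean_space"
  assumes X[measurable]: "\<And>t. 0 \<le> t \<Longrightarrow> X t \<in> borel_measurable M"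
    and cadlag: "\<And>\<omega>. \<omega> \<in> space M \<Longrightarrow> cadlag (\<lambda>t. X t \<omega>)"
    and zero: "\<And>\<omega>. \<omega> \<in> space M \<Longrightarrow> X 0 \<omega> = 0"
    and indep: "independent_increments M X"
    and m: "0 < m" and e: "0 \<le> e"
    and tail: "\<And>s t. 0 \<le> s \<Longrightarrow> s \<le> t \<Longrightarrow> t \<le> s + 1 / real m \<Longrightarrow> prob {\<omega> \<in> space M. e < norm (X t \<omega> - X s \<omega>)} \<le> 1 / 2"
  obtains E where "E \<in> events"
    "\<And>\<omega>. \<omega> \<in> space M - E \<Longrightarrow>
       path_dist (real k) (\<lambda>t\<in>{0..}. X t \<omega>) (step_path m (m * k) (grid_increments m (m * k) X \<omega>)) \<le> 2 * e"
    "prob E \<le> 2 * (\<Sum>j<m * k. prob {\<omega> \<in> space M. e < norm (grid_increments m (m * k) X \<omega> j)})"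
proof -
  let ?p = "\<lambda>j. real j / real m"
  define good where "good j E \<longleftrightarrow> E \<in> events \<and>
      (\<forall>\<omega> t. \<omega> \<in> space M \<longrightarrow> t \<in> {?p j..?p (Suc j)} \<longrightarrow> 2 * e < norm (X t \<omega> - X (?p j) \<omega>) \<longrightarrow> \<omega> \<in> E) \<and>
      prob E \<le> 2 * prob {\<omega> \<in> space M. e < norm (X (?p (Suc j)) \<omega> - X (?p j) \<omega>)}" for j E
  have "\<forall>j. \<exists>E. good j E"
  proof
    fix j
    have rc: "((\<lambda>u. X u \<omega>) \<longlongrightarrow> X t \<omega>) (at_right t)" if "\<omega> \<in> space M" "0 \<le> t" for \<omega> t
      using cadlag[OF that(1)] that(2) by (simp add: cadlag_def)
    show "\<exists>E. good j E"
    proof (rule oscillation_bound[OF X rc indep, of "?p j" "?p (Suc j)" e])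
      fix s assume s: "?p j \<le> s" "s \<le> ?p (Suc j)"
      have "?p (Suc j) = ?p j + 1 / real m" by (simp add: add_divide_distrib)
      moreover have "0 \<le> ?p j" by simp
      ultimately have "0 \<le> s" "?p (Suc j) \<le> s + 1 / real m" using s by linarith+
      with s(2) show "prob {\<omega> \<in> space M. e < norm (X (?p (Suc j)) \<omega> - X s \<omega>)} \<le> 1 / 2"
        by (intro tail)
    qed (use m in \<open>auto simp: good_def divide_strict_right_mono\<close>)
  qed
  then obtain E where "\<And>j. good j (E j)" by metis
  then have E: "\<And>j. E j \<in> events"
    "\<And>j \<omega> t. \<omega> \<in> space M \<Longrightarrow> t \<in> {?p j..?p (Suc j)} \<Longrightarrow> 2 * e < norm (X t \<omega> - X (?p j) \<omega>) \<Longrightarrow> \<omega> \<in> E j"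
    "\<And>j. prob (E j) \<le> 2 * prob {\<omega> \<in> space M. e < norm (X (?p (Suc j)) \<omega> - X (?p j) \<omega>)}"
    unfolding good_def by blast+
  let ?E = "\<Union>j<m * k. E j"
  show thesis
  proof (rule that[of ?E])
    show "?E \<in> events" using E(1) by auto
    have "prob ?E \<le> (\<Sum>j<m * k. prob (E j))"
      using E(1) by (intro finite_measure_subadditive_finite) auto
    also have "\<dots> \<le> (\<Sum>j<m * k. 2 * prob {\<omega> \<in> space M. e < norm (grid_increments m (m * k) X \<omega> j)})"
      using E(3) by (intro sum_mono) (simp add: grid_increments_def)
    finally show "prob ?E \<le> 2 * (\<Sum>j<m * k. prob {\<omega> \<in> space M. e < norm (grid_increments m (m * k) X \<omega> j)})"
      by (simp add: sum_distrib_left)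
  next
    fix \<omega> assume \<omega>: "\<omega> \<in> space M - ?E"
    show "path_dist (real k) (\<lambda>t\<in>{0..}. X t \<omega>) (step_path m (m * k) (grid_increments m (m * k) X \<omega>)) \<le> 2 * e"
    proof (rule path_dist_least)
      fix t assume t: "t \<in> {0..real k}"
      let ?j = "nat \<lfloor>real m * t\<rfloor>"
      have cell: "?p ?j \<le> t" "t < ?p (Suc ?j)"
        using grid_cell[OF m, of t] t by auto
      have step: "step_path m (m * k) (grid_increments m (m * k) X \<omega>) t = X (?p ?j) \<omega>"
        using step_path_grid_increments[OF m, of t "m * k" X \<omega>] t m zero[of \<omega>] \<omega> by simp
      have "norm (X t \<omega> - X (?p ?j) \<omega>) \<le> 2 * e"
      proof (cases "?j < m * k")
        case True
        with E(2)[of \<omega> t ?j] cell \<omega> show ?thesis by fastforce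
      next
        case False
        \<comment> \<open>the end of the horizon: \<open>t = k\<close> is itself a grid point, and the error is \<open>0\<close>\<close>
        then have "real (m * k) \<le> real ?j" by (simp only: of_nat_le_iff not_less)
        then have "real k \<le> ?p ?j" using m by (simp add: field_simps)
        with cell(1) t have "t = ?p ?j" unfolding atLeastAtMost_iff by linarith
        then have "X t \<omega> - X (?p ?j) \<omega> = 0" by (metis diff_self)
        with e show ?thesis by simp
      qed
      then show "min 1 (dist ((\<lambda>t\<in>{0..}. X t \<omega>) t) (step_path m (m * k) (grid_increments m (m * k) X \<omega>) t)) \<le> 2 * e"
        using t by (simp add: step dist_norm)
    qed simp
  qed
qed

text \<open>The chain \<open>\<phi>(X) \<ge> \<phi>\<^sub>k(A X) - k d\<^sub>k(X, A X)\<close>, where \<open>A\<close> samples at the multiples of \<open>1/m\<close>, integrated. The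
distance is at most \<open>2 e\<close> off the exceptional event and at most \<open>1\<close> on it.\<close>
lemma (in prob_space) expectation_lower_bound:
  fixes X :: "real \<Rightarrow> 'a \<Rightarrow> 'b::euclidean_space" and \<phi> :: "(real \<Rightarrow> 'b) \<Rightarrow> real"
  assumes X[measurable]: "\<And>t. 0 \<le> t \<Longrightarrow> X t \<in> borel_measurable M"
    and cadlag: "\<And>\<omega>. \<omega> \<in> space M \<Longrightarrow> cadlag (\<lambda>t. X t \<omega>)"
    and zero: "\<And>\<omega>. \<omega> \<in> space M \<Longrightarrow> X 0 \<omega> = 0"
    and indep: "independent_increments M X"
    and m: "0 < m" and e: "0 \<le> e"
    and tail: "\<And>s t. 0 \<le> s \<Longrightarrow> s \<le> t \<Longrightarrow> t \<le> s + 1 / real m \<Longrightarrow> prob {\<omega> \<in> space M. e < norm (X t \<omega> - X s \<omega>)} \<le> 1 / 2"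
    and bound: "\<And>y. y \<in> skorokhod_paths \<Longrightarrow> \<bar>\<phi> y\<bar> \<le> B"
    and \<phi>[measurable]: "\<phi> \<in> borel_measurable skorokhod_algebra"
  shows "expectation (\<lambda>\<omega>. lower_envelope \<phi> k (step_path m (m * k) (grid_increments m (m * k) X \<omega>)))
      - real k * (2 * e + 2 * (\<Sum>j<m * k. prob {\<omega> \<in> space M. e < norm (grid_increments m (m * k) X \<omega> j)}))
    \<le> expectation (\<lambda>\<omega>. \<phi> (\<lambda>t\<in>{0..}. X t \<omega>))"
proof -
  let ?g = "\<lambda>\<omega>. lower_envelope \<phi> k (step_path m (m * k) (grid_increments m (m * k) X \<omega>))"
  let ?f = "\<lambda>\<omega>. \<phi> (\<lambda>t\<in>{0..}. X t \<omega>)"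
  let ?S = "\<Sum>j<m * k. prob {\<omega> \<in> space M. e < norm (grid_increments m (m * k) X \<omega> j)}"
  obtain E where E: "E \<in> events"
    "\<And>\<omega>. \<omega> \<in> space M - E \<Longrightarrow>
       path_dist (real k) (\<lambda>t\<in>{0..}. X t \<omega>) (step_path m (m * k) (grid_increments m (m * k) X \<omega>)) \<le> 2 * e"
    "prob E \<le> 2 * ?S"
    using step_path_error[OF X cadlag zero indep m e tail] by blast
  have path: "(\<lambda>t\<in>{0..}. X t \<omega>) \<in> skorokhod_paths" if "\<omega> \<in> space M" for \<omega>
    by (rule restrict_in_skorokhod_paths[OF cadlag[OF that]])
  have "(\<lambda>\<omega>. \<lambda>t\<in>{0..}. X t \<omega>) \<in> measurable M skorokhod_algebra"
    by (rule measurable_path[OF X cadlag])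
  then have fm: "?f \<in> borel_measurable M"
    using \<phi> by (rule measurable_compose)
  have "(\<lambda>x. lower_envelope \<phi> k (step_path m (m * k) x)) \<in> borel_measurable borel"
    by (rule borel_measurable_continuous_onI[OF continuous_lower_envelope_step_path[OF bound m]])
  then have gm: "?g \<in> borel_measurable M"
    using grid_increments_measurable[OF X] by (rule measurable_compose[rotated])
  have int: "integrable M ?f" "integrable M ?g"
    using fm gm bound[OF path] lower_envelope_abs_le[of \<phi> B, OF bound step_path_in_skorokhod_paths[OF m]]
    by (auto intro!: integrable_const_bound[of _ B])
  have intE: "integrable M (indicat_real E)"
    using E(1) by (simp add: less_top[symmetric])
  have "expectation ?g \<le> expectation (\<lambda>\<omega>. ?f \<omega> + real k * (2 * e + indicator E \<omega>))"
  proof (rule integral_mono[OF int(2)])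
    show "integrable M (\<lambda>\<omega>. ?f \<omega> + real k * (2 * e + indicator E \<omega>))"
      using int(1) intE by (intro Bochner_Integration.integrable_add integrable_mult_right integrable_const)
    fix \<omega> assume \<omega>: "\<omega> \<in> space M"
    let ?x = "\<lambda>t\<in>{0..}. X t \<omega>" and ?s = "step_path m (m * k) (grid_increments m (m * k) X \<omega>)"
    have s: "?s \<in> skorokhod_paths" by (rule step_path_in_skorokhod_paths[OF m])
    have "path_dist (real k) ?x ?s \<le> 1"
      by (rule path_dist_least) auto
    then have "path_dist (real k) ?x ?s \<le> 2 * e + indicator E \<omega>"
      using E(2)[of \<omega>] \<omega> e by (cases "\<omega> \<in> E") (auto simp: indicator_def)
    then have "real k * path_dist (real k) ?s ?x \<le> real k * (2 * e + indicator E \<omega>)"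
      by (intro mult_left_mono) (simp_all add: path_dist_commute)
    moreover have "lower_envelope \<phi> k ?s \<le> \<phi> ?x + real k * path_dist (real k) ?s ?x"
      by (rule lower_envelope_lower[OF bound path[OF \<omega>]])
    ultimately show "?g \<omega> \<le> ?f \<omega> + real k * (2 * e + indicator E \<omega>)"
      by linarith
  qed
  also have "\<dots> = expectation ?f + real k * (2 * e + prob E)"
    using int(1) intE E(1) by (simp add: prob_space)
  also have "\<dots> \<le> expectation ?f + real k * (2 * e + 2 * ?S)"
    using E(3) by (intro add_left_mono mult_left_mono) auto
  finally show ?thesis by simp
qed

text \<open>Quantitative converse of the union bound: if independent events are unlikely to occur at all, then
the sum of their probabilities is small. It follows from \<open>1 - p \<le> exp(- p)\<close>.\<close>
lemma (in prob_space) prob_Ex_indep_ge: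
  fixes n :: nat
  assumes indep: "indep_vars (\<lambda>_. N) Z {..<n}" and A: "A \<in> sets N"
  shows "1 - exp (- (\<Sum>j<n. prob {\<omega> \<in> space M. Z j \<omega> \<in> A})) \<le> prob {\<omega> \<in> space M. \<exists>j<n. Z j \<omega> \<in> A}"
proof (cases "n = 0")
  case False
  have Zm: "random_variable N (Z j)" if "j < n" for j
    using indep that by (auto simp: indep_vars_def)
  have ev: "{\<omega> \<in> space M. Z j \<omega> \<in> A} \<in> events" if "j < n" for j
    using measurable_sets[OF Zm[OF that] A] by (simp add: vimage_def Int_def conj_commute)
  have Ex: "{\<omega> \<in> space M. \<exists>j<n. Z j \<omega> \<in> A} = (\<Union>j<n. {\<omega> \<in> space M. Z j \<omega> \<in> A})" by auto
  have "prob (space M - {\<omega> \<in> space M. \<exists>j<n. Z j \<omega> \<in> A}) = prob (\<Inter>j\<in>{..<n}. Z j -` (space N - A) \<inter> space M)"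
    using False Zm by (intro arg_cong[of _ _ prob]) (auto dest: measurable_space)
  also have "\<dots> = (\<Prod>j<n. prob (Z j -` (space N - A) \<inter> space M))"
    using False A by (intro indep_varsD_finite[OF indep]) auto
  also have "\<dots> = (\<Prod>j<n. 1 - prob {\<omega> \<in> space M. Z j \<omega> \<in> A})"
  proof (rule prod.cong[OF refl])
    fix j assume "j \<in> {..<n}"
    then have j: "j < n" by simp
    have "Z j -` (space N - A) \<inter> space M = space M - {\<omega> \<in> space M. Z j \<omega> \<in> A}"
      using Zm[OF j] by (auto dest: measurable_space)
    then show "prob (Z j -` (space N - A) \<inter> space M) = 1 - prob {\<omega> \<in> space M. Z j \<omega> \<in> A}"
      using prob_compl[OF ev[OF j]] by simp
  qed
  also have "\<dots> \<le> (\<Prod>j<n. exp (- prob {\<omega> \<in> space M. Z j \<omega> \<in> A}))"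
  proof (rule prod_mono)
    fix j
    show "0 \<le> 1 - prob {\<omega> \<in> space M. Z j \<omega> \<in> A} \<and>
        1 - prob {\<omega> \<in> space M. Z j \<omega> \<in> A} \<le> exp (- prob {\<omega> \<in> space M. Z j \<omega> \<in> A})"
      using exp_ge_add_one_self[of "- prob {\<omega> \<in> space M. Z j \<omega> \<in> A}"] by simp
  qed
  also have "\<dots> = exp (- (\<Sum>j<n. prob {\<omega> \<in> space M. Z j \<omega> \<in> A}))"
    by (simp add: sum_negf[symmetric] exp_sum)
  finally have "prob (space M - {\<omega> \<in> space M. \<exists>j<n. Z j \<omega> \<in> A}) \<le> exp (- (\<Sum>j<n. prob {\<omega> \<in> space M. Z j \<omega> \<in> A}))" .
  moreover have "prob (space M - {\<omega> \<in> space M. \<exists>j<n. Z j \<omega> \<in> A}) = 1 - prob {\<omega> \<in> space M. \<exists>j<n. Z j \<omega> \<in> A}"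
    unfolding Ex using ev by (intro prob_compl) auto
  ultimately show ?thesis by simp
qed simp

lemma continuous_path_small_cells:
  fixes x :: "real \<Rightarrow> 'a::metric_space"
  assumes cont: "continuous_on {0..} x" and e: "0 < e"
  shows "\<forall>\<^sub>F m in sequentially. \<forall>s\<in>{0..T}. \<forall>t\<in>{0..T}. \<bar>s - t\<bar> \<le> 1 / real m \<longrightarrow> dist (x s) (x t) < e"
proof -
  have "uniformly_continuous_on {0..T} x"
    by (intro compact_uniformly_continuous continuous_on_subset[OF cont]) auto
  then obtain d where d: "0 < d" "\<And>s t. s \<in> {0..T} \<Longrightarrow> t \<in> {0..T} \<Longrightarrow> dist t s < d \<Longrightarrow> dist (x t) (x s) < e"
    using e unfolding uniformly_continuous_on_def by metis
  have "\<forall>\<^sub>F m in sequentially. 1 / real m < d"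
    using order_tendstoD(2)[OF lim_1_over_n d(1)] .
  then show ?thesis
  proof eventually_elim
    case (elim m)
    then show ?case using d(2) by (auto simp: dist_real_def)
  qed
qed

text \<open>By uniform continuity on \<open>[0, k]\<close>, each path has no grid increment of size \<open>e\<close> once the grid is fine enough.
So the probability of some such increment tends to \<open>0\<close>, and by independence the sum of the single
probabilities does as well.\<close>
lemma (in prob_space) sum_prob_jumps_tendsto_0:
  fixes W :: "real \<Rightarrow> 'a \<Rightarrow> 'b::euclidean_space"
  assumes W[measurable]: "\<And>t. 0 \<le> t \<Longrightarrow> W t \<in> borel_measurable M"
    and cont: "\<And>\<omega>. \<omega> \<in> space M \<Longrightarrow> continuous_on {0..} (\<lambda>t. W t \<omega>)"
    and indep: "independent_increments M W" and e: "0 < e"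
  shows "(\<lambda>m. \<Sum>j<m * k. prob {\<omega> \<in> space M. e \<le> norm (grid_increments m (m * k) W \<omega> j)}) \<longlonglongrightarrow> 0"
proof -
  define A where "A m = {\<omega> \<in> space M. \<exists>j<m * k. e \<le> norm (grid_increments m (m * k) W \<omega> j)}" for m
  define S where "S m = (\<Sum>j<m * k. prob {\<omega> \<in> space M. e \<le> norm (grid_increments m (m * k) W \<omega> j)})" for m
  have [measurable]: "(\<lambda>\<omega>. grid_increments m n W \<omega> j) \<in> borel_measurable M" for m n j
    using grid_increments_measurable[OF W] by (rule measurable_product_then_coordinatewise)
  have [measurable]: "A m \<in> events" for m
    unfolding A_def by measurable
  have "(\<lambda>m. expectation (indicat_real (A m))) \<longlonglongrightarrow> expectation (\<lambda>_. 0)"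
  proof (rule integral_dominated_convergence[where w = "\<lambda>_. 1"])
    show "AE \<omega> in M. (\<lambda>m. indicat_real (A m) \<omega>) \<longlonglongrightarrow> 0"
    proof (rule AE_I2)
      fix \<omega> assume \<omega>: "\<omega> \<in> space M"
      have "\<forall>\<^sub>F m in sequentially. \<omega> \<notin> A m"
        using continuous_path_small_cells[OF cont[OF \<omega>] e, of "real k"] eventually_gt_at_top[of 0]
      proof eventually_elim
        case (elim m)
        show ?case
        proof
          assume "\<omega> \<in> A m"
          then obtain j where j: "j < m * k" "e \<le> norm (W (real (Suc j) / real m) \<omega> - W (real j / real m) \<omega>)"
            by (auto simp: A_def grid_increments_def)
          have "real (Suc j) \<le> real (m * k)" using j(1) by (simp only: of_nat_le_iff Suc_le_eq)
          then have "real (Suc j) / real m \<le> real k" using elim(2) by (simp add: field_simps)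
          moreover have eq: "real (Suc j) / real m = real j / real m + 1 / real m"
            by (simp add: add_divide_distrib)
          moreover have "0 \<le> 1 / real m" "0 \<le> real j / real m" by simp_all
          ultimately have "real j / real m \<in> {0..real k}" "real (Suc j) / real m \<in> {0..real k}"
              "\<bar>real (Suc j) / real m - real j / real m\<bar> \<le> 1 / real m"
            unfolding atLeastAtMost_iff by linarith+
          with elim(1) have "dist (W (real (Suc j) / real m) \<omega>) (W (real j / real m) \<omega>) < e" by blast
          with j(2) show False by (simp add: dist_norm)
        qed
      qed
      then show "(\<lambda>m. indicat_real (A m) \<omega>) \<longlonglongrightarrow> 0"
        by (intro tendsto_eventually) (auto elim!: eventually_mono)
    qed
  qed auto
  then have PA: "(\<lambda>m. prob (A m)) \<longlonglongrightarrow> 0" by simp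
  have le: "1 - exp (- S m) \<le> prob (A m)" if "0 < m" for m
  proof -
    have "indep_vars (\<lambda>_. borel) (\<lambda>j \<omega>. grid_increments m (m * k) W \<omega> j) {..<m * k}"
      using independent_grid_increments[OF indep that, of "m * k"]
      by (rule indep_vars_cong[THEN iffD1, rotated -1]) (auto simp: grid_increments_def)
    from prob_Ex_indep_ge[OF this, of "{x. e \<le> norm x}"] show ?thesis
      by (simp add: S_def A_def)
  qed
  have "\<forall>\<^sub>F m in sequentially. S m \<le> - ln (1 - prob (A m))"
    using order_tendstoD(2)[OF PA zero_less_one] eventually_gt_at_top[of 0]
  proof eventually_elim
    case (elim m)
    have "ln (1 - prob (A m)) \<le> ln (exp (- S m))"
      using le[OF elim(2)] elim(1) by (intro ln_mono) simp_all
    then show ?case by simp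
  qed
  moreover have "(\<lambda>m. - ln (1 - prob (A m))) \<longlonglongrightarrow> - ln (1 - 0)"
    by (intro tendsto_intros PA) auto
  ultimately have "S \<longlonglongrightarrow> 0"
    by (intro tendsto_sandwich[of "\<lambda>_. 0" S sequentially "\<lambda>m. - ln (1 - prob (A m))" 0]) (auto simp: S_def intro!: always_eventually sum_nonneg)
  then show ?thesis by (simp add: S_def[abs_def])
qed

section \<open>A functional limit theorem in the Skorokhod space\<close>

lemma (in prob_space) char_indep_sum:
  fixes Z :: "nat \<Rightarrow> 'a \<Rightarrow> 'b::euclidean_space"
  assumes indep: "indep_vars (\<lambda>_. borel) Z {..<n}"
  shows "(LINT \<omega>|M. iexp (\<Sum>k<n. u k \<bullet> Z k \<omega>)) = (\<Prod>k<n. (LINT \<omega>|M. iexp (u k \<bullet> Z k \<omega>)))"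
proof -
  have "(LINT \<omega>|M. iexp (\<Sum>k<n. u k \<bullet> Z k \<omega>)) = (LINT \<omega>|M. (\<Prod>k<n. iexp (u k \<bullet> Z k \<omega>)))"
    by (simp add: sum_distrib_left exp_sum)
  also have "\<dots> = (\<Prod>k<n. (LINT \<omega>|M. iexp (u k \<bullet> Z k \<omega>)))"
  proof (rule indep_vars_lebesgue_integral)
    show "indep_vars (\<lambda>_. borel) (\<lambda>k \<omega>. iexp (u k \<bullet> Z k \<omega>)) {..<n}"
      by (rule indep_vars_compose2[OF indep]) measurable
    fix k assume k: "k \<in> {..<n}"
    have [measurable]: "random_variable borel (Z k)"
      using indep k by (auto simp: indep_vars_def)
    show "integrable M (\<lambda>\<omega>. iexp (u k \<bullet> Z k \<omega>))"
      by (intro integrable_const_bound[of _ 1]) auto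
  qed simp
  finally show ?thesis .
qed

lemma step_path_approximates_continuous_path:
  fixes W :: "real \<Rightarrow> 'w \<Rightarrow> 'a::real_normed_vector"
  assumes cont: "continuous_on {0..} (\<lambda>t. W t \<omega>)" and zero: "W 0 \<omega> = 0"
  shows "(\<lambda>m. path_dist (real k) (\<lambda>t\<in>{0..}. W t \<omega>) (step_path m (m * k) (grid_increments m (m * k) W \<omega>))) \<longlonglongrightarrow> 0"
proof (rule LIMSEQ_I)
  fix e :: real assume e: "0 < e"
  have "\<forall>\<^sub>F m in sequentially.
      norm (path_dist (real k) (\<lambda>t\<in>{0..}. W t \<omega>) (step_path m (m * k) (grid_increments m (m * k) W \<omega>)) - 0) < e"
    using continuous_path_small_cells[OF cont half_gt_zero[OF e], of "real k"] eventually_gt_at_top[of 0]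
  proof eventually_elim
    case (elim m)
    have "path_dist (real k) (\<lambda>t\<in>{0..}. W t \<omega>) (step_path m (m * k) (grid_increments m (m * k) W \<omega>)) \<le> e / 2"
    proof (rule path_dist_least)
      fix t assume t: "t \<in> {0..real k}"
      let ?s = "real (nat \<lfloor>real m * t\<rfloor>) / real m"
      have step: "step_path m (m * k) (grid_increments m (m * k) W \<omega>) t = W ?s \<omega>"
        using step_path_grid_increments[OF elim(2), of t "m * k" W \<omega>] t elim(2) zero by simp
      have "?s \<le> t" "t < ?s + 1 / real m" "0 \<le> ?s"
        using grid_cell[OF elim(2), of t] t by (simp_all add: add_divide_distrib add.commute)
      then have "?s \<in> {0..real k}" "\<bar>t - ?s\<bar> \<le> 1 / real m"
        using t unfolding atLeastAtMost_iff by linarith+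
      with elim(1) t have "dist (W t \<omega>) (W ?s \<omega>) < e / 2" by blast
      then show "min 1 (dist ((\<lambda>t\<in>{0..}. W t \<omega>) t) (step_path m (m * k) (grid_increments m (m * k) W \<omega>) t)) \<le> e / 2"
        using t by (simp add: step)
    qed simp
    moreover have "0 \<le> path_dist (real k) (\<lambda>t\<in>{0..}. W t \<omega>) (step_path m (m * k) (grid_increments m (m * k) W \<omega>))"
      by (rule path_dist_nonneg) simp
    ultimately show ?case using e by simp
  qed
  then show "\<exists>m0. \<forall>m\<ge>m0.
      norm (path_dist (real k) (\<lambda>t\<in>{0..}. W t \<omega>) (step_path m (m * k) (grid_increments m (m * k) W \<omega>)) - 0) < e"
    by (simp add: eventually_sequentially)
qed

lemma cadlag_continuous:
  assumes "continuous_on {0..} x" shows "cadlag x"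
  unfolding cadlag_def
proof (intro conjI allI impI)
  fix t :: real assume t: "0 \<le> t"
  have "(x \<longlongrightarrow> x t) (at t within {0..})"
    using assms t by (auto simp: continuous_on_def)
  then show "(x \<longlongrightarrow> x t) (at_right t)"
    by (rule tendsto_within_subset) (use t in auto)
next
  fix t :: real assume t: "0 < t"
  have "(x \<longlongrightarrow> x t) (at t within {0..})"
    using assms t by (auto simp: continuous_on_def)
  moreover have "at t within {0..} = at t"
    using t by (intro at_within_interior) (simp add: interior_Ici[of "-1"])
  ultimately have "(x \<longlongrightarrow> x t) (at t)" by simp
  then show "\<exists>l. (x \<longlongrightarrow> l) (at_left t)"
    by (auto intro: filterlim_at_within_If tendsto_within_subset)
qed

text \<open>The first part is a consequence of the argument for the second: the envelope at a continuous path is a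
pointwise limit of the envelopes at step paths, which are measurable. This needs the process to start
exactly at \<open>0\<close>, since an exceptional null set could destroy measurability of the limit.\<close>
lemma (in prob_space) expectation_step_path_tendsto:
  fixes W :: "real \<Rightarrow> 'a \<Rightarrow> 'b::euclidean_space" and \<phi> :: "(real \<Rightarrow> 'b) \<Rightarrow> real"
  assumes W[measurable]: "\<And>t. 0 \<le> t \<Longrightarrow> W t \<in> borel_measurable M"
    and zero: "\<And>\<omega>. \<omega> \<in> space M \<Longrightarrow> W 0 \<omega> = 0"
    and cont: "\<And>\<omega>. \<omega> \<in> space M \<Longrightarrow> continuous_on {0..} (\<lambda>t. W t \<omega>)"
    and bound: "\<And>y. y \<in> skorokhod_paths \<Longrightarrow> \<bar>\<phi> y\<bar> \<le> B"
  shows "(\<lambda>\<omega>. lower_envelope \<phi> k (\<lambda>t\<in>{0..}. W t \<omega>)) \<in> borel_measurable M" (is ?meas)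
    and "(\<lambda>m. expectation (\<lambda>\<omega>. lower_envelope \<phi> k (step_path m (m * k) (grid_increments m (m * k) W \<omega>))))
      \<longlonglongrightarrow> expectation (\<lambda>\<omega>. lower_envelope \<phi> k (\<lambda>t\<in>{0..}. W t \<omega>))" (is ?lim)
proof -
  let ?s = "\<lambda>m \<omega>. step_path (Suc m) (Suc m * k) (grid_increments (Suc m) (Suc m * k) W \<omega>)"
  let ?x = "\<lambda>\<omega>. \<lambda>t\<in>{0..}. W t \<omega>"
  have s: "?s m \<omega> \<in> skorokhod_paths" for m \<omega>
    by (rule step_path_in_skorokhod_paths) simp
  have x: "?x \<omega> \<in> skorokhod_paths" if "\<omega> \<in> space M" for \<omega>
    by (rule restrict_in_skorokhod_paths[OF cadlag_continuous[OF cont[OF that]]])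
  have meas: "(\<lambda>\<omega>. lower_envelope \<phi> k (?s m \<omega>)) \<in> borel_measurable M" for m
  proof -
    have "(\<lambda>x. lower_envelope \<phi> k (step_path (Suc m) (Suc m * k) x)) \<in> borel_measurable borel"
      by (rule borel_measurable_continuous_onI[OF continuous_lower_envelope_step_path[OF bound]]) simp_all
    then show ?thesis
      using grid_increments_measurable[OF W] by (rule measurable_compose[rotated])
  qed
  have lim: "(\<lambda>m. lower_envelope \<phi> k (?s m \<omega>)) \<longlonglongrightarrow> lower_envelope \<phi> k (?x \<omega>)" if \<omega>: "\<omega> \<in> space M" for \<omega>
  proof -
    have dist0: "(\<lambda>m. path_dist (real k) (?x \<omega>) (?s m \<omega>)) \<longlonglongrightarrow> 0"
      using step_path_approximates_continuous_path[where W = W and k = k, OF cont[OF \<omega>] zero[OF \<omega>]]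
      by (rule LIMSEQ_Suc)
    then have "(\<lambda>m. real k * path_dist (real k) (?x \<omega>) (?s m \<omega>)) \<longlonglongrightarrow> real k * 0"
      by (intro tendsto_mult tendsto_const)
    then have d: "(\<lambda>m. real k * path_dist (real k) (?x \<omega>) (?s m \<omega>)) \<longlonglongrightarrow> 0" by simp
    have "norm (lower_envelope \<phi> k (?s m \<omega>) - lower_envelope \<phi> k (?x \<omega>)) \<le> real k * path_dist (real k) (?x \<omega>) (?s m \<omega>)" for m
      using lower_envelope_lipschitz[of \<phi> B, OF bound s[of m \<omega>] x[OF \<omega>], of k]
        lower_envelope_lipschitz[of \<phi> B, OF bound x[OF \<omega>] s[of m \<omega>], of k]
        path_dist_commute[of "real k" "?s m \<omega>" "?x \<omega>"]
      by (simp add: abs_le_iff)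
    then have "(\<lambda>m. lower_envelope \<phi> k (?s m \<omega>) - lower_envelope \<phi> k (?x \<omega>)) \<longlonglongrightarrow> 0"
      by (intro Lim_null_comparison[OF always_eventually d] allI)
    then show ?thesis by (simp add: LIM_zero_iff)
  qed
  show m: ?meas
    by (rule borel_measurable_LIMSEQ_real[OF lim meas])
  have "(\<lambda>m. expectation (\<lambda>\<omega>. lower_envelope \<phi> k (?s m \<omega>)))
      \<longlonglongrightarrow> expectation (\<lambda>\<omega>. lower_envelope \<phi> k (?x \<omega>))"
  proof (rule integral_dominated_convergence[where w = "\<lambda>_. B"])
    show "AE \<omega> in M. norm (lower_envelope \<phi> k (?s m \<omega>)) \<le> B" for m
      using lower_envelope_abs_le[of \<phi> B, OF bound s] by (intro AE_I2) (simp only: real_norm_def)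
  qed (use lim meas m in auto)
  then show ?lim by (rule LIMSEQ_imp_Suc)
qed

text \<open>Starting at \<open>0\<close> is required everywhere here, not only almost surely, so that step paths built from
increments approximate the paths at every point of the sample space. The constant \<open>c\<close> is uniform in the
index \<open>i\<close>; this yields tightness of the increments and the hypothesis of Ottaviani's inequality on fine
grids.\<close>
locale invariance_principle =
  fixes F :: "'i filter" and M :: "'i \<Rightarrow> 'w measure" and Z :: "'i \<Rightarrow> real \<Rightarrow> 'w \<Rightarrow> 'a::euclidean_space"
    and N :: "'v measure" and W :: "real \<Rightarrow> 'v \<Rightarrow> 'a" and c :: real
  assumes M: "\<And>i. prob_space (M i)" and N: "prob_space N"
    and Z_meas: "\<And>i t. 0 \<le> t \<Longrightarrow> Z i t \<in> borel_measurable (M i)"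
    and W_meas: "\<And>t. 0 \<le> t \<Longrightarrow> W t \<in> borel_measurable N"
    and Z_zero: "\<And>i \<omega>. \<omega> \<in> space (M i) \<Longrightarrow> Z i 0 \<omega> = 0"
    and W_zero: "\<And>\<omega>. \<omega> \<in> space N \<Longrightarrow> W 0 \<omega> = 0"
    and Z_cadlag: "\<And>i \<omega>. \<omega> \<in> space (M i) \<Longrightarrow> cadlag (\<lambda>t. Z i t \<omega>)"
    and W_cont: "\<And>\<omega>. \<omega> \<in> space N \<Longrightarrow> continuous_on {0..} (\<lambda>t. W t \<omega>)"
    and Z_indep: "\<And>i. independent_increments (M i) (Z i)"
    and W_indep: "independent_increments N W"
    and char_tendsto: "\<And>s t u. 0 \<le> s \<Longrightarrow> s \<le> t \<Longrightarrow>
        ((\<lambda>i. LINT \<omega>|M i. iexp (u \<bullet> (Z i t \<omega> - Z i s \<omega>))) \<longlongrightarrow> (LINT \<omega>|N. iexp (u \<bullet> (W t \<omega> - W s \<omega>)))) F"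
    and chebyshev: "\<And>i s t r. 0 \<le> s \<Longrightarrow> s \<le> t \<Longrightarrow> 0 < r \<Longrightarrow>
        measure (M i) {\<omega> \<in> space (M i). r < norm (Z i t \<omega> - Z i s \<omega>)} \<le> c * (t - s) / r\<^sup>2"
begin

lemma c_nonneg: "0 \<le> c"
proof -
  fix i
  show ?thesis using order_trans[OF measure_nonneg chebyshev[of 0 1 1 i]] by simp
qed

lemma grid_increments_weak_convergence:
  fixes g :: "(nat \<Rightarrow> 'a) \<Rightarrow> real"
  assumes m: "0 < m" and g: "continuous_on UNIV g" "\<And>x. \<bar>g x\<bar> \<le> B"
  shows "((\<lambda>i. LINT \<omega>|M i. g (grid_increments m n (Z i) \<omega>)) \<longlongrightarrow> (LINT \<omega>|N. g (grid_increments m n W \<omega>))) F"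
proof (rule weak_convergence_of_char_functions[where n = n and g = g and B = B
      and V = "\<lambda>i. grid_increments m n (Z i)" and U = "grid_increments m n W"])
  show "grid_increments m n (Z i) \<in> borel_measurable (M i)" for i
    by (rule grid_increments_measurable[OF Z_meas])
  show "grid_increments m n W \<in> borel_measurable N"
    by (rule grid_increments_measurable[OF W_meas])
  let ?p = "\<lambda>j. real j / real m"
  have eq: "(LINT \<omega>|P. iexp (\<Sum>k<n. u k \<bullet> grid_increments m n X \<omega> k)) =
      (\<Prod>k<n. (LINT \<omega>|P. iexp (u k \<bullet> (X (?p (Suc k)) \<omega> - X (?p k) \<omega>))))"
    if "prob_space P" "independent_increments P X" for u and P :: "'p measure" and X :: "real \<Rightarrow> 'p \<Rightarrow> 'a"
    unfolding prob_space.char_indep_sum[OF that(1) independent_grid_increments[OF that(2) m, of n], symmetric]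
    by (simp add: grid_increments_def)
  show "((\<lambda>i. LINT \<omega>|M i. iexp (\<Sum>k<n. u k \<bullet> grid_increments m n (Z i) \<omega> k)) \<longlongrightarrow>
      (LINT \<omega>|N. iexp (\<Sum>k<n. u k \<bullet> grid_increments m n W \<omega> k))) F" for u
    unfolding eq[OF M Z_indep] eq[OF N W_indep]
    by (intro tendsto_prod char_tendsto) (auto intro: divide_right_mono)
  fix e :: real assume e: "0 < e"
  \<comment> \<open>chosen so that the tail bounds of the \<open>n\<close> increments sum up to at most \<open>e\<close>; the summand \<open>1\<close> keeps \<open>r\<close> positive\<close>
  define r where "r = sqrt (real n * (c / real m) / e) + 1"
  have r: "0 < r" using c_nonneg e by (auto simp: r_def intro!: add_nonneg_pos)
  have "real n * (c / real m) / e \<le> (sqrt (real n * (c / real m) / e))\<^sup>2"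
    using c_nonneg e by simp
  also have "\<dots> \<le> r\<^sup>2"
    using c_nonneg e unfolding r_def by (intro power_mono) auto
  finally have r_large: "real n * (c / real m) / e \<le> r\<^sup>2" .
  have r2: "real n * (c / real m / r\<^sup>2) \<le> e"
  proof -
    from r_large have "real n * (c / real m) \<le> r\<^sup>2 * e" using e by (simp only: pos_divide_le_eq)
    then have "real n * (c / real m) / r\<^sup>2 \<le> e" using r by (intro mult_imp_div_pos_le) (simp_all add: mult.commute)
    then show ?thesis by simp
  qed
  have "measure (M i) {\<omega> \<in> space (M i). \<exists>k<n. r < norm (grid_increments m n (Z i) \<omega> k)} \<le> e" for i
  proof -
    interpret prob_space "M i" by (rule M)
    have [measurable]: "(\<lambda>\<omega>. grid_increments m n (Z i) \<omega> k) \<in> borel_measurable (M i)" for k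
      using grid_increments_measurable[OF Z_meas] by (rule measurable_product_then_coordinatewise)
    have "{\<omega> \<in> space (M i). \<exists>k<n. r < norm (grid_increments m n (Z i) \<omega> k)} =
        (\<Union>k<n. {\<omega> \<in> space (M i). r < norm (grid_increments m n (Z i) \<omega> k)})" by auto
    then have "prob {\<omega> \<in> space (M i). \<exists>k<n. r < norm (grid_increments m n (Z i) \<omega> k)} \<le>
        (\<Sum>k<n. prob {\<omega> \<in> space (M i). r < norm (grid_increments m n (Z i) \<omega> k)})"
      by (simp only:) (intro finite_measure_subadditive_finite; auto)
    also have "\<dots> \<le> (\<Sum>k<n. c / real m / r\<^sup>2)"
    proof (rule sum_mono)
      fix k assume "k \<in> {..<n}"
      moreover have "?p (Suc k) - ?p k = 1 / real m" by (simp add: add_divide_distrib)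
      moreover have "?p k \<le> ?p (Suc k)" by (simp add: divide_right_mono)
      ultimately show "prob {\<omega> \<in> space (M i). r < norm (grid_increments m n (Z i) \<omega> k)} \<le> c / real m / r\<^sup>2"
        using chebyshev[of "?p k" "?p (Suc k)" r i] r by (simp add: grid_increments_def)
    qed
    also have "\<dots> \<le> e" using r2 by simp
    finally show ?thesis .
  qed
  then show "\<exists>r. \<forall>\<^sub>F i in F. measure (M i) {\<omega> \<in> space (M i). \<exists>k<n. r < norm (grid_increments m n (Z i) \<omega> k)} \<le> e"
    by (intro exI[of _ r] always_eventually allI)
qed (use M N g in \<open>auto simp: grid_increments_def\<close>)

text \<open>The continuous function \<open>g j\<close> rises from \<open>0\<close> to \<open>1\<close> as the \<open>j\<close>-th increment grows from \<open>e/2\<close> to \<open>e\<close>, so it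
separates the two families of events.\<close>
lemma sum_prob_jumps_eventually:
  assumes m: "0 < m" and e: "0 < e" and d: "0 < d"
  shows "\<forall>\<^sub>F i in F. (\<Sum>j<n. measure (M i) {\<omega> \<in> space (M i). e < norm (grid_increments m n (Z i) \<omega> j)})
    < (\<Sum>j<n. measure N {\<omega> \<in> space N. e / 2 \<le> norm (grid_increments m n W \<omega> j)}) + d"
proof -
  define g where "g j x = max 0 (min 1 (2 * norm (x j) / e - 1))" for j and x :: "nat \<Rightarrow> 'a"
  have cont: "continuous_on UNIV (g j)" for j
    unfolding g_def by (intro continuous_intros continuous_on_product_coordinates) (use e in auto)
  have gb: "\<bar>g j x\<bar> \<le> 1" for j x by (auto simp: g_def)
  have g_meas: "g j \<in> borel_measurable borel" for j
    by (rule borel_measurable_continuous_onI[OF cont])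
  have lower: "indicator {\<omega> \<in> space P. e < norm (grid_increments m n X \<omega> j)} \<omega> \<le> g j (grid_increments m n X \<omega>)"
    for P :: "'p measure" and X :: "real \<Rightarrow> 'p \<Rightarrow> 'a" and \<omega> j
    using e by (auto simp: indicator_def g_def field_simps)
  have upper: "g j (grid_increments m n X \<omega>) \<le> indicator {\<omega> \<in> space P. e / 2 \<le> norm (grid_increments m n X \<omega> j)} \<omega>"
    if "\<omega> \<in> space P" for P :: "'p measure" and X :: "real \<Rightarrow> 'p \<Rightarrow> 'a" and \<omega> j
    using e that by (auto simp: indicator_def g_def field_simps)
  have le_Z: "measure (M i) {\<omega> \<in> space (M i). e < norm (grid_increments m n (Z i) \<omega> j)}
      \<le> (LINT \<omega>|M i. g j (grid_increments m n (Z i) \<omega>))" for i j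
  proof -
    interpret prob_space "M i" by (rule M)
    have gm: "grid_increments m n (Z i) \<in> borel_measurable (M i)"
      by (rule grid_increments_measurable[OF Z_meas])
    then have [measurable]: "(\<lambda>\<omega>. grid_increments m n (Z i) \<omega> k) \<in> borel_measurable (M i)" for k
      by (rule measurable_product_then_coordinatewise)
    have A: "{\<omega> \<in> space (M i). e < norm (grid_increments m n (Z i) \<omega> j)} \<in> events" by measurable
    have "prob {\<omega> \<in> space (M i). e < norm (grid_increments m n (Z i) \<omega> j)} =
        (LINT \<omega>|M i. indicator {\<omega> \<in> space (M i). e < norm (grid_increments m n (Z i) \<omega> j)} \<omega>)"
      using A by simp
    also have "\<dots> \<le> (LINT \<omega>|M i. g j (grid_increments m n (Z i) \<omega>))"
    proof (rule integral_mono)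
      show "integrable (M i) (\<lambda>\<omega>. g j (grid_increments m n (Z i) \<omega>))"
        using measurable_compose[OF gm g_meas] gb by (intro integrable_const_bound[of _ 1]) auto
    qed (use A lower in \<open>auto simp: less_top[symmetric]\<close>)
    finally show ?thesis .
  qed
  have le_W: "(LINT \<omega>|N. g j (grid_increments m n W \<omega>)) \<le>
      measure N {\<omega> \<in> space N. e / 2 \<le> norm (grid_increments m n W \<omega> j)}" for j
  proof -
    interpret prob_space N by (rule N)
    have gm: "grid_increments m n W \<in> borel_measurable N"
      by (rule grid_increments_measurable[OF W_meas])
    then have [measurable]: "(\<lambda>\<omega>. grid_increments m n W \<omega> k) \<in> borel_measurable N" for k
      by (rule measurable_product_then_coordinatewise)
    have A: "{\<omega> \<in> space N. e / 2 \<le> norm (grid_increments m n W \<omega> j)} \<in> events" by measurable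
    have "(LINT \<omega>|N. g j (grid_increments m n W \<omega>)) \<le>
        (LINT \<omega>|N. indicator {\<omega> \<in> space N. e / 2 \<le> norm (grid_increments m n W \<omega> j)} \<omega>)"
    proof (rule integral_mono)
      show "integrable N (\<lambda>\<omega>. g j (grid_increments m n W \<omega>))"
        using measurable_compose[OF gm g_meas] gb by (intro integrable_const_bound[of _ 1]) auto
    qed (use A upper in \<open>auto simp: less_top[symmetric]\<close>)
    also have "\<dots> = prob {\<omega> \<in> space N. e / 2 \<le> norm (grid_increments m n W \<omega> j)}"
      using A by simp
    finally show ?thesis .
  qed
  have "((\<lambda>i. \<Sum>j<n. LINT \<omega>|M i. g j (grid_increments m n (Z i) \<omega>)) \<longlongrightarrow>
      (\<Sum>j<n. LINT \<omega>|N. g j (grid_increments m n W \<omega>))) F"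
    by (intro tendsto_sum grid_increments_weak_convergence[OF m cont gb])
  moreover have "(\<Sum>j<n. LINT \<omega>|N. g j (grid_increments m n W \<omega>)) <
      (\<Sum>j<n. measure N {\<omega> \<in> space N. e / 2 \<le> norm (grid_increments m n W \<omega> j)}) + d"
    using sum_mono[of "{..<n}" "\<lambda>j. LINT \<omega>|N. g j (grid_increments m n W \<omega>)", OF le_W] d
    by (intro le_less_trans[OF _ less_add_same_cancel1[THEN iffD2, OF d]])
  ultimately have "\<forall>\<^sub>F i in F. (\<Sum>j<n. LINT \<omega>|M i. g j (grid_increments m n (Z i) \<omega>)) <
      (\<Sum>j<n. measure N {\<omega> \<in> space N. e / 2 \<le> norm (grid_increments m n W \<omega> j)}) + d"
    by (rule order_tendstoD(2))
  then show ?thesis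
  proof eventually_elim
    case (elim i)
    have "(\<Sum>j<n. measure (M i) {\<omega> \<in> space (M i). e < norm (grid_increments m n (Z i) \<omega> j)})
        \<le> (\<Sum>j<n. LINT \<omega>|M i. g j (grid_increments m n (Z i) \<omega>))"
      by (rule sum_mono) (rule le_Z)
    with elim show ?case by simp
  qed
qed

text \<open>The parameters are chosen in the order \<open>k\<close>, \<open>d\<close>, \<open>m\<close>, and then the index \<open>i\<close> is sent along the filter.
The losses are \<open>e/4\<close> from the envelope, \<open>e/4\<close> from the step paths of the limit, \<open>e/8\<close> from the convergence of
the increments, and \<open>6 k d \<le> 3 e/8\<close> from the oscillation.\<close>
lemma expectation_eventually_ge:
  assumes cont: "continuous_map skorokhod_topology euclideanreal \<phi>"
    and bound: "\<And>y. y \<in> skorokhod_paths \<Longrightarrow> \<bar>\<phi> y\<bar> \<le> B"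
    and \<phi>: "\<phi> \<in> borel_measurable skorokhod_algebra" and e: "0 < e"
  shows "\<forall>\<^sub>F i in F. (LINT \<omega>|N. \<phi> (\<lambda>t\<in>{0..}. W t \<omega>)) - e < (LINT \<omega>|M i. \<phi> (\<lambda>t\<in>{0..}. Z i t \<omega>))"
proof -
  interpret N: prob_space N by (rule N)
  let ?x = "\<lambda>\<omega>. \<lambda>t\<in>{0..}. W t \<omega>"
  let ?s = "\<lambda>m k X \<omega>. step_path m (m * k) (grid_increments m (m * k) X \<omega>)"
  have path: "?x \<omega> \<in> skorokhod_paths" if "\<omega> \<in> space N" for \<omega>
    by (rule restrict_in_skorokhod_paths[OF cadlag_continuous[OF W_cont[OF that]]])
  note env = N.expectation_step_path_tendsto[where W = W and \<phi> = \<phi> and B = B, OF W_meas W_zero W_cont bound]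
  have \<phi>W: "(\<lambda>\<omega>. \<phi> (?x \<omega>)) \<in> borel_measurable N"
    using measurable_path[OF W_meas cadlag_continuous[OF W_cont]] \<phi> by (rule measurable_compose)
  have "(\<lambda>k. N.expectation (\<lambda>\<omega>. lower_envelope \<phi> k (?x \<omega>))) \<longlonglongrightarrow> N.expectation (\<lambda>\<omega>. \<phi> (?x \<omega>))"
  proof (rule integral_dominated_convergence[where w = "\<lambda>_. B"])
    show "AE \<omega> in N. (\<lambda>k. lower_envelope \<phi> k (?x \<omega>)) \<longlonglongrightarrow> \<phi> (?x \<omega>)"
      using lower_envelope_tendsto[of \<phi> B, OF bound cont path] by (rule AE_I2)
    show "AE \<omega> in N. norm (lower_envelope \<phi> k (?x \<omega>)) \<le> B" for k
      using lower_envelope_abs_le[of \<phi> B, OF bound path] by (intro AE_I2) (simp only: real_norm_def)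
  qed (use env(1) \<phi>W in auto)
  then have "\<forall>\<^sub>F k in sequentially. N.expectation (\<lambda>\<omega>. \<phi> (?x \<omega>)) - e / 4 < N.expectation (\<lambda>\<omega>. lower_envelope \<phi> k (?x \<omega>))"
    using e by (intro order_tendstoD(1)) auto
  then obtain k where k: "N.expectation (\<lambda>\<omega>. \<phi> (?x \<omega>)) - e / 4 < N.expectation (\<lambda>\<omega>. lower_envelope \<phi> k (?x \<omega>))"
    by (auto simp: eventually_sequentially)
  define d where "d = e / (16 * (real k + 1))"
  have d: "0 < d" and kd: "real k * d \<le> e / 16"
    using e by (auto simp: d_def field_simps)
  have "\<forall>\<^sub>F m in sequentially. N.expectation (\<lambda>\<omega>. lower_envelope \<phi> k (?x \<omega>)) - e / 4 <
      N.expectation (\<lambda>\<omega>. lower_envelope \<phi> k (?s m k W \<omega>))"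
    using e by (intro order_tendstoD(1)[OF env(2)]) auto
  moreover have "\<forall>\<^sub>F m in sequentially.
      (\<Sum>j<m * k. N.prob {\<omega> \<in> space N. d / 2 \<le> norm (grid_increments m (m * k) W \<omega> j)}) < d"
    using d by (intro order_tendstoD(2)[OF N.sum_prob_jumps_tendsto_0[OF W_meas W_cont W_indep]]) auto
  moreover have "\<forall>\<^sub>F m in sequentially. c / d\<^sup>2 * (1 / real m) < 1 / 2"
    using tendsto_mult[OF tendsto_const[of "c / d\<^sup>2"] lim_1_over_n] by (intro order_tendstoD(2)) auto
  ultimately have "\<forall>\<^sub>F m in sequentially. 0 < m \<and>
      N.expectation (\<lambda>\<omega>. lower_envelope \<phi> k (?x \<omega>)) - e / 4 < N.expectation (\<lambda>\<omega>. lower_envelope \<phi> k (?s m k W \<omega>)) \<and>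
      (\<Sum>j<m * k. N.prob {\<omega> \<in> space N. d / 2 \<le> norm (grid_increments m (m * k) W \<omega> j)}) < d \<and>
      c / d\<^sup>2 * (1 / real m) < 1 / 2"
    using eventually_gt_at_top[of 0] by eventually_elim blast
  then obtain m where m: "0 < m"
      "N.expectation (\<lambda>\<omega>. lower_envelope \<phi> k (?x \<omega>)) - e / 4 < N.expectation (\<lambda>\<omega>. lower_envelope \<phi> k (?s m k W \<omega>))"
      "(\<Sum>j<m * k. N.prob {\<omega> \<in> space N. d / 2 \<le> norm (grid_increments m (m * k) W \<omega> j)}) < d"
      "c / d\<^sup>2 * (1 / real m) < 1 / 2"
    by (auto simp: eventually_sequentially)
  have env_bound: "\<bar>lower_envelope \<phi> k (step_path m (m * k) x)\<bar> \<le> B" for x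
    by (rule lower_envelope_abs_le[of \<phi> B, OF bound step_path_in_skorokhod_paths[OF m(1)]])
  have "((\<lambda>i. LINT \<omega>|M i. lower_envelope \<phi> k (?s m k (Z i) \<omega>)) \<longlongrightarrow>
      N.expectation (\<lambda>\<omega>. lower_envelope \<phi> k (?s m k W \<omega>))) F"
    by (rule grid_increments_weak_convergence[OF m(1) continuous_lower_envelope_step_path[OF bound m(1)] env_bound])
  then have "\<forall>\<^sub>F i in F. N.expectation (\<lambda>\<omega>. lower_envelope \<phi> k (?s m k W \<omega>)) - e / 8 <
      (LINT \<omega>|M i. lower_envelope \<phi> k (?s m k (Z i) \<omega>))"
    using e by (intro order_tendstoD(1)) auto
  then show ?thesis
    using sum_prob_jumps_eventually[OF m(1) d d, of "m * k"]
  proof eventually_elim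
    case (elim i)
    interpret prob_space "M i" by (rule M)
    let ?S = "\<Sum>j<m * k. prob {\<omega> \<in> space (M i). d < norm (grid_increments m (m * k) (Z i) \<omega> j)}"
    have S: "?S \<le> 2 * d" using elim(2) m(3) by linarith
    have "expectation (\<lambda>\<omega>. lower_envelope \<phi> k (?s m k (Z i) \<omega>)) - real k * (2 * d + 2 * ?S)
        \<le> expectation (\<lambda>\<omega>. \<phi> (\<lambda>t\<in>{0..}. Z i t \<omega>))"
    proof (rule expectation_lower_bound[OF Z_meas Z_cadlag Z_zero Z_indep m(1) _ _ bound \<phi>])
      fix s t :: real assume st: "0 \<le> s" "s \<le> t" "t \<le> s + 1 / real m"
      have "prob {\<omega> \<in> space (M i). d < norm (Z i t \<omega> - Z i s \<omega>)} \<le> c * (t - s) / d\<^sup>2"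
        by (rule chebyshev[OF st(1,2) d])
      also have "\<dots> = c / d\<^sup>2 * (t - s)" by simp
      also have "\<dots> \<le> c / d\<^sup>2 * (1 / real m)"
        using st c_nonneg by (intro mult_left_mono) auto
      finally show "prob {\<omega> \<in> space (M i). d < norm (Z i t \<omega> - Z i s \<omega>)} \<le> 1 / 2"
        using m(4) by linarith
    qed (use d in auto)
    moreover have "real k * (2 * d + 2 * ?S) \<le> real k * (6 * d)"
      using S by (intro mult_left_mono) auto
    ultimately show ?case
      using elim(1) m(2) k kd e by linarith
  qed
qed

lemma expectation_tendsto:
  assumes cont: "continuous_map skorokhod_topology euclideanreal \<phi>"
    and bound: "\<And>y. y \<in> skorokhod_paths \<Longrightarrow> \<bar>\<phi> y\<bar> \<le> B"
    and \<phi>: "\<phi> \<in> borel_measurable skorokhod_algebra"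
  shows "((\<lambda>i. LINT \<omega>|M i. \<phi> (\<lambda>t\<in>{0..}. Z i t \<omega>)) \<longlongrightarrow> (LINT \<omega>|N. \<phi> (\<lambda>t\<in>{0..}. W t \<omega>))) F"
proof (rule tendstoI)
  fix e :: real assume e: "0 < e"
  have "continuous_map skorokhod_topology euclideanreal (\<lambda>x. - \<phi> x)"
    using cont by (rule continuous_map_minus)
  from expectation_eventually_ge[OF this, of B e] bound \<phi> e
  have "\<forall>\<^sub>F i in F. (LINT \<omega>|M i. \<phi> (\<lambda>t\<in>{0..}. Z i t \<omega>)) < (LINT \<omega>|N. \<phi> (\<lambda>t\<in>{0..}. W t \<omega>)) + e"
    by (auto elim!: eventually_mono)
  moreover have "\<forall>\<^sub>F i in F. (LINT \<omega>|N. \<phi> (\<lambda>t\<in>{0..}. W t \<omega>)) - e < (LINT \<omega>|M i. \<phi> (\<lambda>t\<in>{0..}. Z i t \<omega>))"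
    by (rule expectation_eventually_ge[OF cont bound \<phi> e])
  ultimately show "\<forall>\<^sub>F i in F. dist (LINT \<omega>|M i. \<phi> (\<lambda>t\<in>{0..}. Z i t \<omega>)) (LINT \<omega>|N. \<phi> (\<lambda>t\<in>{0..}. W t \<omega>)) < e"
    by eventually_elim (simp add: dist_real_def abs_less_iff)
qed

end

section \<open>Tail bounds from characteristic functions, and processes started at 0 almost surely\<close>

lemma iexp_quadratic_error: "cmod (1 - iexp v + \<i> * complex_of_real v) \<le> v\<^sup>2 / 2"
proof -
  have "cmod (iexp v - (\<Sum>k\<le>1. (\<i> * complex_of_real v) ^ k / fact k)) \<le> \<bar>v\<bar> ^ Suc 1 / fact (Suc 1)"
    by (rule iexp_approx1)
  moreover have "(\<Sum>k\<le>1. (\<i> * complex_of_real v) ^ k / fact k) = 1 + \<i> * complex_of_real v"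
    by simp
  moreover have "cmod (iexp v - (1 + \<i> * complex_of_real v)) = cmod (1 - iexp v + \<i> * complex_of_real v)"
    by (subst norm_minus_commute) (simp add: algebra_simps)
  ultimately show ?thesis by (simp add: power2_eq_square)
qed

lemma iexp_cubic_error:
  "cmod (1 - iexp v + \<i> * complex_of_real v - complex_of_real (v\<^sup>2 / 2)) \<le> \<bar>v\<bar> ^ 3 / 6"
proof -
  have "cmod (iexp v - (\<Sum>k\<le>2. (\<i> * complex_of_real v) ^ k / fact k)) \<le> \<bar>v\<bar> ^ Suc 2 / fact (Suc 2)"
    by (rule iexp_approx1)
  moreover have "(\<Sum>k\<le>2. (\<i> * complex_of_real v) ^ k / fact k) = 1 + \<i> * complex_of_real v - complex_of_real (v\<^sup>2 / 2)"
    by (simp add: numeral_2_eq_2 power_mult_distrib)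
  moreover have "cmod (iexp v - (1 + \<i> * complex_of_real v - complex_of_real (v\<^sup>2 / 2))) =
      cmod (1 - iexp v + \<i> * complex_of_real v - complex_of_real (v\<^sup>2 / 2))"
    by (subst norm_minus_commute) (simp add: algebra_simps)
  ultimately show ?thesis by (simp add: fact_numeral eval_nat_numeral)
qed

text \<open>Fatou's lemma for \<open>2 (1 - cos (\<theta> X)) / \<theta>\<^sup>2 \<rightarrow> X\<^sup>2\<close> as \<open>\<theta> \<rightarrow> 0\<close>. The factor \<open>exp (a \<theta>\<^sup>2)\<close> in the hypothesis disappears
in the limit; it leaves room for the crude estimate \<open>|exp z - 1| \<le> |z| exp |z|\<close>.\<close>
lemma (in prob_space) second_moment_from_char:
  fixes X :: "'a \<Rightarrow> real"
  assumes X[measurable]: "X \<in> borel_measurable M" and a: "0 \<le> a"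
    and char: "\<And>\<theta>. expectation (\<lambda>\<omega>. 1 - cos (\<theta> * X \<omega>)) \<le> a * \<theta>\<^sup>2 * exp (a * \<theta>\<^sup>2)"
  shows "(\<integral>\<^sup>+\<omega>. ennreal ((X \<omega>)\<^sup>2) \<partial>M) \<le> ennreal (2 * a)"
proof -
  define \<theta> where "\<theta> n = inverse (real (Suc n))" for n
  have \<theta>: "0 < \<theta> n" for n by (simp add: \<theta>_def)
  have \<theta>0: "\<theta> \<longlonglongrightarrow> 0"
    unfolding \<theta>_def[abs_def] by (rule LIMSEQ_inverse_real_of_nat)
  define u where "u n \<omega> = 2 * (1 - cos (\<theta> n * X \<omega>)) / (\<theta> n)\<^sup>2" for n \<omega>
  have [measurable]: "u n \<in> borel_measurable M" for n
    unfolding u_def by measurable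
  have lim: "(\<lambda>n. u n \<omega>) \<longlonglongrightarrow> (X \<omega>)\<^sup>2" for \<omega>
  proof -
    have err: "norm (u n \<omega> - (X \<omega>)\<^sup>2) \<le> \<theta> n * (\<bar>X \<omega>\<bar> ^ 3 / 3)" for n
    proof -
      let ?v = "\<theta> n * X \<omega>"
      have "\<bar>Re (1 - iexp ?v + \<i> * complex_of_real ?v - complex_of_real (?v\<^sup>2 / 2))\<bar> \<le> \<bar>?v\<bar> ^ 3 / 6"
        by (rule order_trans[OF abs_Re_le_cmod iexp_cubic_error])
      then have *: "\<bar>1 - cos ?v - ?v\<^sup>2 / 2\<bar> \<le> \<bar>?v\<bar> ^ 3 / 6"
        by (simp add: Re_exp)
      have "u n \<omega> - (X \<omega>)\<^sup>2 = 2 / (\<theta> n)\<^sup>2 * (1 - cos ?v - ?v\<^sup>2 / 2)"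
        using \<theta>[of n] by (simp add: u_def field_simps power2_eq_square)
      then have "norm (u n \<omega> - (X \<omega>)\<^sup>2) = 2 / (\<theta> n)\<^sup>2 * \<bar>1 - cos ?v - ?v\<^sup>2 / 2\<bar>"
        by (simp only: real_norm_def abs_mult) simp
      also have "\<dots> \<le> 2 / (\<theta> n)\<^sup>2 * (\<bar>?v\<bar> ^ 3 / 6)"
        using * by (intro mult_left_mono) auto
      also have "\<dots> = \<theta> n * (\<bar>X \<omega>\<bar> ^ 3 / 3)"
        using \<theta>[of n] by (simp add: abs_mult power_mult_distrib power3_eq_cube power2_eq_square)
      finally show ?thesis .
    qed
    have "(\<lambda>n. \<theta> n * (\<bar>X \<omega>\<bar> ^ 3 / 3)) \<longlonglongrightarrow> 0"
      by (rule tendsto_mult_left_zero[OF \<theta>0])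
    then have "(\<lambda>n. u n \<omega> - (X \<omega>)\<^sup>2) \<longlonglongrightarrow> 0"
      by (rule Lim_null_comparison[OF always_eventually[OF allI[OF err]]])
    then show ?thesis by (simp add: LIM_zero_iff)
  qed
  have int: "integrable M (\<lambda>\<omega>. 1 - cos (\<theta> n * X \<omega>))" for n
    by (intro Bochner_Integration.integrable_diff integrable_const integrable_const_bound[of _ 1]) auto
  have Eu: "(\<integral>\<^sup>+\<omega>. ennreal (u n \<omega>) \<partial>M) \<le> ennreal (2 * a * exp (a * (\<theta> n)\<^sup>2))" for n
  proof -
    have "(\<integral>\<^sup>+\<omega>. ennreal (u n \<omega>) \<partial>M) = ennreal (expectation (u n))"
    proof (rule nn_integral_eq_integral)
      have "integrable M (\<lambda>\<omega>. 2 / (\<theta> n)\<^sup>2 * (1 - cos (\<theta> n * X \<omega>)))"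
        using int by (rule integrable_mult_right)
      then show "integrable M (u n)" by (simp add: u_def[abs_def])
    qed (auto simp: u_def)
    also have "expectation (u n) = 2 / (\<theta> n)\<^sup>2 * expectation (\<lambda>\<omega>. 1 - cos (\<theta> n * X \<omega>))"
      unfolding u_def[abs_def] by (subst integral_mult_right_zero[symmetric]) simp
    also have "\<dots> \<le> 2 / (\<theta> n)\<^sup>2 * (a * (\<theta> n)\<^sup>2 * exp (a * (\<theta> n)\<^sup>2))"
      by (intro mult_left_mono char) auto
    also have "\<dots> = 2 * a * exp (a * (\<theta> n)\<^sup>2)"
      using \<theta>[of n] by simp
    finally show ?thesis by (simp add: ennreal_leI)
  qed
  have "(\<lambda>n. 2 * a * exp (a * (\<theta> n)\<^sup>2)) \<longlonglongrightarrow> 2 * a * exp (a * 0\<^sup>2)"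
    by (intro tendsto_intros \<theta>0)
  then have lim2: "(\<lambda>n. ennreal (2 * a * exp (a * (\<theta> n)\<^sup>2))) \<longlonglongrightarrow> ennreal (2 * a)"
    by (intro tendsto_ennrealI) simp
  have "(\<integral>\<^sup>+\<omega>. ennreal ((X \<omega>)\<^sup>2) \<partial>M) = (\<integral>\<^sup>+\<omega>. liminf (\<lambda>n. ennreal (u n \<omega>)) \<partial>M)"
    using lim by (intro nn_integral_cong lim_imp_Liminf[symmetric] tendsto_ennrealI) auto
  also have "\<dots> \<le> liminf (\<lambda>n. \<integral>\<^sup>+\<omega>. ennreal (u n \<omega>) \<partial>M)"
    by (rule nn_integral_liminf) measurable
  also have "\<dots> \<le> liminf (\<lambda>n. ennreal (2 * a * exp (a * (\<theta> n)\<^sup>2)))"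
    by (intro Liminf_mono always_eventually allI Eu)
  also have "\<dots> = ennreal (2 * a)"
    by (intro lim_imp_Liminf lim2) auto
  finally show ?thesis .
qed

lemma (in prob_space) chebyshev_from_char:
  fixes V :: "'a \<Rightarrow> 'b::euclidean_space"
  assumes V[measurable]: "V \<in> borel_measurable M" and a: "\<And>b. b \<in> Basis \<Longrightarrow> 0 \<le> a b"
    and char: "\<And>b \<theta>. b \<in> Basis \<Longrightarrow>
      expectation (\<lambda>\<omega>. 1 - cos (\<theta> * (b \<bullet> V \<omega>))) \<le> a b * \<theta>\<^sup>2 * exp (a b * \<theta>\<^sup>2)"
    and r: "0 < r"
  shows "prob {\<omega> \<in> space M. r < norm (V \<omega>)} \<le> (\<Sum>b\<in>Basis. 2 * a b) / r\<^sup>2"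
proof -
  let ?E = "{\<omega> \<in> space M. r < norm (V \<omega>)}"
  have E: "?E \<in> events" by measurable
  have sum0: "0 \<le> (\<Sum>b\<in>Basis. 2 * a b)" using a by (intro sum_nonneg) auto
  have "ennreal (r\<^sup>2) * emeasure M ?E = (\<integral>\<^sup>+\<omega>. ennreal (r\<^sup>2) * indicator ?E \<omega> \<partial>M)"
    using E by (simp add: nn_integral_cmult_indicator)
  also have "\<dots> \<le> (\<integral>\<^sup>+\<omega>. (\<Sum>b\<in>Basis. ennreal ((b \<bullet> V \<omega>)\<^sup>2)) \<partial>M)"
  proof (rule nn_integral_mono)
    fix \<omega>
    have "(norm (V \<omega>))\<^sup>2 = (\<Sum>b\<in>Basis. (b \<bullet> V \<omega>)\<^sup>2)"
      unfolding power2_norm_eq_inner by (subst euclidean_inner) (simp add: power2_eq_square inner_commute)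
    then have eq: "(\<Sum>b\<in>Basis. ennreal ((b \<bullet> V \<omega>)\<^sup>2)) = ennreal ((norm (V \<omega>))\<^sup>2)"
      by (simp add: sum_ennreal)
    have "r\<^sup>2 \<le> (norm (V \<omega>))\<^sup>2" if "r < norm (V \<omega>)"
      using that r by (intro power_mono) auto
    then show "ennreal (r\<^sup>2) * indicator ?E \<omega> \<le> (\<Sum>b\<in>Basis. ennreal ((b \<bullet> V \<omega>)\<^sup>2))"
      unfolding eq by (auto simp: indicator_def intro: ennreal_leI)
  qed
  also have "\<dots> = (\<Sum>b\<in>Basis. \<integral>\<^sup>+\<omega>. ennreal ((b \<bullet> V \<omega>)\<^sup>2) \<partial>M)"
    by (intro nn_integral_sum) measurable
  also have "\<dots> \<le> (\<Sum>b\<in>Basis. ennreal (2 * a b))"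
    by (intro sum_mono second_moment_from_char a char) measurable
  also have "\<dots> = ennreal (\<Sum>b\<in>Basis. 2 * a b)"
    using a by (simp add: sum_ennreal)
  finally have "ennreal (r\<^sup>2 * prob ?E) \<le> ennreal (\<Sum>b\<in>Basis. 2 * a b)"
    by (simp add: emeasure_eq_measure ennreal_mult)
  then have "r\<^sup>2 * prob ?E \<le> (\<Sum>b\<in>Basis. 2 * a b)"
    using sum0 by (simp add: ennreal_le_iff)
  then show ?thesis
    using r by (simp add: pos_le_divide_eq mult.commute)
qed

lemma cadlag_diff_const:
  fixes x :: "real \<Rightarrow> 'a::real_normed_vector"
  assumes "cadlag x"
  shows "cadlag (\<lambda>t. x t - c)"
  unfolding cadlag_def
proof (intro conjI allI impI)
  fix t :: real assume "0 \<le> t"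
  with assms have "(x \<longlongrightarrow> x t) (at_right t)" by (simp add: cadlag_def)
  then show "((\<lambda>t. x t - c) \<longlongrightarrow> x t - c) (at_right t)" by (intro tendsto_intros)
next
  fix t :: real assume "0 < t"
  with assms obtain l where "(x \<longlongrightarrow> l) (at_left t)" by (auto simp: cadlag_def)
  then have "((\<lambda>t. x t - c) \<longlongrightarrow> l - c) (at_left t)" by (intro tendsto_intros)
  then show "\<exists>l. ((\<lambda>t. x t - c) \<longlongrightarrow> l) (at_left t)" by blast
qed

lemma path_law_integral_started_at_0:
  fixes X :: "real \<Rightarrow> 'w \<Rightarrow> 'a::euclidean_space" and \<phi> :: "(real \<Rightarrow> 'a) \<Rightarrow> real"
  assumes X[measurable]: "\<And>t. 0 \<le> t \<Longrightarrow> X t \<in> borel_measurable M"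
    and cadlag: "\<And>\<omega>. \<omega> \<in> space M \<Longrightarrow> cadlag (\<lambda>t. X t \<omega>)"
    and zero: "AE \<omega> in M. X 0 \<omega> = 0"
    and \<phi>: "\<phi> \<in> borel_measurable skorokhod_algebra"
  shows "integral\<^sup>L (path_law M X) \<phi> = (LINT \<omega>|M. \<phi> (\<lambda>t\<in>{0..}. X t \<omega> - X 0 \<omega>))"
proof -
  have m1: "(\<lambda>\<omega>. \<lambda>t\<in>{0..}. X t \<omega>) \<in> measurable M skorokhod_algebra"
    by (rule measurable_path[OF X cadlag])
  have m2: "(\<lambda>\<omega>. \<lambda>t\<in>{0..}. X t \<omega> - X 0 \<omega>) \<in> measurable M skorokhod_algebra"
  proof (rule measurable_path[where X = "\<lambda>t \<omega>. X t \<omega> - X 0 \<omega>"])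
    fix \<omega> assume "\<omega> \<in> space M"
    from cadlag[OF this] show "cadlag (\<lambda>t. X t \<omega> - X 0 \<omega>)"
      by (rule cadlag_diff_const)
  qed measurable
  have "integral\<^sup>L (path_law M X) \<phi> = (LINT \<omega>|M. \<phi> (\<lambda>t\<in>{0..}. X t \<omega>))"
    unfolding path_law_def by (rule integral_distr[OF m1 \<phi>])
  also have "\<dots> = (LINT \<omega>|M. \<phi> (\<lambda>t\<in>{0..}. X t \<omega> - X 0 \<omega>))"
  proof (rule integral_cong_AE)
    show "AE \<omega> in M. \<phi> (\<lambda>t\<in>{0..}. X t \<omega>) = \<phi> (\<lambda>t\<in>{0..}. X t \<omega> - X 0 \<omega>)"
      using zero by eventually_elim simp
  qed (use measurable_compose[OF m1 \<phi>] measurable_compose[OF m2 \<phi>] in auto)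
  finally show ?thesis .
qed

text \<open>Processes that start at \<open>0\<close> only almost surely are reduced to the situation above by subtracting their
initial value, which changes no increment and changes paths only on a null set.\<close>
theorem skorokhod_invariance_principle:
  fixes Z :: "'i \<Rightarrow> real \<Rightarrow> 'w \<Rightarrow> 'a::euclidean_space" and W :: "real \<Rightarrow> 'v \<Rightarrow> 'a"
  assumes M: "\<And>i. prob_space (M i)" and N: "prob_space N"
    and Z_meas[measurable]: "\<And>i t. 0 \<le> t \<Longrightarrow> Z i t \<in> borel_measurable (M i)"
    and W_meas[measurable]: "\<And>t. 0 \<le> t \<Longrightarrow> W t \<in> borel_measurable N"
    and Z_zero: "\<And>i. AE \<omega> in M i. Z i 0 \<omega> = 0" and W_zero: "AE \<omega> in N. W 0 \<omega> = 0"
    and Z_cadlag: "\<And>i \<omega>. \<omega> \<in> space (M i) \<Longrightarrow> cadlag (\<lambda>t. Z i t \<omega>)"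
    and W_cont: "\<And>\<omega>. \<omega> \<in> space N \<Longrightarrow> continuous_on {0..} (\<lambda>t. W t \<omega>)"
    and Z_indep: "\<And>i. independent_increments (M i) (Z i)"
    and W_indep: "independent_increments N W"
    and char_tendsto: "\<And>s t u. 0 \<le> s \<Longrightarrow> s \<le> t \<Longrightarrow>
        ((\<lambda>i. LINT \<omega>|M i. iexp (u \<bullet> (Z i t \<omega> - Z i s \<omega>))) \<longlongrightarrow> (LINT \<omega>|N. iexp (u \<bullet> (W t \<omega> - W s \<omega>)))) F"
    and chebyshev: "\<And>i s t r. 0 \<le> s \<Longrightarrow> s \<le> t \<Longrightarrow> 0 < r \<Longrightarrow>
        measure (M i) {\<omega> \<in> space (M i). r < norm (Z i t \<omega> - Z i s \<omega>)} \<le> c * (t - s) / r\<^sup>2"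
  shows "skorokhod_weak_conv (\<lambda>i. path_law (M i) (Z i)) (path_law N W) F"
proof -
  interpret centred: invariance_principle F M "\<lambda>i t \<omega>. Z i t \<omega> - Z i 0 \<omega>" N "\<lambda>t \<omega>. W t \<omega> - W 0 \<omega>" c
  proof (rule invariance_principle.intro)
    show "cadlag (\<lambda>t. Z i t \<omega> - Z i 0 \<omega>)" if "\<omega> \<in> space (M i)" for i \<omega>
      using Z_cadlag[OF that] by (rule cadlag_diff_const)
    show "continuous_on {0..} (\<lambda>t. W t \<omega> - W 0 \<omega>)" if "\<omega> \<in> space N" for \<omega>
      by (intro continuous_intros W_cont that)
    show "independent_increments (M i) (\<lambda>t \<omega>. Z i t \<omega> - Z i 0 \<omega>)" for i
      using Z_indep[of i] by (simp add: independent_increments_def)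
    show "independent_increments N (\<lambda>t \<omega>. W t \<omega> - W 0 \<omega>)"
      using W_indep by (simp add: independent_increments_def)
    show "((\<lambda>i. LINT \<omega>|M i. iexp (u \<bullet> (Z i t \<omega> - Z i 0 \<omega> - (Z i s \<omega> - Z i 0 \<omega>)))) \<longlongrightarrow>
        (LINT \<omega>|N. iexp (u \<bullet> (W t \<omega> - W 0 \<omega> - (W s \<omega> - W 0 \<omega>))))) F"
      if "0 \<le> s" "s \<le> t" for s t u
      using char_tendsto[OF that, of u] by simp
    show "measure (M i) {\<omega> \<in> space (M i). r < norm (Z i t \<omega> - Z i 0 \<omega> - (Z i s \<omega> - Z i 0 \<omega>))} \<le> c * (t - s) / r\<^sup>2"
      if "0 \<le> s" "s \<le> t" "0 < r" for i s t r
      using chebyshev[OF that, of i] by simp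
    show "(\<lambda>\<omega>. Z i t \<omega> - Z i 0 \<omega>) \<in> borel_measurable (M i)" if "0 \<le> t" for i t
      using that by measurable
    show "(\<lambda>\<omega>. W t \<omega> - W 0 \<omega>) \<in> borel_measurable N" if "0 \<le> t" for t
      using that by measurable
  qed (simp_all add: M N)
  show ?thesis
    unfolding skorokhod_weak_conv_def
  proof (intro allI impI)
    fix \<phi> :: "(real \<Rightarrow> 'a) \<Rightarrow> real"
    assume \<phi>: "continuous_map skorokhod_topology euclideanreal \<phi> \<and> bounded (\<phi> ` skorokhod_paths)"
    then obtain B where B: "\<And>y. y \<in> skorokhod_paths \<Longrightarrow> \<bar>\<phi> y\<bar> \<le> B"
      by (auto simp: bounded_iff)
    show "((\<lambda>i. integral\<^sup>L (path_law (M i) (Z i)) \<phi>) \<longlongrightarrow> integral\<^sup>L (path_law N W) \<phi>) F"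
    proof (cases "\<phi> \<in> borel_measurable skorokhod_algebra")
      case True
      have "integral\<^sup>L (path_law (M i) (Z i)) \<phi> = (LINT \<omega>|M i. \<phi> (\<lambda>t\<in>{0..}. Z i t \<omega> - Z i 0 \<omega>))" for i
        by (rule path_law_integral_started_at_0[OF Z_meas Z_cadlag Z_zero True])
      moreover have "integral\<^sup>L (path_law N W) \<phi> = (LINT \<omega>|N. \<phi> (\<lambda>t\<in>{0..}. W t \<omega> - W 0 \<omega>))"
        by (rule path_law_integral_started_at_0[OF W_meas cadlag_continuous[OF W_cont] W_zero True])
      ultimately show ?thesis
        using centred.expectation_tendsto[of \<phi> B] \<phi> B True by simp
    next
      \<comment> \<open>a non-measurable \<open>\<phi>\<close> is integrable for no path law, and all the integrals are \<open>0\<close> by convention\<close>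
      case False
      then have "\<not> integrable (path_law (M i) (Z i)) \<phi>" "\<not> integrable (path_law N W) \<phi>" for i
        by (auto simp: path_law_def dest: borel_measurable_integrable)
      then show ?thesis by (simp add: not_integrable_integral_eq)
    qed
  qed
qed

section \<open>Second moment and drift of the Lamperti stable Levy measure\<close>

text \<open>Near \<open>0\<close> one has \<open>exp r - 1 \<ge> r\<close>, so the integrand is of order \<open>r powr (1 - \<alpha>)\<close>, integrable since \<open>\<alpha> < 2\<close>. For
\<open>r > 1\<close> one has \<open>exp r - 1 \<ge> exp r / 2\<close>, so it is of order \<open>r\<^sup>2 exp (- \<gamma> r)\<close> with \<open>\<gamma> = \<alpha> + 1 - \<beta> > 0\<close>; half of the
exponential rate absorbs \<open>r\<^sup>2\<close>, and the rest is a multiple of an exponential density. The bound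
is uniform over all \<open>c \<le> \<beta>\<close>.\<close>
lemma radial_second_moment_bounded:
  assumes \<alpha>: "0 < \<alpha>" "\<alpha> < 2" and \<beta>: "\<beta> < \<alpha> + 1"
  obtains C :: real where "0 \<le> C"
    "\<And>c. c \<le> \<beta> \<Longrightarrow> (\<integral>\<^sup>+r\<in>{0<..}. ennreal (r\<^sup>2 * lamperti_density \<alpha> c r) \<partial>lborel) \<le> ennreal C"
proof -
  define \<gamma> where "\<gamma> = \<alpha> + 1 - \<beta>"
  define K where "K = exp ((\<alpha> + 1) * ln 2) * (16 / \<gamma>\<^sup>2) * (2 / \<gamma>)"
  have \<gamma>: "0 < \<gamma>" using \<beta> by (simp add: \<gamma>_def)
  have K: "0 \<le> K" using \<gamma> by (simp add: K_def)
  have near: "r\<^sup>2 * lamperti_density \<alpha> c r \<le> exp \<bar>\<beta>\<bar> * r powr (1 - \<alpha>)" if "0 < r" "r \<le> 1" "c \<le> \<beta>" for r c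
  proof -
    have "r * c \<le> \<bar>\<beta>\<bar>"
    proof -
      have "r * c \<le> r * \<bar>\<beta>\<bar>" using that by (intro mult_left_mono) auto
      also have "\<dots> \<le> 1 * \<bar>\<beta>\<bar>" using that by (intro mult_right_mono) auto
      finally show ?thesis by simp
    qed
    moreover have "r \<le> exp r - 1" using exp_ge_add_one_self[of r] by linarith
    then have "(exp r - 1) powr - (\<alpha> + 1) \<le> r powr - (\<alpha> + 1)"
      using that \<alpha> by (intro powr_mono2') auto
    ultimately have "lamperti_density \<alpha> c r \<le> exp \<bar>\<beta>\<bar> * r powr - (\<alpha> + 1)"
      unfolding lamperti_density_def by (intro mult_mono) auto
    then have "r\<^sup>2 * lamperti_density \<alpha> c r \<le> r powr 2 * (exp \<bar>\<beta>\<bar> * r powr - (\<alpha> + 1))"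
      using that by (simp add: powr_numeral mult_left_mono)
    also have "\<dots> = exp \<bar>\<beta>\<bar> * r powr (2 + - (\<alpha> + 1))"
      by (simp only: powr_add mult_ac)
    finally show ?thesis by simp
  qed
  have far: "r\<^sup>2 * lamperti_density \<alpha> c r \<le> K * exponential_density (\<gamma> / 2) r" if r: "1 < r" and c: "c \<le> \<beta>" for r c
  proof -
    have "2 \<le> exp r" using exp_ge_add_one_self[of r] r by linarith
    then have "ln (exp r / 2) \<le> ln (exp r - 1)"
      by (intro ln_mono) auto
    then have ln_ge: "r - ln 2 \<le> ln (exp r - 1)"
      by (simp add: ln_div)
    have "(exp r - 1) powr - (\<alpha> + 1) = exp (- (\<alpha> + 1) * ln (exp r - 1))"
      using r by (simp add: powr_def)
    also have "\<dots> \<le> exp (- (\<alpha> + 1) * (r - ln 2))"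
      using ln_ge \<alpha> by (simp add: mult_left_mono)
    finally have p: "(exp r - 1) powr - (\<alpha> + 1) \<le> exp (- (\<alpha> + 1) * (r - ln 2))" .
    have "exp (r * c) \<le> exp (r * \<beta>)" using r c by simp
    with p have "lamperti_density \<alpha> c r \<le> exp (r * \<beta>) * exp (- (\<alpha> + 1) * (r - ln 2))"
      unfolding lamperti_density_def by (intro mult_mono) auto
    also have "\<dots> = exp ((\<alpha> + 1) * ln 2) * exp (- \<gamma> * r)"
      by (simp add: exp_add[symmetric] \<gamma>_def algebra_simps)
    finally have dens: "lamperti_density \<alpha> c r \<le> exp ((\<alpha> + 1) * ln 2) * exp (- \<gamma> * r)" .
    have "\<gamma> * r / 4 \<le> exp (\<gamma> * r / 4)" using exp_ge_add_one_self[of "\<gamma> * r / 4"] by linarith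
    then have "(\<gamma> * r / 4)\<^sup>2 \<le> (exp (\<gamma> * r / 4))\<^sup>2" using \<gamma> r by (intro power_mono) auto
    also have "\<dots> = exp (\<gamma> * r / 2)" by (simp add: power2_eq_square exp_add[symmetric])
    finally have "r\<^sup>2 \<le> 16 / \<gamma>\<^sup>2 * exp (\<gamma> * r / 2)"
      using \<gamma> by (simp add: power_mult_distrib power_divide field_simps)
    then have "r\<^sup>2 * lamperti_density \<alpha> c r \<le>
        (16 / \<gamma>\<^sup>2 * exp (\<gamma> * r / 2)) * (exp ((\<alpha> + 1) * ln 2) * exp (- \<gamma> * r))"
      using dens \<gamma> by (intro mult_mono) (auto simp: lamperti_density_def)
    also have "\<dots> = exp ((\<alpha> + 1) * ln 2) * (16 / \<gamma>\<^sup>2) * (exp (\<gamma> * r / 2) * exp (- \<gamma> * r))"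
      by (simp only: mult_ac)
    also have "exp (\<gamma> * r / 2) * exp (- \<gamma> * r) = exp (- r * (\<gamma> / 2))"
      by (simp add: exp_add[symmetric] field_simps)
    also have "exp ((\<alpha> + 1) * ln 2) * (16 / \<gamma>\<^sup>2) * exp (- r * (\<gamma> / 2)) = K * exponential_density (\<gamma> / 2) r"
      using r \<gamma> by (simp add: K_def erlang_density_def)
    finally show ?thesis .
  qed
  have int_near: "(\<integral>\<^sup>+r. ennreal (indicator {0..1} r * r powr (1 - \<alpha>)) \<partial>lborel) = ennreal (1 / (2 - \<alpha>))"
  proof (rule nn_integral_has_integral_lborel)
    have "((\<lambda>r. r powr (1 - \<alpha>)) has_integral (1 powr ((1 - \<alpha>) + 1) / ((1 - \<alpha>) + 1))) {0..1}"
      using \<alpha> by (intro has_integral_powr_from_0) auto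
    then have "((\<lambda>r. if r \<in> {0..1} then r powr (1 - \<alpha>) else 0) has_integral (1 / (2 - \<alpha>))) UNIV"
      unfolding has_integral_restrict_UNIV by (simp add: algebra_simps)
    then show "((\<lambda>r. indicator {0..1} r * r powr (1 - \<alpha>)) has_integral (1 / (2 - \<alpha>))) UNIV"
      by (rule has_integral_eq[rotated]) (auto simp: indicator_def)
  qed auto
  have int_far: "(\<integral>\<^sup>+r. ennreal (exponential_density (\<gamma> / 2) r) \<partial>lborel) = 1"
  proof -
    interpret E: prob_space "density lborel (exponential_density (\<gamma> / 2))"
      using \<gamma> by (intro prob_space_exponential_density) simp
    show ?thesis using E.emeasure_space_1 by (simp add: emeasure_density)
  qed
  have "(\<integral>\<^sup>+r\<in>{0<..}. ennreal (r\<^sup>2 * lamperti_density \<alpha> c r) \<partial>lborel) \<le> ennreal (exp \<bar>\<beta>\<bar> * (1 / (2 - \<alpha>)) + K)"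
    if c: "c \<le> \<beta>" for c
  proof -
    have "(\<integral>\<^sup>+r\<in>{0<..}. ennreal (r\<^sup>2 * lamperti_density \<alpha> c r) \<partial>lborel) \<le>
        (\<integral>\<^sup>+r. ennreal (exp \<bar>\<beta>\<bar>) * ennreal (indicator {0..1} r * r powr (1 - \<alpha>))
          + ennreal K * ennreal (exponential_density (\<gamma> / 2) r) \<partial>lborel)"
    proof (rule nn_integral_mono)
      fix r :: real
      consider "r \<le> 0" | "0 < r" "r \<le> 1" | "1 < r" by linarith
      then show "ennreal (r\<^sup>2 * lamperti_density \<alpha> c r) * indicator {0<..} r \<le>
          ennreal (exp \<bar>\<beta>\<bar>) * ennreal (indicator {0..1} r * r powr (1 - \<alpha>))
          + ennreal K * ennreal (exponential_density (\<gamma> / 2) r)"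
      proof cases
        case 2
        then have "ennreal (r\<^sup>2 * lamperti_density \<alpha> c r) * indicator {0<..} r \<le>
            ennreal (exp \<bar>\<beta>\<bar>) * ennreal (indicator {0..1} r * r powr (1 - \<alpha>))"
          using near[OF 2 c] by (simp add: ennreal_mult[symmetric] ennreal_leI)
        then show ?thesis by (rule order_trans) simp
      next
        case 3
        then have "ennreal (r\<^sup>2 * lamperti_density \<alpha> c r) * indicator {0<..} r \<le>
            ennreal K * ennreal (exponential_density (\<gamma> / 2) r)"
          using far[OF 3 c] K \<gamma> by (simp add: ennreal_mult[symmetric] ennreal_leI erlang_density_nonneg)
        then show ?thesis by (rule order_trans) simp
      qed simp
    qed
    also have "\<dots> = ennreal (exp \<bar>\<beta>\<bar>) * ennreal (1 / (2 - \<alpha>)) + ennreal K * 1"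
      by (subst nn_integral_add; (subst nn_integral_cmult)?; simp add: int_near int_far nn_integral_cmult)
    also have "\<dots> = ennreal (exp \<bar>\<beta>\<bar> * (1 / (2 - \<alpha>)) + K)"
      using \<alpha> K by (simp add: ennreal_mult[symmetric] ennreal_plus[symmetric] del: ennreal_plus)
    finally show ?thesis .
  qed
  moreover have "0 \<le> exp \<bar>\<beta>\<bar> * (1 / (2 - \<alpha>)) + K"
    using \<alpha> K by simp
  ultimately show thesis using that by blast
qed

lemma sets_lamperti_levy_measure:
  fixes f :: "real ^ 'd \<Rightarrow> real"
  shows "sets (lamperti_levy_measure \<alpha> f \<sigma>) = sets (restrict_space borel (- {0}))"
proof -
  have "sets (lamperti_levy_measure \<alpha> f \<sigma>) = sigma_sets (- {0}) (sets (restrict_space borel (- {0})))"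
    unfolding lamperti_levy_measure_def by (rule sets_measure_of) (auto simp: sets_restrict_space)
  then show ?thesis
    using sets.sigma_sets_eq[of "restrict_space borel (- {0::real ^ 'd})"] by (simp add: space_restrict_space)
qed

lemma lamperti_measurable:
  assumes "g \<in> borel_measurable borel"
  shows "g \<in> borel_measurable (lamperti_levy_measure \<alpha> f \<sigma>)"
  using measurable_restrict_space1[OF assms, of "- {0}"]
  by (simp cong: measurable_cong_sets add: sets_lamperti_levy_measure)

lemma lamperti_density_nonneg: "0 \<le> lamperti_density \<alpha> c r"
  by (simp add: lamperti_density_def)

locale lamperti_measure =
  fixes \<alpha> :: real and f :: "real ^ 'd \<Rightarrow> real" and \<sigma> :: "(real ^ 'd) measure"
  assumes \<alpha>_pos: "0 < \<alpha>" and \<alpha>_less: "\<alpha> < 2"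
    and finite_\<sigma>: "finite_measure \<sigma>"
    and sets_\<sigma>: "sets \<sigma> = sets (restrict_space borel (sphere 0 1))"
    and f_measurable [measurable]: "f \<in> borel_measurable \<sigma>"
    and sup_f: "(SUP \<xi>\<in>sphere 0 1. ereal (f \<xi>)) < ereal (\<alpha> + 1)"
begin

abbreviation \<nu> :: "(real ^ 'd) measure" where "\<nu> \<equiv> lamperti_levy_measure \<alpha> f \<sigma>"

sublocale \<sigma>: finite_measure \<sigma> by (rule finite_\<sigma>)

sublocale \<sigma>L: pair_sigma_finite \<sigma> lborel ..

lemma space_\<sigma>: "space \<sigma> = sphere 0 1"
  using sets_eq_imp_space_eq[OF sets_\<sigma>] by (simp add: space_restrict_space)

lemma measurable_\<sigma> [measurable]: "(\<lambda>\<xi>. \<xi>) \<in> borel_measurable \<sigma>"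
  by (subst measurable_cong_sets[OF sets_\<sigma> refl]) (intro measurable_restrict_space1; simp)

definition polar_density :: "(real ^ 'd) \<times> real \<Rightarrow> real" where
  "polar_density = (\<lambda>(\<xi>, r). lamperti_density \<alpha> (f \<xi>) r * indicator {0<..} r)"

text \<open>The value for \<open>r \<le> 0\<close>, where the density vanishes, only serves to avoid the origin.\<close>
definition polar_map :: "(real ^ 'd) \<times> real \<Rightarrow> real ^ 'd" where
  "polar_map = (\<lambda>(\<xi>, r). (if 0 < r then r else 1) *\<^sub>R \<xi>)"

lemma polar_density_measurable [measurable]: "polar_density \<in> borel_measurable (\<sigma> \<Otimes>\<^sub>M lborel)"
  unfolding polar_density_def lamperti_density_def by measurable

lemma polar_density_nonneg: "0 \<le> polar_density p"
  by (auto simp: polar_density_def lamperti_density_nonneg split: prod.split)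

lemma polar_map_borel: "polar_map \<in> borel_measurable (\<sigma> \<Otimes>\<^sub>M lborel)"
  unfolding polar_map_def by measurable

lemma polar_map_measurable: "polar_map \<in> measurable (\<sigma> \<Otimes>\<^sub>M lborel) (restrict_space borel (- {0}))"
proof (rule measurable_restrict_space2[OF _ polar_map_borel])
  show "polar_map \<in> space (\<sigma> \<Otimes>\<^sub>M lborel) \<rightarrow> - {0}"
    by (auto simp: polar_map_def space_pair_measure space_\<sigma> split: if_splits)
qed

text \<open>As an image of a measure with density with respect to a product measure, \<open>\<nu>\<close> becomes accessible to the
transformation rules for Bochner integrals and to Fubini's theorem, which are needed for the
vector-valued drift.\<close>
lemma levy_measure_polar:
  "\<nu> = distr (density (\<sigma> \<Otimes>\<^sub>M lborel) (\<lambda>p. ennreal (polar_density p))) (restrict_space borel (- {0})) polar_map"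
    (is "_ = distr ?D ?R _")
proof (rule measure_eqI)
  show "sets \<nu> = sets (distr ?D ?R polar_map)"
    by (simp add: sets_lamperti_levy_measure)
  fix B assume "B \<in> sets \<nu>"
  then have B_R: "B \<in> sets ?R" by (simp add: sets_lamperti_levy_measure)
  then have B: "B \<in> sets borel" "0 \<notin> B"
    by (auto simp: sets_restrict_space_iff)
  note [measurable] = polar_map_borel B(1)
  have "emeasure (distr ?D ?R polar_map) B = emeasure ?D (polar_map -` B \<inter> space (\<sigma> \<Otimes>\<^sub>M lborel))"
    using polar_map_measurable B_R by (subst emeasure_distr) auto
  also have "\<dots> = (\<integral>\<^sup>+p. ennreal (polar_density p) * indicator (polar_map -` B \<inter> space (\<sigma> \<Otimes>\<^sub>M lborel)) p \<partial>(\<sigma> \<Otimes>\<^sub>M lborel))"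
    by (rule emeasure_density) measurable
  also have "\<dots> = (\<integral>\<^sup>+p. ennreal (polar_density p) * indicator B (polar_map p) \<partial>(\<sigma> \<Otimes>\<^sub>M lborel))"
    by (intro nn_integral_cong) (auto simp: indicator_def)
  also have "\<dots> = (\<integral>\<^sup>+\<xi>. (\<integral>\<^sup>+r. ennreal (polar_density (\<xi>, r)) * indicator B (polar_map (\<xi>, r)) \<partial>lborel) \<partial>\<sigma>)"
    by (rule lborel.nn_integral_fst[symmetric]) measurable
  also have "\<dots> = (\<integral>\<^sup>+\<xi>. (\<integral>\<^sup>+r\<in>{0<..}. indicator B (r *\<^sub>R \<xi>) * ennreal (lamperti_density \<alpha> (f \<xi>) r) \<partial>lborel) \<partial>\<sigma>)"
    by (intro nn_integral_cong) (auto simp: indicator_def polar_density_def polar_map_def)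
  also have "\<dots> = emeasure \<nu> B"
    by (rule emeasure_lamperti_levy_measure[OF sets_\<sigma> f_measurable B, symmetric])
  finally show "emeasure \<nu> B = emeasure (distr ?D ?R polar_map) B" by simp
qed

lemma radial_second_moment_finite:
  obtains C :: real where "0 \<le> C"
    "\<And>\<xi>. \<xi> \<in> sphere 0 1 \<Longrightarrow> (\<integral>\<^sup>+r\<in>{0<..}. ennreal (r\<^sup>2 * lamperti_density \<alpha> (f \<xi>) r) \<partial>lborel) \<le> ennreal C"
proof -
  obtain \<beta> where \<beta>: "(SUP \<xi>\<in>sphere 0 1. ereal (f \<xi>)) < ereal \<beta>" "ereal \<beta> < ereal (\<alpha> + 1)"
    using ereal_dense2[OF sup_f] by blast
  have le: "f \<xi> \<le> \<beta>" if "\<xi> \<in> sphere 0 1" for \<xi>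
    using SUP_upper[OF that, of "\<lambda>\<xi>. ereal (f \<xi>)"] \<beta>(1) by (meson ereal_less_eq(3) less_imp_le order_trans)
  obtain C where "0 \<le> C"
      "\<And>c. c \<le> \<beta> \<Longrightarrow> (\<integral>\<^sup>+r\<in>{0<..}. ennreal (r\<^sup>2 * lamperti_density \<alpha> c r) \<partial>lborel) \<le> ennreal C"
    using radial_second_moment_bounded[OF \<alpha>_pos \<alpha>_less, of \<beta>] \<beta>(2) by auto
  with le show thesis using that by blast
qed

lemma integrable_norm_squared: "integrable \<nu> (\<lambda>x. (norm x)\<^sup>2)"
proof (rule integrableI_bounded)
  note [measurable] = polar_map_borel
  show "(\<lambda>x. (norm x)\<^sup>2) \<in> borel_measurable \<nu>"
    by (rule lamperti_measurable) measurable
  obtain C where C: "0 \<le> C"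
    "\<And>\<xi>. \<xi> \<in> sphere 0 1 \<Longrightarrow> (\<integral>\<^sup>+r\<in>{0<..}. ennreal (r\<^sup>2 * lamperti_density \<alpha> (f \<xi>) r) \<partial>lborel) \<le> ennreal C"
    using radial_second_moment_finite by blast
  have "(\<integral>\<^sup>+x. ennreal (norm ((norm x)\<^sup>2)) \<partial>\<nu>) =
      (\<integral>\<^sup>+p. ennreal ((norm (polar_map p))\<^sup>2) \<partial>(density (\<sigma> \<Otimes>\<^sub>M lborel) (\<lambda>p. ennreal (polar_density p))))"
    unfolding levy_measure_polar using polar_map_measurable
    by (subst nn_integral_distr) (auto intro!: measurable_restrict_space1)
  also have "\<dots> = (\<integral>\<^sup>+p. ennreal (polar_density p) * ennreal ((norm (polar_map p))\<^sup>2) \<partial>(\<sigma> \<Otimes>\<^sub>M lborel))"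
    by (rule nn_integral_density) measurable
  also have "\<dots> = (\<integral>\<^sup>+\<xi>. (\<integral>\<^sup>+r. ennreal (polar_density (\<xi>, r)) * ennreal ((norm (polar_map (\<xi>, r)))\<^sup>2) \<partial>lborel) \<partial>\<sigma>)"
    by (rule lborel.nn_integral_fst[symmetric]) measurable
  also have "\<dots> \<le> (\<integral>\<^sup>+\<xi>. ennreal C \<partial>\<sigma>)"
  proof (rule nn_integral_mono)
    fix \<xi> assume "\<xi> \<in> space \<sigma>"
    then have \<xi>: "\<xi> \<in> sphere 0 1" by (simp add: space_\<sigma>)
    have "(\<integral>\<^sup>+r. ennreal (polar_density (\<xi>, r)) * ennreal ((norm (polar_map (\<xi>, r)))\<^sup>2) \<partial>lborel) =
        (\<integral>\<^sup>+r\<in>{0<..}. ennreal (r\<^sup>2 * lamperti_density \<alpha> (f \<xi>) r) \<partial>lborel)"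
      using \<xi> by (intro nn_integral_cong)
        (auto simp: polar_density_def polar_map_def indicator_def ennreal_mult[symmetric] lamperti_density_nonneg mult.commute)
    with C(2)[OF \<xi>] show "(\<integral>\<^sup>+r. ennreal (polar_density (\<xi>, r)) * ennreal ((norm (polar_map (\<xi>, r)))\<^sup>2) \<partial>lborel) \<le> ennreal C"
      by simp
  qed
  also have "\<dots> < \<infinity>"
    by (simp add: less_top[symmetric] ennreal_mult_eq_top_iff)
  finally show "(\<integral>\<^sup>+x. ennreal (norm ((norm x)\<^sup>2)) \<partial>\<nu>) < \<infinity>" .
qed

lemma integrable_quadratic_bound:
  fixes g :: "real ^ 'd \<Rightarrow> 'b::{banach, second_countable_topology}"
  assumes "g \<in> borel_measurable borel" and "\<And>x. norm (g x) \<le> c * (norm x)\<^sup>2"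
  shows "integrable \<nu> g"
proof (rule Bochner_Integration.integrable_bound)
  show "integrable \<nu> (\<lambda>x. c * (norm x)\<^sup>2)"
    by (intro integrable_mult_right integrable_norm_squared)
  show "AE x in \<nu>. norm (g x) \<le> norm (c * (norm x)\<^sup>2)"
    using assms(2) by (intro AE_I2) (metis abs_ge_self order_trans real_norm_def)
qed (rule lamperti_measurable[OF assms(1)])

lemma big_jumps_bound: "norm (indicator {x. 1 \<le> norm x} x *\<^sub>R x) \<le> 1 * (norm x)\<^sup>2" for x :: "real ^ 'd"
proof (cases "1 \<le> norm x")
  case True
  then have "1 * norm x \<le> norm x * norm x" by (intro mult_right_mono) auto
  with True show ?thesis by (simp add: power2_eq_square)
qed simp

lemma integrable_big_jumps: "integrable \<nu> (\<lambda>x. indicator {x. 1 \<le> norm x} x *\<^sub>R x)"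
  by (rule integrable_quadratic_bound[OF _ big_jumps_bound]) measurable

text \<open>Since \<open>\<sigma>\<close> lives on the unit sphere, \<open>|r \<xi>| \<ge> 1\<close> means \<open>r \<ge> 1\<close> for \<open>r > 0\<close>. So the iterated integral that defines the
centring vector is the integral of \<open>x\<close> over the jumps that the compensator in the exponent
leaves out.\<close>
lemma integral_big_jumps: "(LINT x|\<nu>. indicator {x. 1 \<le> norm x} x *\<^sub>R x) = lamperti_drift \<alpha> f \<sigma>"
proof -
  let ?g = "\<lambda>x :: real ^ 'd. indicat_real {x. 1 \<le> norm x} x *\<^sub>R x"
  let ?D = "density (\<sigma> \<Otimes>\<^sub>M lborel) (\<lambda>p. ennreal (polar_density p))"
  note [measurable] = polar_map_borel
  have g[measurable]: "?g \<in> borel_measurable borel" by measurable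
  have g': "?g \<in> borel_measurable (restrict_space borel (- {0}))"
    by (rule measurable_restrict_space1[OF g])
  have pm: "polar_map \<in> measurable ?D (restrict_space borel (- {0}))"
    using polar_map_measurable by simp
  have gp: "(\<lambda>p. ?g (polar_map p)) \<in> borel_measurable (\<sigma> \<Otimes>\<^sub>M lborel)"
    by measurable
  have int: "integrable (\<sigma> \<Otimes>\<^sub>M lborel) (\<lambda>p. polar_density p *\<^sub>R ?g (polar_map p))"
    using integrable_big_jumps unfolding levy_measure_polar integrable_distr_eq[OF pm g']
    by (subst (asm) integrable_density[OF gp]) (auto simp: polar_density_nonneg)
  have "(LINT x|\<nu>. ?g x) = (LINT p|?D. ?g (polar_map p))"
    unfolding levy_measure_polar by (rule integral_distr[OF pm g'])
  also have "\<dots> = (LINT p|(\<sigma> \<Otimes>\<^sub>M lborel). polar_density p *\<^sub>R ?g (polar_map p))"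
    by (rule integral_density[OF gp]) (auto simp: polar_density_nonneg)
  also have "\<dots> = (LINT \<xi>|\<sigma>. (LINT r|lborel. polar_density (\<xi>, r) *\<^sub>R ?g (polar_map (\<xi>, r))))"
    by (rule \<sigma>L.integral_fst'[OF int, symmetric])
  also have "\<dots> = (LINT \<xi>|\<sigma>. (LINT r:{1..}|lborel. r * lamperti_density \<alpha> (f \<xi>) r) *\<^sub>R \<xi>)"
  proof (rule Bochner_Integration.integral_cong[OF refl])
    fix \<xi> assume "\<xi> \<in> space \<sigma>"
    then have \<xi>: "norm \<xi> = 1" by (simp add: space_\<sigma>)
    have "(LINT r|lborel. polar_density (\<xi>, r) *\<^sub>R ?g (polar_map (\<xi>, r))) =
        (LINT r|lborel. (indicator {1..} r *\<^sub>R (r * lamperti_density \<alpha> (f \<xi>) r)) *\<^sub>R \<xi>)"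
    proof (rule Bochner_Integration.integral_cong[OF refl])
      fix r :: real
      show "polar_density (\<xi>, r) *\<^sub>R ?g (polar_map (\<xi>, r)) =
          (indicator {1..} r *\<^sub>R (r * lamperti_density \<alpha> (f \<xi>) r)) *\<^sub>R \<xi>"
        using \<xi> by (auto simp: polar_density_def polar_map_def indicator_def mult.commute)
    qed
    also have "\<dots> = (LINT r:{1..}|lborel. r * lamperti_density \<alpha> (f \<xi>) r) *\<^sub>R \<xi>"
    proof -
      have "integrable lborel (\<lambda>r. indicator {1..} r *\<^sub>R (r * lamperti_density \<alpha> (f \<xi>) r))"
      proof (rule integrableI_bounded)
        show "(\<lambda>r. indicator {1..} r *\<^sub>R (r * lamperti_density \<alpha> (f \<xi>) r)) \<in> borel_measurable lborel"
          unfolding lamperti_density_def by measurable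
        obtain C where C: "0 \<le> C"
          "\<And>\<xi>. \<xi> \<in> sphere 0 1 \<Longrightarrow> (\<integral>\<^sup>+r\<in>{0<..}. ennreal (r\<^sup>2 * lamperti_density \<alpha> (f \<xi>) r) \<partial>lborel) \<le> ennreal C"
          using radial_second_moment_finite by blast
        have "(\<integral>\<^sup>+r. ennreal (norm (indicator {1..} r *\<^sub>R (r * lamperti_density \<alpha> (f \<xi>) r))) \<partial>lborel) \<le>
            (\<integral>\<^sup>+r\<in>{0<..}. ennreal (r\<^sup>2 * lamperti_density \<alpha> (f \<xi>) r) \<partial>lborel)"
        proof (rule nn_integral_mono)
          fix r :: real
          have "r * lamperti_density \<alpha> (f \<xi>) r \<le> r\<^sup>2 * lamperti_density \<alpha> (f \<xi>) r" if "1 \<le> r"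
            using that by (intro mult_right_mono lamperti_density_nonneg) (simp add: power2_eq_square)
          then show "ennreal (norm (indicator {1..} r *\<^sub>R (r * lamperti_density \<alpha> (f \<xi>) r))) \<le>
              ennreal (r\<^sup>2 * lamperti_density \<alpha> (f \<xi>) r) * indicator {0<..} r"
            by (auto simp: indicator_def lamperti_density_nonneg abs_mult intro!: ennreal_leI)
        qed
        also have "\<dots> \<le> ennreal C" using \<xi> by (intro C(2)) simp
        finally show "(\<integral>\<^sup>+r. ennreal (norm (indicator {1..} r *\<^sub>R (r * lamperti_density \<alpha> (f \<xi>) r))) \<partial>lborel) < \<infinity>"
          by (rule le_less_trans) simp
      qed
      then show ?thesis
        unfolding set_lebesgue_integral_def by (rule integral_scaleR_left)
    qed
    finally show "(LINT r|lborel. polar_density (\<xi>, r) *\<^sub>R ?g (polar_map (\<xi>, r))) =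
        (LINT r:{1..}|lborel. r * lamperti_density \<alpha> (f \<xi>) r) *\<^sub>R \<xi>" .
  qed
  finally show ?thesis by (simp add: lamperti_drift_def)
qed

end

section \<open>The exponent of the centred process and its scaling limit\<close>

context lamperti_measure
begin

definition centred_exponent :: "real ^ 'd \<Rightarrow> complex" where
  "centred_exponent y = (LINT x|\<nu>. 1 - iexp (y \<bullet> x) + \<i> * complex_of_real (y \<bullet> x))"

definition jump_variance :: "real ^ 'd \<Rightarrow> real" where
  "jump_variance y = (LINT x|\<nu>. (y \<bullet> x)\<^sup>2)"

lemma inner_squared_le: "(y \<bullet> x)\<^sup>2 \<le> (norm y)\<^sup>2 * (norm x)\<^sup>2" for x y :: "real ^ 'd"
  using power_mono[OF Cauchy_Schwarz_ineq2[of y x], of 2] by (simp add: power_mult_distrib)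

lemma integrable_inner_squared: "integrable \<nu> (\<lambda>x. (y \<bullet> x)\<^sup>2)"
  by (rule integrable_quadratic_bound[of _ "(norm y)\<^sup>2"]) (simp_all add: inner_squared_le)

lemma jump_variance_nonneg: "0 \<le> jump_variance y"
  unfolding jump_variance_def by (rule integral_nonneg_AE) simp

lemma jump_variance_scale: "jump_variance (c *\<^sub>R y) = c\<^sup>2 * jump_variance y"
  unfolding jump_variance_def by (simp add: power_mult_distrib)

lemma integrable_centred: "integrable \<nu> (\<lambda>x. 1 - iexp (y \<bullet> x) + \<i> * complex_of_real (y \<bullet> x))"
proof (rule integrable_quadratic_bound[of _ "(norm y)\<^sup>2"])
  fix x
  show "cmod (1 - iexp (y \<bullet> x) + \<i> * complex_of_real (y \<bullet> x)) \<le> (norm y)\<^sup>2 * (norm x)\<^sup>2"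
    using iexp_quadratic_error[of "y \<bullet> x"] inner_squared_le[of y x] zero_le_power2[of "y \<bullet> x"] by linarith
qed measurable

lemma lamperti_exponent_compensated:
  "lamperti_exponent \<alpha> f \<sigma> 0 y + \<i> * complex_of_real (y \<bullet> lamperti_drift \<alpha> f \<sigma>) = centred_exponent y"
proof -
  let ?s = "\<lambda>x. 1 - iexp (y \<bullet> x) + \<i> * complex_of_real (y \<bullet> x) * indicator {x. norm x < 1} x"
  let ?b = "\<lambda>x. \<i> * complex_of_real (y \<bullet> (indicator {x. 1 \<le> norm x} x *\<^sub>R x))"
  have T: "bounded_linear (\<lambda>v. \<i> * complex_of_real (y \<bullet> v))"
    by (intro bounded_linear_const_mult bounded_linear_compose[OF bounded_linear_of_real] bounded_linear_inner_right)
  have b: "integrable \<nu> ?b"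
    by (rule integrable_bounded_linear[OF T integrable_big_jumps])
  have s_eq: "?s x = (1 - iexp (y \<bullet> x) + \<i> * complex_of_real (y \<bullet> x)) - ?b x" for x
    by (auto simp: indicator_def)
  have s: "integrable \<nu> ?s"
    unfolding s_eq by (rule Bochner_Integration.integrable_diff[OF integrable_centred b])
  have "\<i> * complex_of_real (y \<bullet> lamperti_drift \<alpha> f \<sigma>) = integral\<^sup>L \<nu> ?b"
    unfolding integral_big_jumps[symmetric] by (rule integral_bounded_linear[OF T integrable_big_jumps, symmetric])
  then have "lamperti_exponent \<alpha> f \<sigma> 0 y + \<i> * complex_of_real (y \<bullet> lamperti_drift \<alpha> f \<sigma>) =
      integral\<^sup>L \<nu> ?s + integral\<^sup>L \<nu> ?b"
    by (simp add: lamperti_exponent_def)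
  also have "\<dots> = integral\<^sup>L \<nu> (\<lambda>x. ?s x + ?b x)"
    by (rule Bochner_Integration.integral_add[OF s b, symmetric])
  also have "\<dots> = centred_exponent y"
    unfolding s_eq centred_exponent_def by simp
  finally show ?thesis .
qed

lemma centred_exponent_bound: "cmod (centred_exponent y) \<le> jump_variance y / 2"
proof -
  have "cmod (centred_exponent y) \<le> (LINT x|\<nu>. cmod (1 - iexp (y \<bullet> x) + \<i> * complex_of_real (y \<bullet> x)))"
    unfolding centred_exponent_def by (rule integral_norm_bound)
  also have "\<dots> \<le> (LINT x|\<nu>. (y \<bullet> x)\<^sup>2 / 2)"
    by (intro integral_mono integrable_norm integrable_centred integrable_divide integrable_inner_squared iexp_quadratic_error)
  finally show ?thesis by (simp add: jump_variance_def)
qed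

text \<open>Dominated convergence: with \<open>v = <y,x> / sqrt h\<close> the integrand is \<open>h (1 - exp(i v) + i v)\<close>, which is bounded
by \<open>h v\<^sup>2/2 = <y,x>\<^sup>2/2\<close> and differs from it by at most \<open>h |v|\<^sup>3/6 = |<y,x>|\<^sup>3 / (6 sqrt h)\<close>.\<close>
lemma centred_exponent_scaling_limit:
  "((\<lambda>h. complex_of_real h * centred_exponent (h powr (- 1 / 2) *\<^sub>R y)) \<longlongrightarrow> complex_of_real (jump_variance y / 2)) at_top"
proof -
  define v where "v h x = h powr (- 1 / 2) * (y \<bullet> x)" for h x
  \<comment> \<open>with \<open>max 1 h\<close> in place of \<open>h\<close> the identity \<open>h v\<^sup>2 = <y,x>\<^sup>2\<close> is available for every index\<close>
  define k where "k h x = complex_of_real (max 1 h) * (1 - iexp (v (max 1 h) x) + \<i> * complex_of_real (v (max 1 h) x))" for h x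
  have hv: "h * (v h x)\<^sup>2 = (y \<bullet> x)\<^sup>2" if "0 < h" for h x
  proof -
    have "(h powr (- 1 / 2))\<^sup>2 = h powr (- 1)"
      by (simp add: power2_eq_square powr_add[symmetric])
    also have "\<dots> = inverse h" using that by (simp add: powr_minus)
    finally show ?thesis using that by (simp add: v_def power_mult_distrib)
  qed
  have "((\<lambda>h. integral\<^sup>L \<nu> (k h)) \<longlongrightarrow> (LINT x|\<nu>. complex_of_real ((y \<bullet> x)\<^sup>2 / 2))) at_top"
  proof (rule integral_dominated_convergence_at_top[where w = "\<lambda>x. (y \<bullet> x)\<^sup>2 / 2"])
    show "integrable \<nu> (\<lambda>x. (y \<bullet> x)\<^sup>2 / 2)"
      by (intro integrable_divide integrable_inner_squared)
    show "(\<lambda>x. complex_of_real ((y \<bullet> x)\<^sup>2 / 2)) \<in> borel_measurable \<nu>"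
      by (rule lamperti_measurable) measurable
    show "k h \<in> borel_measurable \<nu>" for h
      unfolding k_def v_def by (rule lamperti_measurable) measurable
    have "cmod (k h x) \<le> (y \<bullet> x)\<^sup>2 / 2" for h x
    proof -
      have "cmod (k h x) \<le> max 1 h * ((v (max 1 h) x)\<^sup>2 / 2)"
        unfolding k_def norm_mult by (intro mult_mono iexp_quadratic_error) auto
      also have "\<dots> = (y \<bullet> x)\<^sup>2 / 2"
        using hv[of "max 1 h" x] by simp
      finally show ?thesis .
    qed
    then show "\<forall>\<^sub>F h in at_top. AE x in \<nu>. cmod (k h x) \<le> (y \<bullet> x)\<^sup>2 / 2"
      by (intro always_eventually allI AE_I2)
    show "AE x in \<nu>. ((\<lambda>h. k h x) \<longlongrightarrow> complex_of_real ((y \<bullet> x)\<^sup>2 / 2)) at_top"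
    proof (rule AE_I2)
      fix x
      have "((\<lambda>h::real. \<bar>y \<bullet> x\<bar> ^ 3 / 6 * h powr (- 1 / 2)) \<longlongrightarrow> \<bar>y \<bullet> x\<bar> ^ 3 / 6 * 0) at_top"
        by (intro tendsto_mult tendsto_const tendsto_neg_powr filterlim_ident) auto
      then have lim: "((\<lambda>h::real. \<bar>y \<bullet> x\<bar> ^ 3 / 6 * h powr (- 1 / 2)) \<longlongrightarrow> 0) at_top" by simp
      have "\<forall>\<^sub>F h in at_top. norm (k h x - complex_of_real ((y \<bullet> x)\<^sup>2 / 2)) \<le> \<bar>y \<bullet> x\<bar> ^ 3 / 6 * h powr (- 1 / 2)"
        using eventually_ge_at_top[of 1]
      proof eventually_elim
        case (elim h)
        then have h: "0 < h" "max 1 h = h" by auto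
        have "k h x - complex_of_real ((y \<bullet> x)\<^sup>2 / 2) =
            complex_of_real h * (1 - iexp (v h x) + \<i> * complex_of_real (v h x) - complex_of_real ((v h x)\<^sup>2 / 2))"
          unfolding k_def h(2) hv[OF h(1), of x, symmetric] by (simp add: right_diff_distrib)
        then have "norm (k h x - complex_of_real ((y \<bullet> x)\<^sup>2 / 2)) \<le> h * (\<bar>v h x\<bar> ^ 3 / 6)"
          using iexp_cubic_error[of "v h x"] h(1) by (simp only: norm_mult norm_of_real abs_of_pos mult_left_mono less_imp_le)
        also have "\<dots> = (h * (v h x)\<^sup>2) * \<bar>v h x\<bar> / 6"
          by (simp add: power3_eq_cube power2_eq_square)
        also have "\<dots> = (y \<bullet> x)\<^sup>2 * \<bar>v h x\<bar> / 6"
          by (simp only: hv[OF h(1)])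
        also have "\<dots> = \<bar>y \<bullet> x\<bar> ^ 3 / 6 * h powr (- 1 / 2)"
          by (simp add: v_def abs_mult power3_eq_cube power2_eq_square)
        finally show ?case .
      qed
      then have "((\<lambda>h. k h x - complex_of_real ((y \<bullet> x)\<^sup>2 / 2)) \<longlongrightarrow> 0) at_top"
        by (rule Lim_null_comparison[OF _ lim])
      then show "((\<lambda>h. k h x) \<longlongrightarrow> complex_of_real ((y \<bullet> x)\<^sup>2 / 2)) at_top"
        by (rule LIM_zero_cancel)
    qed
  qed
  moreover have "(LINT x|\<nu>. complex_of_real ((y \<bullet> x)\<^sup>2 / 2)) = complex_of_real (jump_variance y / 2)"
    by (subst integral_complex_of_real) (simp add: jump_variance_def)
  moreover have "\<forall>\<^sub>F h in at_top. integral\<^sup>L \<nu> (k h) = complex_of_real h * centred_exponent (h powr (- 1 / 2) *\<^sub>R y)"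
    using eventually_ge_at_top[of 1]
  proof eventually_elim
    case (elim h)
    then have h: "max 1 h = h" by auto
    show ?case
      unfolding k_def h centred_exponent_def v_def by (simp only: integral_mult_right_zero inner_scaleR_left)
  qed
  ultimately show ?thesis
    by (simp only: tendsto_cong)
qed

lemma covariance_quadratic_form: "y \<bullet> (lamperti_covariance \<alpha> f \<sigma> *v y) = jump_variance y"
proof -
  let ?Q = "\<lambda>x :: real ^ 'd. (\<chi> i j. x $ i * x $ j) :: real ^ 'd ^ 'd"
  have norm_Q: "norm (?Q x) \<le> 1 * (norm x)\<^sup>2" for x
  proof -
    have row: "?Q x $ i = (x $ i) *\<^sub>R x" for i
      by (simp add: vec_eq_iff)
    have "norm (?Q x) = L2_set (\<lambda>i. norm x * norm (x $ i)) UNIV"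
      unfolding norm_vec_def[of "?Q x"] row by (simp add: mult.commute)
    also have "\<dots> = norm x * L2_set (\<lambda>i. norm (x $ i)) UNIV"
      by (rule L2_set_right_distrib[symmetric]) simp
    also have "L2_set (\<lambda>i. norm (x $ i)) UNIV = norm x"
      by (rule norm_vec_def[symmetric])
    finally show ?thesis by (simp add: power2_eq_square)
  qed
  have "continuous_on UNIV ?Q"
    by (intro continuous_intros)
  then have Q: "integrable \<nu> ?Q"
    by (intro integrable_quadratic_bound[OF _ norm_Q] borel_measurable_continuous_onI)
  have T: "bounded_linear (\<lambda>A :: real ^ 'd ^ 'd. y \<bullet> (A *v y))"
    unfolding linear_conv_bounded_linear[symmetric]
    by (intro linearI) (simp_all add: matrix_vector_mult_add_rdistrib inner_add_right scaleR_matrix_vector_assoc[symmetric])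
  have "y \<bullet> (?Q x *v y) = (y \<bullet> x)\<^sup>2" for x
    by (simp add: inner_vec_def matrix_vector_mult_def power2_eq_square sum_product sum_distrib_left mult_ac)
  then show ?thesis
    using integral_bounded_linear[OF T Q] by (simp add: lamperti_covariance_def jump_variance_def)
qed

end

section \<open>Rescaled Lamperti stable processes and their Brownian limit\<close>

lemma levy_increment_char:
  fixes X :: "real \<Rightarrow> 'w \<Rightarrow> real ^ 'd"
  assumes X: "levy_process M X" and s: "0 \<le> s" "0 \<le> t"
  shows "(LINT \<omega>|M. iexp (u \<bullet> (X (s + t) \<omega> - X s \<omega>))) = (LINT \<omega>|M. iexp (u \<bullet> X t \<omega>))"
proof -
  have X_meas[measurable]: "X r \<in> borel_measurable M" if "0 \<le> r" for r
    using X that by (simp add: levy_process_def)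
  have [measurable]: "X (s + t) \<in> borel_measurable M" "X s \<in> borel_measurable M" "X t \<in> borel_measurable M" "X 0 \<in> borel_measurable M"
    using s by (auto intro: X_meas)
  have "(LINT \<omega>|M. iexp (u \<bullet> (X (s + t) \<omega> - X s \<omega>))) =
      (LINT x|distr M borel (\<lambda>\<omega>. X (s + t) \<omega> - X s \<omega>). iexp (u \<bullet> x))"
    by (rule integral_distr[symmetric]) measurable
  also have "\<dots> = (LINT x|distr M borel (\<lambda>\<omega>. X t \<omega> - X 0 \<omega>). iexp (u \<bullet> x))"
    using X s by (simp add: levy_process_def)
  also have "\<dots> = (LINT \<omega>|M. iexp (u \<bullet> (X t \<omega> - X 0 \<omega>)))"
    by (rule integral_distr) measurable
  also have "\<dots> = (LINT \<omega>|M. iexp (u \<bullet> X t \<omega>))"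
  proof (rule integral_cong_AE)
    have "AE \<omega> in M. X 0 \<omega> = 0" using X by (simp add: levy_process_def)
    then show "AE \<omega> in M. iexp (u \<bullet> (X t \<omega> - X 0 \<omega>)) = iexp (u \<bullet> X t \<omega>)"
      by eventually_elim simp
  qed measurable
  finally show ?thesis .
qed

lemma cadlag_rescale:
  fixes x :: "real \<Rightarrow> 'a::real_normed_vector"
  assumes x: "cadlag x" and h: "0 < h"
  shows "cadlag (\<lambda>t. c *\<^sub>R (x (h * t) - (h * t) *\<^sub>R d))"
  unfolding cadlag_def
proof (intro conjI allI impI)
  fix t :: real assume "0 \<le> t"
  then have "(x \<longlongrightarrow> x (h * t)) (at_right (h * t))"
    using x h by (simp add: cadlag_def)
  moreover have "filterlim (\<lambda>u. h * u) (at_right (h * t)) (at_right t)"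
    using h filtermap_times_pos_at_right[of h t] by (simp add: filterlim_def)
  ultimately have "((\<lambda>u. x (h * u)) \<longlongrightarrow> x (h * t)) (at_right t)"
    by (rule filterlim_compose)
  then show "((\<lambda>u. c *\<^sub>R (x (h * u) - (h * u) *\<^sub>R d)) \<longlongrightarrow> c *\<^sub>R (x (h * t) - (h * t) *\<^sub>R d)) (at_right t)"
    by (intro tendsto_intros)
next
  fix t :: real assume "0 < t"
  then have "0 < h * t" using h by simp
  then obtain l where "(x \<longlongrightarrow> l) (at_left (h * t))"
    using x unfolding cadlag_def by blast
  moreover have "filterlim (\<lambda>u. h * u) (at_left (h * t)) (at_left t)"
    unfolding filterlim_at
    using h by (auto intro!: tendsto_intros eventually_at_leftI[of "t - 1"])
  ultimately have "((\<lambda>u. x (h * u)) \<longlongrightarrow> l) (at_left t)"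
    by (rule filterlim_compose)
  then have "((\<lambda>u. c *\<^sub>R (x (h * u) - (h * u) *\<^sub>R d)) \<longlongrightarrow> c *\<^sub>R (l - (h * t) *\<^sub>R d)) (at_left t)"
    by (intro tendsto_intros)
  then show "\<exists>l. ((\<lambda>u. c *\<^sub>R (x (h * u) - (h * u) *\<^sub>R d)) \<longlongrightarrow> l) (at_left t)" by blast
qed

locale lamperti_stable_process = lamperti_measure \<alpha> f \<sigma>
  for \<alpha> :: real and f :: "real ^ 'd \<Rightarrow> real" and \<sigma> :: "(real ^ 'd) measure" +
  fixes M :: "'w measure" and X :: "real \<Rightarrow> 'w \<Rightarrow> real ^ 'd"
  assumes stable: "lamperti_stable M X \<alpha> f \<sigma> 0"
begin

definition rescaled :: "real \<Rightarrow> real \<Rightarrow> 'w \<Rightarrow> real ^ 'd" where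
  "rescaled h t \<omega> = h powr (- 1 / 2) *\<^sub>R (X (h * t) \<omega> - (h * t) *\<^sub>R lamperti_drift \<alpha> f \<sigma>)"

lemma levy: "levy_process M X"
  using stable by (simp add: lamperti_stable_def)

sublocale prob_space M
  using levy by (simp add: levy_process_def)

lemma X_measurable [measurable]: "0 \<le> t \<Longrightarrow> X t \<in> borel_measurable M"
  using levy by (simp add: levy_process_def)

lemma rescaled_measurable:
  assumes "0 < h" "0 \<le> t"
  shows "rescaled h t \<in> borel_measurable M"
proof -
  have [measurable]: "X (h * t) \<in> borel_measurable M"
    using assms by (intro X_measurable) simp
  show ?thesis unfolding rescaled_def[abs_def] by measurable
qed

lemma rescaled_increment:
  "rescaled h t \<omega> - rescaled h s \<omega> =
    h powr (- 1 / 2) *\<^sub>R (X (h * t) \<omega> - X (h * s) \<omega>) - (h powr (- 1 / 2) * (h * (t - s))) *\<^sub>R lamperti_drift \<alpha> f \<sigma>"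
  by (simp add: rescaled_def algebra_simps)

lemma rescaled_increment_char:
  assumes h: "0 < h" and s: "0 \<le> s" "s \<le> t"
  shows "(LINT \<omega>|M. iexp (u \<bullet> (rescaled h t \<omega> - rescaled h s \<omega>))) =
    exp (- (complex_of_real (t - s) * (complex_of_real h * centred_exponent (h powr (- 1 / 2) *\<^sub>R u))))"
proof -
  let ?u = "h powr (- 1 / 2) *\<^sub>R u" and ?\<tau> = "h * (t - s)" and ?\<eta> = "lamperti_drift \<alpha> f \<sigma>"
  have \<tau>: "0 \<le> ?\<tau>" "0 \<le> h * s" "h * s + ?\<tau> = h * t"
    using h s by (auto simp: algebra_simps)
  have "(LINT \<omega>|M. iexp (u \<bullet> (rescaled h t \<omega> - rescaled h s \<omega>))) =
      (LINT \<omega>|M. iexp (?u \<bullet> (X (h * s + ?\<tau>) \<omega> - X (h * s) \<omega>)) * iexp (- (?\<tau> * (?u \<bullet> ?\<eta>))))"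
    unfolding \<tau>(3) rescaled_increment by (simp add: inner_diff_right exp_add[symmetric] algebra_simps)
  also have "\<dots> = (LINT \<omega>|M. iexp (?u \<bullet> X ?\<tau> \<omega>)) * iexp (- (?\<tau> * (?u \<bullet> ?\<eta>)))"
    by (simp only: integral_mult_left_zero levy_increment_char[OF levy \<tau>(2,1)])
  also have "(LINT \<omega>|M. iexp (?u \<bullet> X ?\<tau> \<omega>)) = exp (- (complex_of_real ?\<tau> * lamperti_exponent \<alpha> f \<sigma> 0 ?u))"
    using stable[unfolded lamperti_stable_def] \<tau>(1) by blast
  also have "exp (- (complex_of_real ?\<tau> * lamperti_exponent \<alpha> f \<sigma> 0 ?u)) * iexp (- (?\<tau> * (?u \<bullet> ?\<eta>))) =
      exp (- (complex_of_real ?\<tau> * (lamperti_exponent \<alpha> f \<sigma> 0 ?u + \<i> * complex_of_real (?u \<bullet> ?\<eta>))))"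
    unfolding exp_add[symmetric] by (rule arg_cong[where f = exp]) (simp only: of_real_mult of_real_minus; algebra)
  also have "\<dots> = exp (- (complex_of_real (t - s) * (complex_of_real h * centred_exponent ?u)))"
    unfolding lamperti_exponent_compensated by (simp add: mult_ac)
  finally show ?thesis .
qed

text \<open>The estimate \<open>|\<psi>(u)| \<le> \<integral> <u,x>\<^sup>2 \<nu>(dx) / 2\<close> is invariant under the scaling \<open>h \<psi>(u / sqrt h)\<close>, which makes the
tail bound uniform in \<open>h\<close>. The moments of the increments are not given and are recovered from the
characteristic function, one coordinate at a time.\<close>
lemma rescaled_chebyshev:
  assumes h: "0 < h" and s: "0 \<le> s" "s \<le> t" and r: "0 < r"
  shows "prob {\<omega> \<in> space M. r < norm (rescaled h t \<omega> - rescaled h s \<omega>)}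
    \<le> (\<Sum>b\<in>Basis. jump_variance b) * (t - s) / r\<^sup>2"
proof -
  let ?V = "\<lambda>\<omega>. rescaled h t \<omega> - rescaled h s \<omega>"
  have [measurable]: "rescaled h t \<in> borel_measurable M" "rescaled h s \<in> borel_measurable M"
    using h s by (auto intro: rescaled_measurable)
  have V: "?V \<in> borel_measurable M" by measurable
  have "prob {\<omega> \<in> space M. r < norm (?V \<omega>)} \<le> (\<Sum>b\<in>Basis. 2 * ((t - s) * jump_variance b / 2)) / r\<^sup>2"
  proof (rule chebyshev_from_char[OF V])
    fix b :: "real ^ 'd" and \<theta> :: real
    let ?u = "\<theta> *\<^sub>R b"
    let ?z = "complex_of_real (t - s) * (complex_of_real h * centred_exponent (h powr (- 1 / 2) *\<^sub>R ?u))"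
    let ?a = "(t - s) * jump_variance b / 2 * \<theta>\<^sup>2"
    have "(h powr (- 1 / 2))\<^sup>2 = h powr (- 1)"
      by (simp add: power2_eq_square powr_add[symmetric])
    also have "\<dots> = inverse h" using h by (simp add: powr_minus)
    finally have hh: "(h powr (- 1 / 2))\<^sup>2 = inverse h" .
    have "cmod (centred_exponent (h powr (- 1 / 2) *\<^sub>R ?u)) \<le> inverse h * (\<theta>\<^sup>2 * jump_variance b) / 2"
      using centred_exponent_bound[of "h powr (- 1 / 2) *\<^sub>R ?u"] by (simp only: jump_variance_scale hh)
    then have "(t - s) * (h * cmod (centred_exponent (h powr (- 1 / 2) *\<^sub>R ?u))) \<le>
        (t - s) * (h * (inverse h * (\<theta>\<^sup>2 * jump_variance b) / 2))"
      using h s by (intro mult_left_mono) auto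
    also have "\<dots> = ?a" using h by simp
    finally have z: "cmod ?z \<le> ?a"
      using h s by (simp add: norm_mult del: of_real_diff)
    have int: "complex_integrable M (\<lambda>\<omega>. iexp (?u \<bullet> ?V \<omega>))"
      by (intro integrable_const_bound[of _ 1]) auto
    have "expectation (\<lambda>\<omega>. 1 - cos (\<theta> * (b \<bullet> ?V \<omega>))) = expectation (\<lambda>\<omega>. Re (1 - iexp (?u \<bullet> ?V \<omega>)))"
      by (simp add: Re_exp)
    also have "\<dots> = Re (LINT \<omega>|M. 1 - iexp (?u \<bullet> ?V \<omega>))"
      using int by (intro integral_Re) simp
    also have "(LINT \<omega>|M. 1 - iexp (?u \<bullet> ?V \<omega>)) = 1 - exp (- ?z)"
      using int rescaled_increment_char[OF h s, of ?u] by (simp add: prob_space)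
    also have "Re (1 - exp (- ?z)) \<le> cmod (exp (- ?z) - 1)"
      using complex_Re_le_cmod[of "1 - exp (- ?z)"] by (simp only: norm_minus_commute)
    also have "\<dots> \<le> exp (cmod ?z) * cmod ?z"
      using Taylor_exp_field[of "- ?z" 0] by simp
    also have "\<dots> \<le> exp ?a * ?a"
      using z by (intro mult_mono) (auto intro: order_trans[OF norm_ge_zero])
    finally show "expectation (\<lambda>\<omega>. 1 - cos (\<theta> * (b \<bullet> ?V \<omega>))) \<le>
        (t - s) * jump_variance b / 2 * \<theta>\<^sup>2 * exp ((t - s) * jump_variance b / 2 * \<theta>\<^sup>2)"
      by (simp only: mult.commute)
  qed (use s r jump_variance_nonneg in auto)
  also have "(\<Sum>b\<in>Basis. 2 * ((t - s) * jump_variance b / 2)) = (\<Sum>b\<in>Basis. jump_variance b) * (t - s)"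
    by (simp add: sum_distrib_left[symmetric] mult.commute)
  finally show ?thesis .
qed

lemma rescaled_cadlag: "0 < h \<Longrightarrow> \<omega> \<in> space M \<Longrightarrow> cadlag (\<lambda>t. rescaled h t \<omega>)"
  unfolding rescaled_def using levy by (intro cadlag_rescale) (simp_all add: levy_process_def)

lemma rescaled_independent_increments:
  assumes h: "0 < h"
  shows "independent_increments M (rescaled h)"
  unfolding independent_increments_def
proof (intro allI impI)
  fix n :: nat and t :: "nat \<Rightarrow> real" assume t: "0 \<le> t 0 \<and> mono_on {..n} t"
  have "0 \<le> h * t 0 \<and> mono_on {..n} (\<lambda>i. h * t i)"
    using t h by (auto simp: mono_on_def)
  moreover have "independent_increments M X"
    using levy by (simp add: levy_process_def)
  ultimately have X: "indep_vars (\<lambda>_. borel) (\<lambda>i \<omega>. X (h * t (Suc i)) \<omega> - X (h * t i) \<omega>) {..<n}"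
    unfolding independent_increments_def by (elim allE[of _ n] allE[of _ "\<lambda>i. h * t i"]) simp
  show "indep_vars (\<lambda>_. borel) (\<lambda>i \<omega>. rescaled h (t (Suc i)) \<omega> - rescaled h (t i) \<omega>) {..<n}"
    unfolding rescaled_increment
    by (rule indep_vars_compose2[OF X, of "\<lambda>i x. h powr (- 1 / 2) *\<^sub>R x -
          (h powr (- 1 / 2) * (h * (t (Suc i) - t i))) *\<^sub>R lamperti_drift \<alpha> f \<sigma>"]) measurable
qed

lemma rescaled_starts_at_0: "AE \<omega> in M. rescaled h 0 \<omega> = 0"
proof -
  have "AE \<omega> in M. X 0 \<omega> = 0" using levy by (simp add: levy_process_def)
  then show ?thesis by eventually_elim (simp add: rescaled_def)
qed

end

text \<open>Only large \<open>h\<close> matter; replacing \<open>h\<close> by \<open>max 1 h\<close> turns the rescaled processes into a family with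
independent increments for every index of the filter, as the general limit theorem demands.\<close>
theorem theorem2:
  fixes \<alpha> :: real and f :: "real ^ 'd \<Rightarrow> real" and \<sigma> :: "(real ^ 'd) measure"
    and M :: "'w measure" and X :: "real \<Rightarrow> 'w \<Rightarrow> real ^ 'd"
    and N :: "'v measure" and W :: "real \<Rightarrow> 'v \<Rightarrow> real ^ 'd"
  assumes "0 < \<alpha>" and "\<alpha> < 2"
    and "finite_measure \<sigma>"
    and "sets \<sigma> = sets (restrict_space borel (sphere 0 1))"
    and "emeasure \<sigma> (space \<sigma>) \<noteq> 0"
    and "f \<in> borel_measurable \<sigma>"
    and "(SUP \<xi>\<in>sphere 0 1. ereal (f \<xi>)) < ereal (\<alpha> + 1)"
    and "lamperti_stable M X \<alpha> f \<sigma> 0"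
    and "centered_brownian_motion N W (lamperti_covariance \<alpha> f \<sigma>)"
  shows "skorokhod_weak_conv
           (\<lambda>h::real. path_law M
              (\<lambda>t \<omega>. h powr (- 1 / 2) *\<^sub>R (X (h * t) \<omega> - (h * t) *\<^sub>R lamperti_drift \<alpha> f \<sigma>)))
           (path_law N W) at_top"
proof -
  interpret lamperti_stable_process \<alpha> f \<sigma> M X
    using assms by (intro lamperti_stable_process.intro lamperti_measure.intro lamperti_stable_process_axioms.intro)
  note W = assms(9)[unfolded centered_brownian_motion_def]
  have [measurable]: "W t \<in> borel_measurable N" if "0 \<le> t" for t
    using W that by simp
  have W_char: "(LINT \<omega>|N. iexp (u \<bullet> (W t \<omega> - W s \<omega>))) = complex_of_real (exp (- ((t - s) * jump_variance u) / 2))"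
    if "0 \<le> s" "s \<le> t" for s t u
  proof -
    have [measurable]: "W s \<in> borel_measurable N" "W t \<in> borel_measurable N"
      using W that by auto
    have "(LINT \<omega>|N. iexp (u \<bullet> (W t \<omega> - W s \<omega>))) = (LINT x|distr N borel (\<lambda>\<omega>. W t \<omega> - W s \<omega>). iexp (u \<bullet> x))"
      by (rule integral_distr[symmetric]) measurable
    also have "\<dots> = complex_of_real (exp (- (u \<bullet> (((t - s) *\<^sub>R lamperti_covariance \<alpha> f \<sigma>) *v u)) / 2))"
      using W that unfolding centered_gaussian_def by blast
    also have "u \<bullet> (((t - s) *\<^sub>R lamperti_covariance \<alpha> f \<sigma>) *v u) = (t - s) * jump_variance u"
      by (simp add: scaleR_matrix_vector_assoc[symmetric] covariance_quadratic_form)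
    finally show ?thesis .
  qed
  have "skorokhod_weak_conv (\<lambda>h. path_law M (rescaled (max 1 h))) (path_law N W) at_top"
  proof (rule skorokhod_invariance_principle[where c = "\<Sum>b\<in>Basis. jump_variance b"])
    fix s t :: real and u :: "real ^ 'd" assume st: "0 \<le> s" "s \<le> t"
    have "((\<lambda>h. exp (- (complex_of_real (t - s) * (complex_of_real h * centred_exponent (h powr (- 1 / 2) *\<^sub>R u))))) \<longlongrightarrow>
        exp (- (complex_of_real (t - s) * complex_of_real (jump_variance u / 2)))) at_top"
      by (intro tendsto_intros centred_exponent_scaling_limit)
    also have "exp (- (complex_of_real (t - s) * complex_of_real (jump_variance u / 2))) =
        (LINT \<omega>|N. iexp (u \<bullet> (W t \<omega> - W s \<omega>)))"
      unfolding W_char[OF st] exp_of_real[symmetric] by simp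
    finally show "((\<lambda>h. LINT \<omega>|M. iexp (u \<bullet> (rescaled (max 1 h) t \<omega> - rescaled (max 1 h) s \<omega>))) \<longlongrightarrow>
        (LINT \<omega>|N. iexp (u \<bullet> (W t \<omega> - W s \<omega>)))) at_top"
    proof (rule Lim_transform_eventually)
      show "\<forall>\<^sub>F h in at_top. exp (- (complex_of_real (t - s) * (complex_of_real h * centred_exponent (h powr (- 1 / 2) *\<^sub>R u)))) =
          (LINT \<omega>|M. iexp (u \<bullet> (rescaled (max 1 h) t \<omega> - rescaled (max 1 h) s \<omega>)))"
        using eventually_ge_at_top[of 1]
      proof eventually_elim
        case (elim h)
        then have "max 1 h = h" "0 < h" by auto
        then show ?case using rescaled_increment_char[OF _ st, of h u] by simp
      qed
    qed
  next
    show "measure M {\<omega> \<in> space M. r < norm (rescaled (max 1 h) t \<omega> - rescaled (max 1 h) s \<omega>)}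
        \<le> (\<Sum>b\<in>Basis. jump_variance b) * (t - s) / r\<^sup>2" if "0 \<le> s" "s \<le> t" "0 < r" for h s t r
      using that by (intro rescaled_chebyshev) auto
    show "prob_space M" by (rule prob_space_axioms)
    show "rescaled (max 1 h) t \<in> borel_measurable M" if "0 \<le> t" for h t
      using that by (intro rescaled_measurable) auto
    show "cadlag (\<lambda>t. rescaled (max 1 h) t \<omega>)" if "\<omega> \<in> space M" for h \<omega>
      using that by (intro rescaled_cadlag) auto
    show "independent_increments M (rescaled (max 1 h))" for h
      by (rule rescaled_independent_increments) simp
    show "AE \<omega> in M. rescaled (max 1 h) 0 \<omega> = 0" for h
      by (rule rescaled_starts_at_0)
  qed (use W in auto)
  then show ?thesis
    unfolding skorokhod_weak_conv_def
  proof (intro allI impI)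
    fix \<phi> :: "(real \<Rightarrow> real ^ 'd) \<Rightarrow> real"
    assume *: "\<forall>\<phi>. continuous_map skorokhod_topology euclideanreal \<phi> \<and> bounded (\<phi> ` skorokhod_paths) \<longrightarrow>
        ((\<lambda>h. integral\<^sup>L (path_law M (rescaled (max 1 h))) \<phi>) \<longlongrightarrow> integral\<^sup>L (path_law N W) \<phi>) at_top"
      and \<phi>: "continuous_map skorokhod_topology euclideanreal \<phi> \<and> bounded (\<phi> ` skorokhod_paths)"
    from *[rule_format, OF \<phi>]
    show "((\<lambda>h. integral\<^sup>L (path_law M (\<lambda>t \<omega>. h powr (- 1 / 2) *\<^sub>R (X (h * t) \<omega> - (h * t) *\<^sub>R lamperti_drift \<alpha> f \<sigma>))) \<phi>)
        \<longlongrightarrow> integral\<^sup>L (path_law N W) \<phi>) at_top"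
    proof (rule Lim_transform_eventually)
      show "\<forall>\<^sub>F h in at_top. integral\<^sup>L (path_law M (rescaled (max 1 h))) \<phi> =
          integral\<^sup>L (path_law M (\<lambda>t \<omega>. h powr (- 1 / 2) *\<^sub>R (X (h * t) \<omega> - (h * t) *\<^sub>R lamperti_drift \<alpha> f \<sigma>))) \<phi>"
        using eventually_ge_at_top[of 1]
        by eventually_elim (simp add: rescaled_def[abs_def] max_absorb2)
    qed
  qed
qed

end
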